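(* Suppose that the alternative $H_{1n}(\rho)$ holds, i.e. the innovations $\{\varepsilon_t\}$ are i.i.d. with distribution function $A_n(x)=(1-\rho_n)G_0(x)+\rho_nH(x)$, $\rho_n=\min(1,\rho n^{-1/2})$. Suppose that (i) random variables with distribution functions $G_0$ and $H$ have zero means and finite variances, and (ii) $G_0$ and $H$ are twice differentiable with bounded second derivatives; let $g_0$ be the derivative of $G_0$. Let $\Gamma\ge 0$, $R\ge 0$ and $\Theta\ge 0$ be any finite numbers. Then, for $x\in\mathbb{R}$ and for any $\delta>0$, $$ \sup_{\gamma\le\Gamma,\;\rho\le R}\mathsf{P}\Big(\sup_{|\tau_0|\le\Theta,\;|\boldsymbol{\tau}_1|\le\Theta}\big|n^{1/2}[G_n(x,\tau_0,\boldsymbol{\tau}_1)-G_n(x)]-g_0(x)\tau_0-\gamma\Delta(x,\Pi)\big|>\delta\Big)\to 0,\qquad n\to\infty, $$ where the shift is $$ \Delta(x,\Pi)=\sum_{j=0}^p\big[\mathsf{E}\,G_0(x+\beta_j\xi_1)-G_0(x)\big],\qquad \beta_0=-1. $$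
   Context: Model. Let $\boldsymbol{\beta}=(\beta_1,\dots,\beta_p)^T\in\mathbb{R}^p$ be a vector of unknown parameters such that all roots of the characteristic equation $\lambda^p-\beta_1\lambda^{p-1}-\dots-\beta_p=0$ are less than one in modulus, and let $\nu\in\mathbb{R}$ be unknown. Let $\{v_t\}_{t\in\mathbb{Z}}$ be the stationary solution of $v_t=\beta_1v_{t-1}+\dots+\beta_pv_{t-p}+\nu+\varepsilon_t$, where the innovations $\{\varepsilon_t\}$ are i.i.d. with $\mathsf{E}\,\varepsilon_1=0$ and $0<\mathsf{E}\,\varepsilon_1^2<\infty$. Let $\mu$ be defined by $\nu=(1-\beta_1-\dots-\beta_p)\mu$ and $u_t=v_t-\mu$, so that $u_t=\beta_1u_{t-1}+\dots+\beta_pu_{t-p}+\varepsilon_t$. Outliers. The observations are $y_t=v_t+z_t^{\gamma_n}\xi_t$, $t=1-p,\dots,n$, where $\{z_t^{\gamma_n}\}$ are i.i.d. random variables taking the value $1$ with probability $\gamma_n=\min(1,\gamma n^{-1/2})$ and $0$ with probability $1-\gamma_n$, with unknown $\gamma\ge0$, and $\{\xi_t\}$ are i.i.d. random variables with an arbitrary and unknown distribution $\Pi$. $G_0$ and $H$ are distribution functions and $\rho\ge0$. Under $H_{1n}(\rho)$ the distribution of the innovations, $A_n$, depends on $n$. Notation. $I(\cdot)$ is the indicator of an event, $|\cdot|$ the Euclidean norm, $\tilde{\boldsymbol{u}}_{t-1}=(u_{t-1},\dots,u_{t-p})^T$, and $$\alpha_{tn}=z_t^{\gamma_n}\xi_t-\sum_{j=1}^p\beta_jz_{t-j}^{\gamma_n}\xi_{t-j}.$$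 The empirical distribution function of the (unobservable) innovations is $G_n(x)=n^{-1}\sum_{t=1}^nI(\varepsilon_t\le x)$. For $\tau_0\in\mathbb{R}$ and $\boldsymbol{\tau}_1=(\tau_1,\dots,\tau_p)^T\in\mathbb{R}^p$, $$ G_n(x,\tau_0,\boldsymbol{\tau}_1)=n^{-1}\sum_{t=1}^nI\Big(\varepsilon_t\le x+n^{-1/2}\boldsymbol{\tau}_1^T\tilde{\boldsymbol{u}}_{t-1}+n^{-1/2}\tau_0-\alpha_{tn}+\sum_{j=1}^pn^{-1/2}\tau_jz_{t-j}^{\gamma_n}\xi_{t-j}\Big). $$
   Formalization: The sequences of innovations, outlier indicators z_t and outlier sizes ξ_t are additionally assumed mutually independent; each being i.i.d. alone is not enough (ξ_t = 2ε_t gives a different shift). *)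

theory Defs
  imports "HOL-Probability.Probability"
begin

text \<open>
  A vector in $\mathbb{R}^p$ is a function \<open>nat \<Rightarrow> real\<close> of which only the values
  at \<open>1..p\<close> matter; its Euclidean norm is \<open>L2_set _ {1..p}\<close>.
\<close>

definition local_rate :: "real \<Rightarrow> nat \<Rightarrow> real" where
  "local_rate c n = min 1 (c / sqrt (real n))"

definition mixture_cdf :: "(real \<Rightarrow> real) \<Rightarrow> (real \<Rightarrow> real) \<Rightarrow> real \<Rightarrow> nat \<Rightarrow> real \<Rightarrow> real" where
  "mixture_cdf G H \<rho> n x = (1 - local_rate \<rho> n) * G x + local_rate \<rho> n * H x"

definition char_roots_inside :: "nat \<Rightarrow> (nat \<Rightarrow> real) \<Rightarrow> bool" where
  "char_roots_inside p \<beta> \<longleftrightarrow>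
     (\<forall>w::complex. w ^ p - (\<Sum>j=1..p. of_real (\<beta> j) * w ^ (p - j)) = 0 \<longrightarrow> cmod w < 1)"

definition strictly_stationary :: "'w measure \<Rightarrow> (int \<Rightarrow> 'w \<Rightarrow> real) \<Rightarrow> bool" where
  "strictly_stationary M X \<longleftrightarrow>
     (\<forall>t. X t \<in> borel_measurable M) \<and>
     (\<forall>h. distr M (Pi\<^sub>M UNIV (\<lambda>_. borel)) (\<lambda>\<omega> t. X (t + h) \<omega>) =
          distr M (Pi\<^sub>M UNIV (\<lambda>_. borel)) (\<lambda>\<omega> t. X t \<omega>))"

definition stationary_ar_solution ::
  "'w measure \<Rightarrow> nat \<Rightarrow> (nat \<Rightarrow> real) \<Rightarrow> real \<Rightarrow> (int \<Rightarrow> 'w \<Rightarrow> real) \<Rightarrow> (int \<Rightarrow> 'w \<Rightarrow> real) \<Rightarrow> bool" where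
  "stationary_ar_solution M p \<beta> \<nu> \<epsilon> v \<longleftrightarrow>
     strictly_stationary M v \<and>
     (AE \<omega> in M. \<forall>t. v t \<omega> = (\<Sum>j=1..p. \<beta> j * v (t - int j) \<omega>) + \<nu> + \<epsilon> t \<omega>)"

text \<open>
  The model for one sample size \<open>n\<close> and one pair \<open>(\<gamma>, \<rho>)\<close>. Innovations \<open>\<epsilon>\<close> and the process \<open>v\<close>
  are indexed by all integers; the outlier indicators \<open>z\<close> and outlier sizes \<open>\<xi>\<close> are constrained
  only at the observation times \<open>1 - p, \<dots>, n\<close>. The single independence assumption, over the
  disjoint sum of the three index sets, says that each of the sequences \<open>\<epsilon>\<close>, \<open>z\<close>, \<open>\<xi>\<close> is
  independent and that the three sequences are mutually independent.
\<close>

locale ar_outlier_model = prob_space M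
  for M :: "'w measure"
    and p :: nat and \<beta> :: "nat \<Rightarrow> real" and \<nu> :: real
    and G0 H :: "real \<Rightarrow> real" and P\<xi> :: "real measure"
    and n :: nat and \<gamma> \<rho> :: real
    and \<epsilon> v z \<xi> :: "int \<Rightarrow> 'w \<Rightarrow> real" +
  assumes indep:
      "indep_vars (\<lambda>_. borel) (case_sum \<epsilon> (case_sum z \<xi>))
         (UNIV <+> {1 - int p..int n} <+> {1 - int p..int n})"
    and innovation_cdf: "\<And>t. cdf (distr M borel (\<epsilon> t)) = mixture_cdf G0 H \<rho> n"
    and indicator_one:
      "\<And>t. t \<in> {1 - int p..int n} \<Longrightarrow> prob {\<omega> \<in> space M. z t \<omega> = 1} = local_rate \<gamma> n"
    and indicator_zero:
      "\<And>t. t \<in> {1 - int p..int n} \<Longrightarrow> prob {\<omega> \<in> space M. z t \<omega> = 0} = 1 - local_rate \<gamma> n"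
    and outlier_law: "\<And>t. t \<in> {1 - int p..int n} \<Longrightarrow> distr M borel (\<xi> t) = P\<xi>"
    and stationary_solution: "stationary_ar_solution M p \<beta> \<nu> \<epsilon> v"

definition outlier_term ::
  "nat \<Rightarrow> (nat \<Rightarrow> real) \<Rightarrow> (int \<Rightarrow> 'w \<Rightarrow> real) \<Rightarrow> (int \<Rightarrow> 'w \<Rightarrow> real) \<Rightarrow> int \<Rightarrow> 'w \<Rightarrow> real" where
  "outlier_term p \<beta> z \<xi> t \<omega> =
     z t \<omega> * \<xi> t \<omega> - (\<Sum>j=1..p. \<beta> j * z (t - int j) \<omega> * \<xi> (t - int j) \<omega>)"

definition emp_cdf :: "nat \<Rightarrow> (int \<Rightarrow> 'w \<Rightarrow> real) \<Rightarrow> real \<Rightarrow> 'w \<Rightarrow> real" where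
  "emp_cdf n \<epsilon> x \<omega> = (\<Sum>t\<in>{1..int n}. of_bool (\<epsilon> t \<omega> \<le> x)) / real n"

definition perturbed_emp_cdf ::
  "nat \<Rightarrow> (nat \<Rightarrow> real) \<Rightarrow> nat \<Rightarrow> (int \<Rightarrow> 'w \<Rightarrow> real) \<Rightarrow> (int \<Rightarrow> 'w \<Rightarrow> real) \<Rightarrow>
   (int \<Rightarrow> 'w \<Rightarrow> real) \<Rightarrow> (int \<Rightarrow> 'w \<Rightarrow> real) \<Rightarrow> real \<Rightarrow> real \<Rightarrow> (nat \<Rightarrow> real) \<Rightarrow> 'w \<Rightarrow> real" where
  "perturbed_emp_cdf p \<beta> n \<epsilon> u z \<xi> x \<tau>0 \<tau>1 \<omega> =
     (\<Sum>t\<in>{1..int n}. of_bool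
        (\<epsilon> t \<omega> \<le> x
           + (\<Sum>j=1..p. \<tau>1 j * u (t - int j) \<omega>) / sqrt (real n)
           + \<tau>0 / sqrt (real n)
           - outlier_term p \<beta> z \<xi> t \<omega>
           + (\<Sum>j=1..p. \<tau>1 j / sqrt (real n) * z (t - int j) \<omega> * \<xi> (t - int j) \<omega>))) / real n"

text \<open>The coefficient with index 0 is \<open>-1\<close> by convention, whatever \<open>\<beta> 0\<close> is.\<close>

definition outlier_shift ::
  "nat \<Rightarrow> (nat \<Rightarrow> real) \<Rightarrow> (real \<Rightarrow> real) \<Rightarrow> real measure \<Rightarrow> real \<Rightarrow> real" where
  "outlier_shift p \<beta> G0 P\<xi> x =
     (\<Sum>j=0..p. ((LINT s|P\<xi>. G0 (x + (\<beta>(0 := -1)) j * s)) - G0 x))"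

end

theory Submission
  imports Defs
    "HOL-Computational_Algebra.Polynomial_FPS"
    "HOL-Computational_Algebra.Fundamental_Theorem_Algebra"
begin

text \<open>
  Conditionally on the past and on all outliers, each innovation has the mixture distribution
  function. Subtracting the conditional expectations of the indicators leaves martingale differences
  whose second moments are of order \<open>1 / sqrt n\<close>, so their normalised sum vanishes in
  \<open>L\<^sup>2\<close> for each fixed perturbation \<open>(\<tau>\<^sub>0, \<tau>\<^sub>1)\<close>. The compensator is expanded pathwise,
  uniformly in the perturbation: times without outliers contribute \<open>g\<^sub>0(x) \<tau>\<^sub>0\<close> by Taylor's formula
  and the law of large numbers, times with exactly one outlier among the \<open>p + 1\<close> relevant ones
  contribute \<open>\<gamma> \<Delta>(x, \<Pi>)\<close>, and the rest is negligible. Since the indicators are monotone in the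
  threshold, a finite net of perturbations, enlarged by a small slack \<open>s\<close>, brackets the supremum
  at the cost of a term of order \<open>s\<close>.
\<close>

section \<open>Iterating an autoregression\<close>

unbundle no vec_syntax
unbundle fps_syntax

text \<open>The process \<open>v\<close> is only assumed stationary and to satisfy the recursion.
  The martingale argument needs more: its lagged values must be functions of earlier innovations and
  have second moments. Both come from identifying \<open>v\<close> with the causal series, which is
  where the root condition enters; it enters again through \<Sum>\<beta> \<noteq> 1, which controls
  the partial sums of the process. The outlier law is arbitrary and may lack all moments, so outlier
  sizes enter only through bounded functions, and their effect on the perturbation vanishes by
  dominated convergence, without a rate. Uniformity in \<gamma> and \<rho> is obtained by making
  every bound an explicit function of n and of constants that depend on neither. The slack
  \<open>s\<close> is fixed before the net and the net before n: the slack term does not vanish with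
  n, while the martingale term is multiplied by the size of the net.\<close>

lemma fps_inverse_linear_nth:
  fixes a :: "'a::field fps" and w :: 'a
  shows "(inverse (1 - fps_const w * fps_X) * a) $ Suc k = w * (inverse (1 - fps_const w * fps_X) * a) $ k + a $ Suc k"
proof -
  let ?f = "1 - fps_const w * fps_X" and ?b = "inverse (1 - fps_const w * fps_X) * a"
  have "?f * inverse ?f = 1" by (rule inverse_mult_eq_1') simp
  then have fb: "?f * ?b = a" by (metis mult.assoc mult_1)
  have "a $ Suc k = (?f * ?b) $ Suc k" by (simp only: fb)
  also have "\<dots> = ?b $ Suc k - w * ?b $ k"
    by (simp add: left_diff_distrib mult.assoc)
  finally show ?thesis by simp
qed

text \<open>Dividing by 1 - w X turns coefficients into a first-order recursion with factor w. Since
  |w| is strictly below r, the rate r survives and only the constant grows.\<close>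

lemma geometric_bound_inverse_linear:
  fixes a :: "complex fps" and w :: complex
  assumes a: "\<And>k. cmod (a $ k) \<le> C * r ^ k" and w: "cmod w < r"
  shows "\<exists>C'. \<forall>k. cmod ((inverse (1 - fps_const w * fps_X) * a) $ k) \<le> C' * r ^ k"
proof -
  let ?b = "inverse (1 - fps_const w * fps_X) * a"
  have r: "r > 0" using w norm_ge_zero[of w] by linarith
  have C: "C \<ge> 0" using order_trans[OF norm_ge_zero a[of 0]] by simp
  \<comment> \<open>\<open>C'\<close> is the fixed point of the induction step: it solves
    \<open>C' * cmod w + C * r = C' * r\<close>.\<close>
  define C' where "C' = C * r / (r - cmod w)"
  have eq: "C' * cmod w + C * r = C' * r"
    using w unfolding C'_def by (simp add: field_simps)
  have C': "C \<le> C'" using w C r unfolding C'_def by (simp add: field_simps)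
  have "cmod (?b $ k) \<le> C' * r ^ k" for k
  proof (induction k)
    case 0
    have "cmod (a $ 0) \<le> C" using a[of 0] by simp
    then show ?case using C' by simp
  next
    case (Suc k)
    have "cmod (?b $ Suc k) \<le> cmod w * cmod (?b $ k) + cmod (a $ Suc k)"
      unfolding fps_inverse_linear_nth by (metis norm_mult norm_triangle_ineq)
    also have "\<dots> \<le> cmod w * (C' * r ^ k) + C * r ^ Suc k"
      by (intro add_mono mult_left_mono Suc a) auto
    also have "\<dots> = (C' * cmod w + C * r) * r ^ k" by (simp add: algebra_simps)
    also have "\<dots> = C' * r ^ Suc k" by (simp add: eq)
    finally show ?case .
  qed
  then show ?thesis by blast
qed

text \<open>One linear factor is divided out per root. Working with the multiset of roots and a rate
  r above all of them treats multiple roots without partial fractions or polynomial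
  prefactors.\<close>

lemma geometric_bound_inverse_reflected_roots:
  assumes "\<And>w. w \<in># A \<Longrightarrow> cmod w < r" and "r > 0"
  shows "\<exists>C. \<forall>k. cmod (inverse (fps_of_poly (reflect_poly (\<Prod>w\<in>#A. [:- w, 1:]))) $ k) \<le> C * r ^ k"
  using assms(1)
proof (induction A)
  case empty
  show ?case using assms(2) by (intro exI[of _ 1]) auto
next
  case (add w A)
  then obtain C where C: "\<And>k. cmod (inverse (fps_of_poly (reflect_poly (\<Prod>w\<in>#A. [:- w, 1:]))) $ k) \<le> C * r ^ k"
    by auto
  \<comment> \<open>For w = 0 the reflection drops the degree and yields 1, which is still 1 - w
    X.\<close>
  have lin: "fps_of_poly (reflect_poly [:- w, 1:]) = 1 - fps_const w * fps_X"
    by (cases "w = 0") (simp_all add: reflect_poly_pCons' fps_of_poly_pCons fps_of_poly_linear' monom_altdef)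
  have "inverse (fps_of_poly (reflect_poly (\<Prod>w\<in>#add_mset w A. [:- w, 1:])))
      = inverse (1 - fps_const w * fps_X) * inverse (fps_of_poly (reflect_poly (\<Prod>w\<in>#A. [:- w, 1:])))"
    by (simp only: image_mset_add_mset prod_mset.add_mset reflect_poly_mult fps_of_poly_mult
        fps_inverse_mult lin)
  then show ?case
    using geometric_bound_inverse_linear[OF C, of w] add.prems[of w] by auto
qed

text \<open>\<psi> is the coefficient sequence of 1 / (1 - \<beta>_1 X - ... - \<beta>_p X^p). The
  denominator is the reflected characteristic polynomial, so its linear factors are 1 - w X with w
  the characteristic roots.\<close>

lemma ar_impulse_response:
  fixes \<beta> :: "nat \<Rightarrow> real"
  assumes "char_roots_inside p \<beta>"
  obtains \<psi> :: "nat \<Rightarrow> real" and C r where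
    "\<psi> 0 = 1" "\<And>n. n \<ge> 1 \<Longrightarrow> \<psi> n = (\<Sum>i=1..p. if i \<le> n then \<beta> i * \<psi> (n - i) else 0)"
    "\<And>k. \<bar>\<psi> k\<bar> \<le> C * r ^ k" "0 < r" "r < 1"
proof -
  define P :: "complex poly" where "P = monom 1 p - (\<Sum>j=1..p. monom (of_real (\<beta> j)) (p - j))"
  have coeffP: "coeff P k = (if k = p then 1 else if k < p then - of_real (\<beta> (p - k)) else 0)" for k
  proof -
    have "(\<Sum>j=1..p. if p - j = k then complex_of_real (\<beta> j) else 0)
        = (if k < p then complex_of_real (\<beta> (p - k)) else 0)"
    proof (cases "k < p")
      case True
      have "(\<Sum>j=1..p. if p - j = k then complex_of_real (\<beta> j) else 0)
          = (\<Sum>j\<in>{p - k}. if p - j = k then complex_of_real (\<beta> j) else 0)"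
        using True by (intro sum.mono_neutral_right) auto
      then show ?thesis using True by simp
    qed (auto intro!: sum.neutral)
    then show ?thesis unfolding P_def by (simp add: coeff_sum)
  qed
  have deg: "degree P = p"
    by (rule antisym[OF degree_le le_degree]) (auto simp: coeffP)
  have lead: "lead_coeff P = 1" by (simp add: deg coeffP)
  obtain A where A: "P = (\<Prod>w\<in>#A. [:- w, 1:])"
    using complex_poly_decompose_multiset[of P] lead by (metis smult_1_left)
  have roots: "cmod w < 1" if "w \<in># A" for w
  proof -
    have "poly P w = 0" using that unfolding A by (auto simp: poly_prod_mset)
    then show ?thesis using assms unfolding char_roots_inside_def P_def
      by (simp add: poly_sum poly_monom)
  qed
  \<comment> \<open>The inserted 0 keeps the maximum defined when there are no roots; r is the
    midpoint between the largest modulus and 1.\<close>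
  define m where "m = Max (insert 0 (cmod ` set_mset A))"
  define r where "r = (m + 1) / 2"
  have mx: "m < 1" using roots unfolding m_def by (subst Max_less_iff) auto
  have mx0: "m \<ge> 0" unfolding m_def by (intro Max_ge) auto
  have r: "0 < r" using mx0 unfolding r_def by simp
  have r1: "r < 1" using mx unfolding r_def by simp
  have rA: "cmod w < r" if "w \<in># A" for w
  proof -
    have "cmod w \<le> m" using that unfolding m_def by (intro Max_ge) auto
    moreover have "2 * r = m + 1" unfolding r_def by simp
    ultimately show ?thesis using mx by linarith
  qed
  define Q where "Q = fps_of_poly (reflect_poly P)"
  have Qn: "Q $ k = (if k = 0 then 1 else if k \<le> p then - of_real (\<beta> k) else 0)" for k
    unfolding Q_def by (auto simp: coeff_reflect_poly deg coeffP)
  obtain C where C: "\<And>k. cmod (inverse Q $ k) \<le> C * r ^ k"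
    using geometric_bound_inverse_reflected_roots[OF rA r] unfolding Q_def A by blast
  \<comment> \<open>The series lives over the complex numbers because of the roots. As \<beta> is
    real, the recursion passes to real parts directly.\<close>
  define \<psi> where "\<psi> k = Re (inverse Q $ k)" for k
  have "\<psi> 0 = 1" unfolding \<psi>_def by (simp add: Qn)
  moreover have "\<psi> n = (\<Sum>i=1..p. if i \<le> n then \<beta> i * \<psi> (n - i) else 0)" if n: "n \<ge> 1" for n
  proof -
    have "(Q * inverse Q) $ n = 0" using inverse_mult_eq_1'[of Q] n by (simp add: Qn)
    then have "0 = (\<Sum>i=0..n. Q $ i * inverse Q $ (n - i))" by (simp add: fps_mult_nth)
    also have "\<dots> = inverse Q $ n + (\<Sum>i=1..n. Q $ i * inverse Q $ (n - i))"
      by (subst sum.atLeast_Suc_atMost) (simp_all add: Qn)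
    also have "(\<Sum>i=1..n. Q $ i * inverse Q $ (n - i))
        = - (\<Sum>i=1..n. if i \<le> p then of_real (\<beta> i) * inverse Q $ (n - i) else 0)"
      unfolding sum_negf[symmetric] by (intro sum.cong) (auto simp: Qn)
    also have "(\<Sum>i=1..n. if i \<le> p then of_real (\<beta> i) * inverse Q $ (n - i) else 0)
       = (\<Sum>i\<in>{1..n}\<inter>{1..p}. of_real (\<beta> i) * inverse Q $ (n - i))"
      by (rule sum.mono_neutral_cong_right) auto
    finally have e: "inverse Q $ n = (\<Sum>i\<in>{1..n}\<inter>{1..p}. of_real (\<beta> i) * inverse Q $ (n - i))"
      by (simp add: algebra_simps)
    have "\<psi> n = (\<Sum>i\<in>{1..n}\<inter>{1..p}. \<beta> i * \<psi> (n - i))"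
      unfolding \<psi>_def by (subst e) simp
    also have "\<dots> = (\<Sum>i=1..p. if i \<le> n then \<beta> i * \<psi> (n - i) else 0)"
      by (rule sum.mono_neutral_cong_left) auto
    finally show ?thesis .
  qed
  moreover have "\<bar>\<psi> k\<bar> \<le> C * r ^ k" for k
    using abs_Re_le_cmod C unfolding \<psi>_def by (rule order_trans)
  ultimately show ?thesis using that r r1 by blast
qed

text \<open>A deterministic identity for arbitrary sequences \<open>u\<close> and \<open>e\<close>,
  so that it can be applied to one path at a time. The remainder has a fixed number of terms, each
  with a coefficient that vanishes as k grows.\<close>

lemma ar_iteration:
  fixes \<beta> :: "nat \<Rightarrow> real"
  assumes "char_roots_inside p \<beta>"
  obtains \<psi> :: "nat \<Rightarrow> real" and c :: "nat \<Rightarrow> nat \<Rightarrow> real" where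
    "summable (\<lambda>i. \<bar>\<psi> i\<bar>)" "\<And>j. (\<lambda>k. c k j) \<longlonglongrightarrow> 0"
    "\<And>(u :: int \<Rightarrow> real) e t k. (\<And>t. u t = (\<Sum>j=1..p. \<beta> j * u (t - int j)) + e t) \<Longrightarrow>
       u t = (\<Sum>i\<le>k. \<psi> i * e (t - int i)) + (\<Sum>j=1..p. c k j * u (t - int k - int j))"
proof -
  obtain \<psi> :: "nat \<Rightarrow> real" and C r where
    \<psi>0: "\<psi> 0 = 1" and
    \<psi>: "\<And>n. n \<ge> 1 \<Longrightarrow> \<psi> n = (\<Sum>i=1..p. if i \<le> n then \<beta> i * \<psi> (n - i) else 0)" and
    bnd: "\<And>k. \<bar>\<psi> k\<bar> \<le> C * r ^ k" and r: "0 < r" "r < 1"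
    by (rule ar_impulse_response[OF assms]) blast
  \<comment> \<open>After substituting for lags 0 to k, lag l has been expanded with total weight
    \<open>\<psi> l\<close> and contributes \<open>\<beta> i\<close> at lag l + i. Lag k + j is thus
    reached from l = k + j - i \<le> k, that is from i \<ge> j. The \<open>if\<close> encodes that
    \<psi> vanishes at negative indices.\<close>
  define c where "c k j = (\<Sum>i=j..p. if i \<le> k + j then \<beta> i * \<psi> (k + j - i) else 0)" for k j
  have summ: "summable (\<lambda>i. \<bar>\<psi> i\<bar>)"
    by (rule summable_comparison_test[OF _ summable_mult[of "\<lambda>k. r ^ k" C]])
       (use bnd r in \<open>auto intro: summable_geometric\<close>)
  have \<psi>_lim: "\<psi> \<longlonglongrightarrow> 0"
    using summable_LIMSEQ_zero[OF summ] by (simp add: tendsto_rabs_zero_iff)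
  have c_lim: "(\<lambda>k. c k j) \<longlonglongrightarrow> 0" for j
    unfolding c_def
  proof (rule tendsto_null_sum)
    fix i
    have "(\<lambda>k. \<beta> i * \<psi> (k - i)) \<longlonglongrightarrow> 0"
      using \<psi>_lim by (intro tendsto_mult_right_zero LIMSEQ_offset[of "\<lambda>k. \<psi> (k - i)" i]) simp
    then have "(\<lambda>k. \<beta> i * \<psi> ((k + j) - i)) \<longlonglongrightarrow> 0"
      by (rule LIMSEQ_ignore_initial_segment)
    moreover have "eventually (\<lambda>k. \<beta> i * \<psi> ((k + j) - i) = (if i \<le> k + j then \<beta> i * \<psi> (k + j - i) else 0)) sequentially"
      using eventually_ge_at_top[of i] by eventually_elim auto
    ultimately show "(\<lambda>k. if i \<le> k + j then \<beta> i * \<psi> (k + j - i) else 0) \<longlonglongrightarrow> 0"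
      by (rule Lim_transform_eventually)
  qed
  have c_step: "c (Suc k) j = c k (Suc j) + \<psi> (Suc k) * \<beta> j" if "j \<le> p" for k j
  proof -
    have "k + Suc j = Suc k + j" by simp
    then show ?thesis
      unfolding c_def using that by (simp only: ) (subst sum.atLeast_Suc_atMost, simp_all)
  qed
  have c_one: "c k (Suc 0) = \<psi> (Suc k)" for k
    using \<psi>[of "Suc k"] unfolding c_def by (simp only: add_Suc_right add_0_right One_nat_def)
  have c_top: "c k (Suc p) = 0" for k unfolding c_def by simp
  have iter: "u t = (\<Sum>i\<le>k. \<psi> i * e (t - int i)) + (\<Sum>j=1..p. c k j * u (t - int k - int j))"
    if ar: "\<And>t. u t = (\<Sum>j=1..p. \<beta> j * u (t - int j)) + e t" for u e :: "int \<Rightarrow> real" and t k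
  proof (induction k)
    case 0
    have "c 0 j = \<beta> j" if "j \<in> {1..p}" for j
    proof -
      have "c 0 j = (\<Sum>i\<in>{j}. if i \<le> j then \<beta> i * \<psi> (j - i) else 0)"
        unfolding c_def using that by (intro sum.mono_neutral_cong_right) auto
      then show ?thesis by (simp add: \<psi>0)
    qed
    then show ?case using ar[of t] by (simp add: \<psi>0)
  next
    case (Suc k)
    \<comment> \<open>The most recent remaining value is split off, to be expanded once more. Its
      coefficient is \<open>\<psi> (Suc k)\<close> by \<open>c_one\<close>, and \<open>c_top\<close>
      fills the lag that appears at the far end.\<close>
    have shift: "(\<Sum>j=1..p. c k j * u (t - int k - int j))
        = (\<Sum>j=1..p. c k (Suc j) * u (t - int (Suc k) - int j)) + c k 1 * u (t - int (Suc k))"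
    proof -
      have "(\<Sum>j=1..p. c k j * u (t - int k - int j)) = (\<Sum>j=1..Suc p. c k j * u (t - int k - int j))"
        by (simp add: c_top)
      also have "\<dots> = c k 1 * u (t - int k - 1) + (\<Sum>j=Suc 1..Suc p. c k j * u (t - int k - int j))"
        by (subst sum.atLeast_Suc_atMost) auto
      also have "(\<Sum>j=Suc 1..Suc p. c k j * u (t - int k - int j))
         = (\<Sum>j=1..p. c k (Suc j) * u (t - int (Suc k) - int j))"
        by (subst sum.shift_bounds_cl_Suc_ivl) (simp add: algebra_simps)
      finally show ?thesis by (simp add: algebra_simps)
    qed
    have "(\<Sum>j=1..p. c (Suc k) j * u (t - int (Suc k) - int j))
       = (\<Sum>j=1..p. c k (Suc j) * u (t - int (Suc k) - int j))
         + \<psi> (Suc k) * (\<Sum>j=1..p. \<beta> j * u (t - int (Suc k) - int j))"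
      unfolding sum_distrib_left sum.distrib[symmetric]
      by (intro sum.cong) (auto simp: c_step algebra_simps)
    also have "\<dots> = (\<Sum>j=1..p. c k (Suc j) * u (t - int (Suc k) - int j))
         + \<psi> (Suc k) * u (t - int (Suc k)) - \<psi> (Suc k) * e (t - int (Suc k))"
      using ar[of "t - int (Suc k)"] by (simp add: algebra_simps)
    finally show ?case using Suc shift c_one[of k] by simp
  qed
  show ?thesis by (rule that[OF summ c_lim iter])
qed

section \<open>Real analysis\<close>

lemma weighted_Cauchy_Schwarz_sum:
  fixes a b :: "'a \<Rightarrow> real"
  assumes "\<And>i. i \<in> A \<Longrightarrow> a i \<ge> 0"
  shows "(\<Sum>i\<in>A. a i * b i)\<^sup>2 \<le> (\<Sum>i\<in>A. a i) * (\<Sum>i\<in>A. a i * (b i)\<^sup>2)"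
proof -
  have "(\<Sum>i\<in>A. a i * b i)\<^sup>2 = (\<Sum>i\<in>A. sqrt (a i) * (sqrt (a i) * b i))\<^sup>2"
    using assms by (intro arg_cong[where f="\<lambda>x. x\<^sup>2"] sum.cong) (auto simp: mult.assoc[symmetric])
  also have "\<dots> \<le> (\<Sum>i\<in>A. (sqrt (a i))\<^sup>2) * (\<Sum>i\<in>A. (sqrt (a i) * b i)\<^sup>2)"
    by (rule Cauchy_Schwarz_ineq_sum)
  also have "\<dots> = (\<Sum>i\<in>A. a i) * (\<Sum>i\<in>A. a i * (b i)\<^sup>2)"
    using assms by (intro arg_cong2[where f="(*)"] sum.cong) (auto simp: power_mult_distrib)
  finally show ?thesis .
qed

text \<open>The only analytic input is a bounded second derivative and values in [0, 1]. The mean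
  value theorem applied to F minus its tangent gives the quadratic error with constant K.\<close>

lemma bounded_density:
  fixes F f f' :: "real \<Rightarrow> real"
  assumes F: "\<And>s. (F has_real_derivative f s) (at s)" and f: "\<And>s. (f has_real_derivative f' s) (at s)"
    and K: "\<And>s. \<bar>f' s\<bar> \<le> K" and range: "\<And>s. 0 \<le> F s" "\<And>s. F s \<le> 1"
  shows "\<bar>F (x + w) - F x - f x * w\<bar> \<le> K * w\<^sup>2"
    and "\<bar>f x\<bar> \<le> 1 + K"
    and "\<bar>F (x + w) - F x\<bar> \<le> (1 + K) * \<bar>w\<bar>"
proof -
  have lip: "\<bar>f a - f b\<bar> \<le> K * \<bar>a - b\<bar>" for a b
    using field_differentiable_bound[of UNIV f f' K a b] f K by auto
  have tb: "\<bar>F (x + w) - F x - f x * w\<bar> \<le> K * w\<^sup>2" for x w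
  proof -
    have "norm ((\<lambda>s. F s - f x * s) (x + w) - (\<lambda>s. F s - f x * s) x) \<le> (K * \<bar>w\<bar>) * norm ((x + w) - x)"
    proof (rule field_differentiable_bound[where S="closed_segment x (x + w)" and f'="\<lambda>s. f s - f x"])
      fix s assume s: "s \<in> closed_segment x (x + w)"
      show "((\<lambda>s. F s - f x * s) has_field_derivative f s - f x) (at s within closed_segment x (x + w))"
        by (auto intro!: derivative_eq_intros DERIV_subset[OF F])
      have "\<bar>s - x\<bar> \<le> \<bar>w\<bar>" using s by (auto simp: closed_segment_eq_real_ivl split: if_splits)
      then have "K * \<bar>s - x\<bar> \<le> K * \<bar>w\<bar>"
        using order_trans[OF abs_ge_zero K[of 0]] by (intro mult_left_mono) auto
      then show "norm (f s - f x) \<le> K * \<bar>w\<bar>"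
        using lip[of s x] by simp
    qed auto
    then show ?thesis by (simp add: algebra_simps power2_eq_square)
  qed
  show "\<bar>F (x + w) - F x - f x * w\<bar> \<le> K * w\<^sup>2" by (rule tb)
  \<comment> \<open>The quadratic bound at w = 1 compares f(x) with an increment of F, which is at
    most 1 in absolute value.\<close>
  have db: "\<bar>f x\<bar> \<le> 1 + K" for x
    using tb[of x 1] range[of x] range[of "x + 1"] by auto
  show "\<bar>f x\<bar> \<le> 1 + K" by (rule db)
  show "\<bar>F (x + w) - F x\<bar> \<le> (1 + K) * \<bar>w\<bar>"
    using field_differentiable_bound[of UNIV F f "1 + K" "x + w" x] F db by auto
qed

text \<open>A product of one-dimensional nets on the cube of index set 0..p, with coordinate 0
  reserved for \<tau>_0. The net points stay in the cube because the moment bounds hold only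
  there.\<close>

lemma finite_coordinate_net:
  fixes \<Theta> s :: real
  assumes "s > 0"
  obtains N :: "(nat \<Rightarrow> real) set" where "finite N"
    "\<And>g i. g \<in> N \<Longrightarrow> i \<le> p \<Longrightarrow> \<bar>g i\<bar> \<le> \<Theta>"
    "\<And>\<tau>. (\<And>i. i \<le> p \<Longrightarrow> \<bar>\<tau> i\<bar> \<le> \<Theta>) \<Longrightarrow> \<exists>g\<in>N. \<forall>i\<le>p. \<bar>\<tau> i - g i\<bar> \<le> s"
proof -
  have "compact {-\<Theta>..\<Theta>}" by simp
  from seq_compact_imp_totally_bounded[OF compact_imp_seq_compact[OF this], rule_format, OF assms]
  obtain K where K: "finite K" "K \<subseteq> {-\<Theta>..\<Theta>}" "{-\<Theta>..\<Theta>} \<subseteq> (\<Union>x\<in>K. ball x s)"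
    by blast
  show ?thesis
  proof (rule that[of "PiE {..p} (\<lambda>_. K)"])
    show "finite (PiE {..p} (\<lambda>_. K))" using K by (intro finite_PiE) auto
    show "\<bar>g i\<bar> \<le> \<Theta>" if "g \<in> PiE {..p} (\<lambda>_. K)" "i \<le> p" for g i
      using that K(2) PiE_mem[OF that(1), of i] by (auto simp: abs_le_iff)
    show "\<exists>g\<in>PiE {..p} (\<lambda>_. K). \<forall>i\<le>p. \<bar>\<tau> i - g i\<bar> \<le> s" if \<tau>: "\<And>i. i \<le> p \<Longrightarrow> \<bar>\<tau> i\<bar> \<le> \<Theta>" for \<tau>
    proof -
      have "\<exists>x\<in>K. \<bar>\<tau> i - x\<bar> \<le> s" if "i \<le> p" for i
      proof -
        have "\<tau> i \<in> {-\<Theta>..\<Theta>}" using \<tau>[OF that] by auto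
        then obtain x where "x \<in> K" "\<tau> i \<in> ball x s" using K(3) by blast
        then show ?thesis by (intro bexI[of _ x]) (simp_all add: dist_real_def)
      qed
      then obtain h where h: "\<And>i. i \<le> p \<Longrightarrow> h i \<in> K \<and> \<bar>\<tau> i - h i\<bar> \<le> s" by metis
      show ?thesis
      proof (rule bexI[of _ "restrict h {..p}"])
        show "\<forall>i\<le>p. \<bar>\<tau> i - restrict h {..p} i\<bar> \<le> s" using h by simp
        show "restrict h {..p} \<in> PiE {..p} (\<lambda>_. K)" using h by (intro restrict_PiE_iff[THEN iffD2]) simp
      qed
    qed
  qed
qed

lemma min_one_abs_sum_le:
  fixes f :: "'i \<Rightarrow> real"
  assumes "finite A"
  shows "min 1 \<bar>\<Sum>i\<in>A. f i\<bar> \<le> (\<Sum>i\<in>A. min 1 \<bar>f i\<bar>)"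
  using assms
proof (induction A rule: finite_induct)
  case (insert i A)
  have "0 \<le> (\<Sum>i\<in>A. min 1 \<bar>f i\<bar>)" by (intro sum_nonneg) auto
  then show ?case using insert abs_triangle_ineq[of "f i" "\<Sum>i\<in>A. f i"] by simp
qed simp

lemma sum_int_telescope:
  fixes f :: "int \<Rightarrow> 'a::ab_group_add"
  shows "(\<Sum>t\<in>{1..int m}. f t - f (t - 1)) = f (int m) - f 0"
proof (induction m)
  case (Suc m)
  have "{1..int (Suc m)} = insert (int (Suc m)) {1..int m}" by auto
  then show ?case using Suc by simp
qed simp

section \<open>Mixtures, uncorrelated sums and independent coordinates\<close>

lemma integrable_mult_square:
  fixes f g :: "'a \<Rightarrow> real"
  assumes "f \<in> borel_measurable M" "g \<in> borel_measurable M"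
    and "integrable M (\<lambda>\<omega>. (f \<omega>)\<^sup>2)" "integrable M (\<lambda>\<omega>. (g \<omega>)\<^sup>2)"
  shows "integrable M (\<lambda>\<omega>. f \<omega> * g \<omega>)"
proof (rule Bochner_Integration.integrable_bound)
  show "integrable M (\<lambda>\<omega>. (f \<omega>)\<^sup>2 + (g \<omega>)\<^sup>2)" using assms by simp
  have "\<bar>f \<omega> * g \<omega>\<bar> \<le> (f \<omega>)\<^sup>2 + (g \<omega>)\<^sup>2" for \<omega>
    using sum_squares_bound[of "\<bar>f \<omega>\<bar>" "\<bar>g \<omega>\<bar>"] mult_nonneg_nonneg[of "\<bar>f \<omega>\<bar>" "\<bar>g \<omega>\<bar>"]
    unfolding abs_mult power2_abs by linarith
  then show "AE \<omega> in M. norm (f \<omega> * g \<omega>) \<le> norm ((f \<omega>)\<^sup>2 + (g \<omega>)\<^sup>2)" by simp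
qed (use assms in measurable)

lemma borel_measurable_of_bool:
  assumes [measurable]: "Measurable.pred M P"
  shows "(\<lambda>\<omega>. of_bool (P \<omega>) :: real) \<in> borel_measurable M"
  unfolding of_bool_def by measurable

text \<open>The hypothesis concerns distribution functions only. A law with the same distribution
  function is built by drawing one of the two laws with a Bernoulli variable; it equals
  \<open>Q\<close> by uniqueness, and its integrals are computed by the bind rule.\<close>

lemma mixture_distribution_nn_integral:
  fixes r :: real
  assumes P0: "real_distribution P0" and PH: "real_distribution PH" and Q: "real_distribution Q"
    and r: "0 \<le> r" "r \<le> 1"
    and cdf: "\<And>x. cdf Q x = (1 - r) * cdf P0 x + r * cdf PH x"
    and f: "f \<in> borel_measurable borel"
  shows "(\<integral>\<^sup>+s. f s \<partial>Q) = ennreal (1 - r) * (\<integral>\<^sup>+s. f s \<partial>P0) + ennreal r * (\<integral>\<^sup>+s. f s \<partial>PH)"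
proof -
  interpret P0: real_distribution P0 by fact
  interpret PH: real_distribution PH by fact
  interpret Q: real_distribution Q by fact
  define N where "N b = (if b then PH else P0)" for b
  define B where "B = measure_pmf (bernoulli_pmf r) \<bind> N"
  have N_prob: "prob_space (N b)" "sets (N b) = sets borel" for b
    unfolding N_def by (auto simp: P0.prob_space_axioms PH.prob_space_axioms)
  have N: "N \<in> measure_pmf (bernoulli_pmf r) \<rightarrow>\<^sub>M subprob_algebra borel"
    using N_prob by (auto simp: space_subprob_algebra prob_space_imp_subprob_space)
  have nn: "(\<integral>\<^sup>+s. g s \<partial>B) = ennreal (1 - r) * (\<integral>\<^sup>+s. g s \<partial>P0) + ennreal r * (\<integral>\<^sup>+s. g s \<partial>PH)"
    if g: "g \<in> borel_measurable borel" for g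
  proof -
    have "(\<integral>\<^sup>+s. g s \<partial>B) = (\<integral>\<^sup>+b. (\<integral>\<^sup>+s. g s \<partial>N b) \<partial>bernoulli_pmf r)"
      unfolding B_def by (rule nn_integral_bind[OF g N])
    also have "\<dots> = ennreal (1 - r) * (\<integral>\<^sup>+s. g s \<partial>P0) + ennreal r * (\<integral>\<^sup>+s. g s \<partial>PH)"
      using r by (simp add: N_def add.commute mult.commute)
    finally show ?thesis .
  qed
  have sets_B: "sets B = sets borel"
    unfolding B_def by (rule sets_bind_measurable[OF N]) simp
  have B: "real_distribution B"
  proof (intro real_distribution.intro real_distribution_axioms.intro)
    show "prob_space B" unfolding B_def
      using N_prob by (intro measure_pmf.prob_space_bind[OF _ N]) auto
    show "sets B = sets borel" by (rule sets_B)
  qed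
  interpret B: real_distribution B by fact
  have "cdf B x = cdf Q x" for x
  proof -
    have "emeasure B {..x} = ennreal (1 - r) * emeasure P0 {..x} + ennreal r * emeasure PH {..x}"
      using nn[of "indicator {..x}"] by simp
    also have "\<dots> = ennreal ((1 - r) * measure P0 {..x} + r * measure PH {..x})"
      using r by (simp add: P0.emeasure_eq_measure PH.emeasure_eq_measure ennreal_mult' ennreal_plus)
    finally have "measure B {..x} = (1 - r) * measure P0 {..x} + r * measure PH {..x}"
      using r by (simp add: B.emeasure_eq_measure del: ennreal_plus)
    then show ?thesis unfolding cdf by (simp add: cdf_def)
  qed
  then have "B = Q" by (intro cdf_unique[OF B Q] ext)
  then show ?thesis using nn[OF f] by simp
qed

lemma mixture_distribution_integral:
  fixes r :: real and f :: "real \<Rightarrow> real"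
  assumes P0: "real_distribution P0" and PH: "real_distribution PH" and Q: "real_distribution Q"
    and r: "0 \<le> r" "r \<le> 1"
    and cdf: "\<And>x. cdf Q x = (1 - r) * cdf P0 x + r * cdf PH x"
    and f0: "integrable P0 f" and fH: "integrable PH f"
  shows "integrable Q f" and "(LINT s|Q. f s) = (1 - r) * (LINT s|P0. f s) + r * (LINT s|PH. f s)"
proof -
  interpret P0: real_distribution P0 by fact
  interpret PH: real_distribution PH by fact
  interpret Q: real_distribution Q by fact
  have f: "f \<in> borel_measurable borel"
    using borel_measurable_integrable[OF f0] by simp
  note nn = mixture_distribution_nn_integral[OF P0 PH Q r cdf]
  have fin: "(\<integral>\<^sup>+s. ennreal (norm (f s)) \<partial>P0) < \<infinity>" "(\<integral>\<^sup>+s. ennreal (norm (f s)) \<partial>PH) < \<infinity>"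
    using f0 fH by (auto simp: integrable_iff_bounded)
  show int: "integrable Q f"
    unfolding integrable_iff_bounded using fin f
    by (subst nn) (auto simp: ennreal_mult_less_top)
  \<comment> \<open>Applied to f and to -f; domination by |f| keeps both extended integrals finite,
    so \<open>enn2real\<close> is additive on them.\<close>
  have part: "enn2real (\<integral>\<^sup>+s. ennreal (g s) \<partial>Q)
      = (1 - r) * enn2real (\<integral>\<^sup>+s. ennreal (g s) \<partial>P0) + r * enn2real (\<integral>\<^sup>+s. ennreal (g s) \<partial>PH)"
    if g: "g \<in> borel_measurable borel" and le: "\<And>s. g s \<le> norm (f s)" for g
  proof -
    have "(\<integral>\<^sup>+s. ennreal (g s) \<partial>P0) < \<infinity>"
      by (rule le_less_trans[OF nn_integral_mono fin(1)]) (rule ennreal_leI[OF le])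
    moreover have "(\<integral>\<^sup>+s. ennreal (g s) \<partial>PH) < \<infinity>"
      by (rule le_less_trans[OF nn_integral_mono fin(2)]) (rule ennreal_leI[OF le])
    ultimately show ?thesis using g r
      by (subst nn) (simp_all add: enn2real_plus enn2real_mult ennreal_mult_less_top)
  qed
  have "f s \<le> norm (f s)" "- f s \<le> norm (f s)" for s by simp_all
  note pos = part[OF f this(1)] and neg = part[OF borel_measurable_uminus[OF f] this(2)]
  show "(LINT s|Q. f s) = (1 - r) * (LINT s|P0. f s) + r * (LINT s|PH. f s)"
    unfolding real_lebesgue_integral_def[OF int] real_lebesgue_integral_def[OF f0]
      real_lebesgue_integral_def[OF fH]
    using pos neg by (simp add: algebra_simps)
qed

lemma (in prob_space) expectation_abs_le_sqrt:
  fixes X :: "'a \<Rightarrow> real"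
  assumes [measurable]: "X \<in> borel_measurable M" and "integrable M (\<lambda>\<omega>. (X \<omega>)\<^sup>2)"
  shows "expectation (\<lambda>\<omega>. \<bar>X \<omega>\<bar>) \<le> sqrt (expectation (\<lambda>\<omega>. (X \<omega>)\<^sup>2))"
proof -
  have int: "integrable M (\<lambda>\<omega>. \<bar>X \<omega>\<bar>)"
    using square_integrable_imp_integrable[of X] assms by simp
  have "0 \<le> variance (\<lambda>\<omega>. \<bar>X \<omega>\<bar>)" by (rule variance_positive)
  also have "\<dots> = expectation (\<lambda>\<omega>. (X \<omega>)\<^sup>2) - (expectation (\<lambda>\<omega>. \<bar>X \<omega>\<bar>))\<^sup>2"
    using int assms by (subst variance_eq) simp_all
  finally show ?thesis by (intro real_le_rsqrt) simp
qed

text \<open>Orthogonality removes the cross terms of the squared sum. The lemma serves the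
  martingale differences, the outlier sums and the innovations alike.\<close>

lemma (in prob_space) expectation_abs_sum_uncorrelated:
  fixes D :: "'i \<Rightarrow> 'a \<Rightarrow> real"
  assumes T: "finite T"
    and meas[measurable]: "\<And>t. t \<in> T \<Longrightarrow> D t \<in> borel_measurable M"
    and sq: "\<And>t. t \<in> T \<Longrightarrow> integrable M (\<lambda>\<omega>. (D t \<omega>)\<^sup>2)"
    and orth: "\<And>s t. s \<in> T \<Longrightarrow> t \<in> T \<Longrightarrow> s \<noteq> t \<Longrightarrow> expectation (\<lambda>\<omega>. D s \<omega> * D t \<omega>) = 0"
    and V: "\<And>t. t \<in> T \<Longrightarrow> expectation (\<lambda>\<omega>. (D t \<omega>)\<^sup>2) \<le> V"
  shows "integrable M (\<lambda>\<omega>. \<bar>\<Sum>t\<in>T. D t \<omega>\<bar>)"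
    and "expectation (\<lambda>\<omega>. \<bar>\<Sum>t\<in>T. D t \<omega>\<bar>) \<le> sqrt (real (card T) * V)"
proof -
  have prod: "integrable M (\<lambda>\<omega>. D s \<omega> * D t \<omega>)" if "s \<in> T" "t \<in> T" for s t
    using that by (intro integrable_mult_square meas sq)
  have [measurable]: "(\<lambda>\<omega>. \<Sum>t\<in>T. D t \<omega>) \<in> borel_measurable M" by (rule borel_measurable_sum) measurable
  have expand: "(\<Sum>t\<in>T. D t \<omega>)\<^sup>2 = (\<Sum>s\<in>T. \<Sum>t\<in>T. D s \<omega> * D t \<omega>)" for \<omega>
    by (simp add: power2_eq_square sum_product)
  have int2: "integrable M (\<lambda>\<omega>. (\<Sum>t\<in>T. D t \<omega>)\<^sup>2)"
    unfolding expand using prod by auto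
  show "integrable M (\<lambda>\<omega>. \<bar>\<Sum>t\<in>T. D t \<omega>\<bar>)"
    using square_integrable_imp_integrable[OF _ int2] by simp
  have "expectation (\<lambda>\<omega>. (\<Sum>t\<in>T. D t \<omega>)\<^sup>2) = (\<Sum>s\<in>T. \<Sum>t\<in>T. expectation (\<lambda>\<omega>. D s \<omega> * D t \<omega>))"
    unfolding expand using prod by (simp add: Bochner_Integration.integral_sum)
  also have "\<dots> = (\<Sum>s\<in>T. expectation (\<lambda>\<omega>. (D s \<omega>)\<^sup>2))"
  proof (rule sum.cong[OF refl])
    fix s assume s: "s \<in> T"
    have "(\<Sum>t\<in>T. expectation (\<lambda>\<omega>. D s \<omega> * D t \<omega>)) = (\<Sum>t\<in>{s}. expectation (\<lambda>\<omega>. D s \<omega> * D t \<omega>))"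
      using s T orth[of s] by (intro sum.mono_neutral_right) auto
    then show "(\<Sum>t\<in>T. expectation (\<lambda>\<omega>. D s \<omega> * D t \<omega>)) = expectation (\<lambda>\<omega>. (D s \<omega>)\<^sup>2)"
      by (simp add: power2_eq_square)
  qed
  also have "\<dots> \<le> real (card T) * V" using sum_bounded_above[of T _ V] V by simp
  finally have "expectation (\<lambda>\<omega>. (\<Sum>t\<in>T. D t \<omega>)\<^sup>2) \<le> real (card T) * V" .
  then show "expectation (\<lambda>\<omega>. \<bar>\<Sum>t\<in>T. D t \<omega>\<bar>) \<le> sqrt (real (card T) * V)"
    by (intro order_trans[OF expectation_abs_le_sqrt[OF _ int2]] real_sqrt_le_mono) measurable
qed

section \<open>Independence of families generated by disjoint sets of coordinates\<close>

text \<open>The sigma-algebra generated by the coordinates in \<open>A\<close>, written as a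
  pull-back of the product algebra: this is the form in which independence of disjoint subfamilies
  is available.\<close>

definition coord_algebra :: "'w measure \<Rightarrow> ('i \<Rightarrow> 'w \<Rightarrow> real) \<Rightarrow> 'i set \<Rightarrow> 'w measure" where
  "coord_algebra M X A = vimage_algebra (space M) (\<lambda>\<omega>. \<lambda>i\<in>A. X i \<omega>) (Pi\<^sub>M A (\<lambda>_. borel))"

lemma space_coord_algebra [simp]: "space (coord_algebra M X A) = space M"
  by (simp add: coord_algebra_def)

lemma measurable_coord:
  assumes "i \<in> A"
  shows "X i \<in> borel_measurable (coord_algebra M X A)"
proof -
  have "(\<lambda>\<omega>. \<lambda>i\<in>A. X i \<omega>) \<in> measurable (coord_algebra M X A) (Pi\<^sub>M A (\<lambda>_. borel))"
    unfolding coord_algebra_def by (rule measurable_vimage_algebra1) (auto simp: space_PiM)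
  from measurable_compose[OF this measurable_component_singleton[OF assms]]
  show ?thesis using assms by simp
qed

lemma measurable_coord_algebra_mono:
  assumes "f \<in> measurable (coord_algebra M X A) N" and "\<And>i. i \<in> A \<Longrightarrow> X i \<in> borel_measurable M"
  shows "f \<in> measurable M N"
proof -
  have "(\<lambda>\<omega>. \<omega>) \<in> measurable M (coord_algebra M X A)"
    unfolding coord_algebra_def
    by (rule measurable_vimage_algebra2) (use assms(2) in \<open>auto intro!: measurable_restrict\<close>)
  from measurable_compose[OF this assms(1)] show ?thesis .
qed

lemma (in prob_space) indep_set_coord_algebra:
  assumes X: "indep_vars (\<lambda>_. borel) X I" and AB: "A \<subseteq> I" "B \<subseteq> I" "A \<inter> B = {}"
  shows "indep_set (sets (coord_algebra M X A)) (sets (coord_algebra M X B))"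
  using indep_var_restrict[OF X AB(3,1,2)]
  unfolding indep_var_eq coord_algebra_def sets_vimage_algebra by simp

lemma (in prob_space) joint_distr_coord_algebra:
  assumes X: "indep_vars (\<lambda>_. borel) X I" and AB: "A \<subseteq> I" "B \<subseteq> I" "A \<inter> B = {}"
    and f: "f \<in> measurable (coord_algebra M X A) S" and g: "g \<in> measurable (coord_algebra M X B) T"
  shows "distr M S f \<Otimes>\<^sub>M distr M T g = distr M (S \<Otimes>\<^sub>M T) (\<lambda>\<omega>. (f \<omega>, g \<omega>))"
proof -
  have rv: "X i \<in> borel_measurable M" if "i \<in> I" for i
    using X that by (auto simp: indep_vars_def)
  have [measurable]: "f \<in> measurable M S" "g \<in> measurable M T"
    using measurable_coord_algebra_mono[OF f] measurable_coord_algebra_mono[OF g] rv AB by auto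
  interpret F: prob_space "distr M S f" by (rule prob_space_distr) simp
  interpret G: prob_space "distr M T g" by (rule prob_space_distr) simp
  show ?thesis
  proof (rule pair_measure_eqI)
    show "sigma_finite_measure (distr M S f)" "sigma_finite_measure (distr M T g)"
      by unfold_locales
    fix E E' assume E: "E \<in> sets (distr M S f)" "E' \<in> sets (distr M T g)"
    have "f -` E \<inter> space M \<in> sets (coord_algebra M X A)" "g -` E' \<inter> space M \<in> sets (coord_algebra M X B)"
      using measurable_sets[OF f, of E] measurable_sets[OF g, of E'] E by auto
    then have "prob ((f -` E \<inter> space M) \<inter> (g -` E' \<inter> space M))
        = prob (f -` E \<inter> space M) * prob (g -` E' \<inter> space M)"
      by (rule indep_setD[OF indep_set_coord_algebra[OF X AB]])
    moreover have "(\<lambda>\<omega>. (f \<omega>, g \<omega>)) -` (E \<times> E') \<inter> space M = (f -` E \<inter> space M) \<inter> (g -` E' \<inter> space M)"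
      by auto
    ultimately show "emeasure (distr M S f) E * emeasure (distr M T g) E'
        = emeasure (distr M (S \<Otimes>\<^sub>M T) (\<lambda>\<omega>. (f \<omega>, g \<omega>))) (E \<times> E')"
      using E by (simp add: emeasure_distr emeasure_eq_measure ennreal_mult'')
  qed simp
qed

text \<open>The freezing form of conditional expectation: \<open>Y\<close> is held fixed while the
  independent \<open>E\<close> is integrated out. Fubini on the product law takes the place of
  conditioning on a sigma-algebra.\<close>

lemma (in prob_space) expectation_iterated_coord_algebra:
  fixes f :: "'b \<times> 'c \<Rightarrow> real"
  assumes X: "indep_vars (\<lambda>_. borel) X I" and AB: "A \<subseteq> I" "B \<subseteq> I" "A \<inter> B = {}"
    and Y: "Y \<in> measurable (coord_algebra M X A) S" and E: "E \<in> measurable (coord_algebra M X B) T"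
    and f[measurable]: "f \<in> borel_measurable (S \<Otimes>\<^sub>M T)"
    and int: "integrable M (\<lambda>\<omega>. f (Y \<omega>, E \<omega>))"
  shows "expectation (\<lambda>\<omega>. f (Y \<omega>, E \<omega>)) = expectation (\<lambda>\<omega>. LINT e|distr M T E. f (Y \<omega>, e))"
proof -
  have rv: "X i \<in> borel_measurable M" if "i \<in> I" for i
    using X that by (auto simp: indep_vars_def)
  have [measurable]: "Y \<in> measurable M S" "E \<in> measurable M T"
    using measurable_coord_algebra_mono[OF Y] measurable_coord_algebra_mono[OF E] rv AB by auto
  interpret Y: prob_space "distr M S Y" by (rule prob_space_distr) simp
  interpret E: prob_space "distr M T E" by (rule prob_space_distr) simp
  interpret YE: pair_prob_space "distr M S Y" "distr M T E" ..
  note eq = joint_distr_coord_algebra[OF X AB Y E]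
  have f': "f \<in> borel_measurable (distr M S Y \<Otimes>\<^sub>M distr M T E)" by measurable
  have int': "integrable (distr M S Y \<Otimes>\<^sub>M distr M T E) f"
    unfolding eq using int by (subst integrable_distr_eq) simp_all
  have "expectation (\<lambda>\<omega>. f (Y \<omega>, E \<omega>)) = (LINT y|distr M (S \<Otimes>\<^sub>M T) (\<lambda>\<omega>. (Y \<omega>, E \<omega>)). f y)"
    by (subst integral_distr) simp_all
  also have "\<dots> = (LINT y|distr M S Y. LINT e|distr M T E. f (y, e))"
    unfolding eq[symmetric] by (rule YE.integral_fst'[OF int', symmetric])
  also have "\<dots> = expectation (\<lambda>\<omega>. LINT e|distr M T E. f (Y \<omega>, e))"
  proof (rule integral_distr)
    show "Y \<in> measurable M S" by fact
    have "(\<lambda>y. LINT e|distr M T E. f (y, e)) \<in> borel_measurable (distr M S Y)"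
      using E.borel_measurable_lebesgue_integral[of "\<lambda>y e. f (y, e)" "distr M S Y"] f' by simp
    then show "(\<lambda>y. LINT e|distr M T E. f (y, e)) \<in> borel_measurable S" by simp
  qed
  finally show ?thesis .
qed

lemma (in prob_space) expectation_mult_coord_algebra:
  fixes f g :: "'a \<Rightarrow> real"
  assumes X: "indep_vars (\<lambda>_. borel) X I" and AB: "A \<subseteq> I" "B \<subseteq> I" "A \<inter> B = {}"
    and f: "f \<in> borel_measurable (coord_algebra M X A)" and g: "g \<in> borel_measurable (coord_algebra M X B)"
    and int: "integrable M (\<lambda>\<omega>. f \<omega> * g \<omega>)"
  shows "expectation (\<lambda>\<omega>. f \<omega> * g \<omega>) = expectation f * expectation g"
proof -
  have gM: "g \<in> borel_measurable M"
    by (rule measurable_coord_algebra_mono[OF g]) (use X AB in \<open>auto simp: indep_vars_def\<close>)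
  have "expectation (\<lambda>\<omega>. f \<omega> * g \<omega>) = expectation (\<lambda>\<omega>. LINT e|distr M borel g. f \<omega> * e)"
    using expectation_iterated_coord_algebra[OF X AB f g, of "\<lambda>(y, e). y * e"] int by simp
  also have "\<dots> = expectation (\<lambda>\<omega>. f \<omega> * expectation g)"
    using gM by (simp add: integral_distr)
  finally show ?thesis by simp
qed

text \<open>The difference of two indicators takes only the values 0 and \<sigma> = \<plusminus>1,
  so its square is \<sigma> times itself and its variance is \<sigma> m - m^2, where m is its mean.
  The variance is thus of the order of the increment of the distribution function, not of constant
  order.\<close>

lemma step_variance_le:
  assumes "real_distribution Q"
  shows "(LINT e|Q. of_bool (e \<le> a) - of_bool (e \<le> b) - (cdf Q a - cdf Q b)) = 0"
    and "(LINT e|Q. (of_bool (e \<le> a) - of_bool (e \<le> b) - (cdf Q a - cdf Q b))\<^sup>2) \<le> \<bar>cdf Q a - cdf Q b\<bar>"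
proof -
  interpret Q: real_distribution Q by fact
  let ?X = "\<lambda>e. of_bool (e \<le> a) - of_bool (e \<le> b) :: real"
  let ?m = "cdf Q a - cdf Q b"
  define \<sigma> :: real where "\<sigma> = (if b \<le> a then 1 else - 1)"
  have ind: "(\<lambda>e. of_bool (e \<le> a) :: real) = indicator {..a}" for a :: real
    by (auto simp: indicator_def)
  have int1: "integrable Q (\<lambda>e. of_bool (e \<le> a) :: real)" for a
    by (rule Q.integrable_const_bound[of _ 1]) auto
  have E1: "(LINT e|Q. of_bool (e \<le> a)) = cdf Q a" for a
    unfolding ind by (simp add: cdf_def)
  have int: "integrable Q ?X" using int1 by simp
  have EX: "(LINT e|Q. ?X e) = ?m" using int1 E1 by simp
  show "(LINT e|Q. ?X e - ?m) = 0"
    using Bochner_Integration.integral_diff[OF int, of "\<lambda>_. ?m"] EX Q.prob_space by simp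
  have "(?X e - ?m)\<^sup>2 = (\<sigma> - 2 * ?m) * ?X e + ?m\<^sup>2" for e
  proof -
    have "(?X e)\<^sup>2 = \<sigma> * ?X e" unfolding \<sigma>_def by (auto simp: of_bool_def)
    moreover have "(y - ?m)\<^sup>2 = y\<^sup>2 - 2 * ?m * y + ?m\<^sup>2" for y
      by (simp add: power2_eq_square algebra_simps)
    ultimately show ?thesis by (simp only: left_diff_distrib)
  qed
  then have "(LINT e|Q. (?X e - ?m)\<^sup>2) = (\<sigma> - 2 * ?m) * ?m + ?m\<^sup>2"
    using int EX Q.prob_space by simp
  also have "\<dots> = \<sigma> * ?m - ?m\<^sup>2" by (simp add: algebra_simps power2_eq_square)
  also have "\<dots> \<le> \<sigma> * ?m" by simp
  also have "\<dots> \<le> \<bar>?m\<bar>" unfolding \<sigma>_def by auto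
  finally show "(LINT e|Q. (?X e - ?m)\<^sup>2) \<le> \<bar>?m\<bar>" .
qed

lemma (in real_distribution) cdf_range: "0 \<le> cdf M y" "cdf M y \<le> 1"
  by (rule cdf_nonneg, rule cdf_bounded_prob)

text \<open>Truncation provides the dominating constant 1, so convergence holds for every law, even
  without a first moment.\<close>

lemma truncated_moment_lim:
  assumes "real_distribution Q" and a: "a \<longlonglongrightarrow> 0" "\<And>n. 0 \<le> a n"
  shows "(\<lambda>n. LINT s|Q. min 1 (a n * \<bar>s\<bar>)) \<longlonglongrightarrow> (0 :: real)"
proof -
  interpret Q: real_distribution Q by fact
  have "(\<lambda>n. LINT s|Q. min 1 (a n * \<bar>s\<bar>)) \<longlonglongrightarrow> (LINT s|Q. 0)"
  proof (rule integral_dominated_convergence[where w="\<lambda>_. 1"])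
    have "(\<lambda>n. min 1 (a n * \<bar>s\<bar>)) \<longlonglongrightarrow> min 1 (0 * \<bar>s\<bar>)" for s :: real
      by (intro tendsto_min tendsto_const tendsto_mult a)
    then show "AE s in Q. (\<lambda>n. min 1 (a n * \<bar>s\<bar>)) \<longlonglongrightarrow> 0" by simp
  qed (use a(2) in auto)
  then show ?thesis by simp
qed

section \<open>The stationary solution\<close>

lemma (in ar_outlier_model) innovation_moments:
  assumes P0: "real_distribution P0" "G0 = cdf P0" and PH: "real_distribution PH" "H = cdf PH"
    and \<rho>: "0 \<le> \<rho>" and f: "integrable P0 f" "integrable PH (f :: real \<Rightarrow> real)"
  shows "integrable M (\<lambda>\<omega>. f (\<epsilon> t \<omega>))"
    and "expectation (\<lambda>\<omega>. f (\<epsilon> t \<omega>)) = (1 - local_rate \<rho> n) * (LINT s|P0. f s) + local_rate \<rho> n * (LINT s|PH. f s)"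
proof -
  have [measurable]: "\<epsilon> t \<in> borel_measurable M"
    using indep unfolding indep_vars_def by (auto dest!: bspec[of _ _ "Inl t"])
  interpret P0: real_distribution P0 by fact
  have [measurable]: "f \<in> borel_measurable borel" using borel_measurable_integrable[OF f(1)] by simp
  have Q: "real_distribution (distr M borel (\<epsilon> t))" by simp
  have r: "0 \<le> local_rate \<rho> n" "local_rate \<rho> n \<le> 1" using \<rho> unfolding local_rate_def by auto
  have cdf: "cdf (distr M borel (\<epsilon> t)) y = (1 - local_rate \<rho> n) * cdf P0 y + local_rate \<rho> n * cdf PH y" for y
    by (simp add: innovation_cdf mixture_cdf_def P0 PH)
  note mix = mixture_distribution_integral[OF P0(1) PH(1) Q r cdf f]
  show "integrable M (\<lambda>\<omega>. f (\<epsilon> t \<omega>))" using mix(1) by (subst (asm) integrable_distr_eq) simp_all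
  show "expectation (\<lambda>\<omega>. f (\<epsilon> t \<omega>)) = (1 - local_rate \<rho> n) * (LINT s|P0. f s) + local_rate \<rho> n * (LINT s|PH. f s)"
    using mix(2) by (subst (asm) integral_distr) simp_all
qed

text \<open>\<open>V\<close>, \<open>\<psi>\<close> and \<open>c\<close> are parameters rather than
  quantities derived from the model. Constants built from them therefore coincide across all models
  of the double array, whatever n, \<gamma> and \<rho>.\<close>

locale outlier_bounds = ar_outlier_model M p \<beta> \<nu> G0 H P\<xi> n \<gamma> \<rho> \<epsilon> v z \<xi>
  for M :: "'w measure"
    and p :: nat and \<beta> :: "nat \<Rightarrow> real" and \<nu> :: real
    and G0 H :: "real \<Rightarrow> real" and P\<xi> :: "real measure"
    and n :: nat and \<gamma> \<rho> :: real
    and \<epsilon> v z \<xi> :: "int \<Rightarrow> 'w \<Rightarrow> real" +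
  fixes \<mu> V :: real and \<psi> :: "nat \<Rightarrow> real" and c :: "nat \<Rightarrow> nat \<Rightarrow> real"
  assumes n_pos: "n \<ge> 1"
    and mean: "\<nu> = (1 - (\<Sum>j=1..p. \<beta> j)) * \<mu>"
    and \<epsilon>_sq: "integrable M (\<lambda>\<omega>. (\<epsilon> t \<omega>)\<^sup>2)"
    and \<epsilon>_mean: "expectation (\<epsilon> t) = 0"
    and \<epsilon>_var: "expectation (\<lambda>\<omega>. (\<epsilon> t \<omega>)\<^sup>2) \<le> V"
    and \<psi>_summable: "summable (\<lambda>i. \<bar>\<psi> i\<bar>)"
    and c_lim: "(\<lambda>k. c k j) \<longlonglongrightarrow> 0"
    and iterate: "(\<And>t. u t = (\<Sum>j=1..p. \<beta> j * u (t - int j)) + e t) \<Longrightarrow>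
       u t = (\<Sum>i\<le>k. \<psi> i * e (t - int i)) + (\<Sum>j=1..p. c k j * u (t - int k - int j))"
begin

definition X where "X = case_sum \<epsilon> (case_sum z \<xi>)"

text \<open>The causal moving average of infinite order. Where the series diverges the value is
  arbitrary but the function is still measurable; convergence holds almost surely by
  \<open>U_summable\<close>.\<close>

definition U where "U t \<omega> = (\<Sum>i. \<psi> i * \<epsilon> (t - int i) \<omega>)"

definition CU where "CU = (\<Sum>i. \<bar>\<psi> i\<bar>)\<^sup>2 * V"

lemma X_simps [simp]: "X (Inl t) = \<epsilon> t" "X (Inr (Inl t)) = z t" "X (Inr (Inr t)) = \<xi> t"
  by (simp_all add: X_def)

lemma X_indep: "indep_vars (\<lambda>_. borel) X (UNIV <+> {1 - int p..int n} <+> {1 - int p..int n})"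
  unfolding X_def by (rule indep)

lemma X_measurable: "i \<in> UNIV <+> {1 - int p..int n} <+> {1 - int p..int n} \<Longrightarrow> X i \<in> borel_measurable M"
  using X_indep by (auto simp: indep_vars_def)

lemma \<epsilon>_measurable [measurable]: "\<epsilon> t \<in> borel_measurable M"
  using X_measurable[of "Inl t"] by auto

lemma U_measurable [measurable]: "U t \<in> borel_measurable M"
  unfolding U_def[abs_def] by measurable

lemma V_nonneg: "0 \<le> V"
  by (rule order_trans[OF Bochner_Integration.integral_nonneg \<epsilon>_var[of 0]]) simp

text \<open>Since |e| \<le> 1 + e^2, convergence of the weighted squares forces absolute convergence
  of the series. The square bound is the Cauchy-Schwarz inequality with weights |\<psi>|, passed to
  the limit.\<close>

lemma causal_square_bound:
  fixes e :: "nat \<Rightarrow> real"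
  assumes sq: "summable (\<lambda>i. \<bar>\<psi> i\<bar> * (e i)\<^sup>2)"
  shows "summable (\<lambda>i. \<psi> i * e i)"
    and "(\<Sum>i. \<psi> i * e i)\<^sup>2 \<le> (\<Sum>i. \<bar>\<psi> i\<bar>) * (\<Sum>i. \<bar>\<psi> i\<bar> * (e i)\<^sup>2)"
proof -
  have e1: "\<bar>e i\<bar> \<le> 1 + (e i)\<^sup>2" for i
    using sum_squares_bound[of 1 "\<bar>e i\<bar>"] by (simp add: power2_eq_square abs_mult_self_eq)
  have bnd: "norm (\<psi> i * e i) \<le> \<bar>\<psi> i\<bar> + \<bar>\<psi> i\<bar> * (e i)\<^sup>2" for i
    using mult_left_mono[OF e1, of "\<bar>\<psi> i\<bar>" i] by (simp add: abs_mult algebra_simps)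
  show summ: "summable (\<lambda>i. \<psi> i * e i)"
    by (rule summable_comparison_test'[OF summable_add[OF \<psi>_summable sq], of 0]) (rule bnd)
  have le: "(\<Sum>i<k. \<psi> i * e i)\<^sup>2 \<le> (\<Sum>i. \<bar>\<psi> i\<bar>) * (\<Sum>i. \<bar>\<psi> i\<bar> * (e i)\<^sup>2)" for k
  proof -
    have "\<bar>\<Sum>i<k. \<psi> i * e i\<bar> \<le> (\<Sum>i<k. \<bar>\<psi> i\<bar> * \<bar>e i\<bar>)"
      using sum_abs[of "\<lambda>i. \<psi> i * e i"] by (simp add: abs_mult)
    then have "(\<Sum>i<k. \<psi> i * e i)\<^sup>2 \<le> (\<Sum>i<k. \<bar>\<psi> i\<bar> * \<bar>e i\<bar>)\<^sup>2"
      using power_mono[OF _ abs_ge_zero, of "\<Sum>i<k. \<psi> i * e i" _ 2] by simp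
    also have "\<dots> \<le> (\<Sum>i<k. \<bar>\<psi> i\<bar>) * (\<Sum>i<k. \<bar>\<psi> i\<bar> * \<bar>e i\<bar>\<^sup>2)"
      by (rule weighted_Cauchy_Schwarz_sum) simp
    also have "\<dots> \<le> (\<Sum>i. \<bar>\<psi> i\<bar>) * (\<Sum>i. \<bar>\<psi> i\<bar> * (e i)\<^sup>2)"
      unfolding power2_abs
    proof (rule mult_mono)
      show "(\<Sum>i<k. \<bar>\<psi> i\<bar>) \<le> (\<Sum>i. \<bar>\<psi> i\<bar>)"
        by (rule sum_le_suminf[OF \<psi>_summable]) simp_all
      show "(\<Sum>i<k. \<bar>\<psi> i\<bar> * (e i)\<^sup>2) \<le> (\<Sum>i. \<bar>\<psi> i\<bar> * (e i)\<^sup>2)"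
        by (rule sum_le_suminf[OF sq]) simp_all
      show "0 \<le> (\<Sum>i. \<bar>\<psi> i\<bar>)" by (rule suminf_nonneg[OF \<psi>_summable]) simp
      show "0 \<le> (\<Sum>i<k. \<bar>\<psi> i\<bar> * (e i)\<^sup>2)" by (rule sum_nonneg) simp
    qed
    finally show ?thesis .
  qed
  have "(\<lambda>k. (\<Sum>i<k. \<psi> i * e i)\<^sup>2) \<longlonglongrightarrow> (\<Sum>i. \<psi> i * e i)\<^sup>2"
    by (intro tendsto_power summable_LIMSEQ summ)
  then show "(\<Sum>i. \<psi> i * e i)\<^sup>2 \<le> (\<Sum>i. \<bar>\<psi> i\<bar>) * (\<Sum>i. \<bar>\<psi> i\<bar> * (e i)\<^sup>2)"
    by (rule LIMSEQ_le_const2) (use le in blast)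
qed

text \<open>The estimates run with extended nonnegative integrals, where sum and integral may be
  exchanged before finiteness is known. Finiteness of the weighted sum of squares then yields almost
  sure convergence and, by Cauchy-Schwarz, the second moment.\<close>

lemma U_moments:
  shows U_summable: "AE \<omega> in M. summable (\<lambda>i. \<psi> i * \<epsilon> (t - int i) \<omega>)"
    and U_sq: "integrable M (\<lambda>\<omega>. (U t \<omega>)\<^sup>2)"
    and U_var: "expectation (\<lambda>\<omega>. (U t \<omega>)\<^sup>2) \<le> CU"
proof -
  let ?S = "\<Sum>i. \<bar>\<psi> i\<bar>"
  let ?W = "\<lambda>\<omega>. \<Sum>i. ennreal (\<bar>\<psi> i\<bar> * (\<epsilon> (t - int i) \<omega>)\<^sup>2)"
  have S: "0 \<le> ?S" by (rule suminf_nonneg[OF \<psi>_summable]) simp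
  have "(\<integral>\<^sup>+\<omega>. ?W \<omega> \<partial>M) = (\<Sum>i. \<integral>\<^sup>+\<omega>. ennreal (\<bar>\<psi> i\<bar> * (\<epsilon> (t - int i) \<omega>)\<^sup>2) \<partial>M)"
    by (rule nn_integral_suminf) measurable
  also have "\<dots> \<le> (\<Sum>i. ennreal (\<bar>\<psi> i\<bar> * V))"
  proof (intro suminf_le)
    fix i
    have "(\<integral>\<^sup>+\<omega>. ennreal (\<bar>\<psi> i\<bar> * (\<epsilon> (t - int i) \<omega>)\<^sup>2) \<partial>M)
        = ennreal (expectation (\<lambda>\<omega>. \<bar>\<psi> i\<bar> * (\<epsilon> (t - int i) \<omega>)\<^sup>2))"
      by (rule nn_integral_eq_integral) (use \<epsilon>_sq in auto)
    also have "\<dots> \<le> ennreal (\<bar>\<psi> i\<bar> * V)"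
      using \<epsilon>_var by (simp add: ennreal_leI mult_left_mono)
    finally show "(\<integral>\<^sup>+\<omega>. ennreal (\<bar>\<psi> i\<bar> * (\<epsilon> (t - int i) \<omega>)\<^sup>2) \<partial>M) \<le> ennreal (\<bar>\<psi> i\<bar> * V)" .
  qed auto
  also have "\<dots> = ennreal (?S * V)"
    using \<psi>_summable V_nonneg
    by (subst suminf_ennreal2) (simp_all add: suminf_mult2[symmetric] summable_mult2)
  finally have W: "(\<integral>\<^sup>+\<omega>. ?W \<omega> \<partial>M) \<le> ennreal (?S * V)" .
  have "AE \<omega> in M. ?W \<omega> \<noteq> \<infinity>"
  proof (rule nn_integral_PInf_AE)
    show "(\<integral>\<^sup>+\<omega>. ?W \<omega> \<partial>M) \<noteq> \<infinity>"
      using le_less_trans[OF W ennreal_less_top] by simp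
  qed measurable
  then have AE: "AE \<omega> in M. summable (\<lambda>i. \<bar>\<psi> i\<bar> * (\<epsilon> (t - int i) \<omega>)\<^sup>2)"
    by eventually_elim (rule summable_suminf_not_top, auto)
  then show "AE \<omega> in M. summable (\<lambda>i. \<psi> i * \<epsilon> (t - int i) \<omega>)"
    by eventually_elim (rule causal_square_bound(1))
  have "AE \<omega> in M. ennreal ((U t \<omega>)\<^sup>2) \<le> ennreal ?S * ?W \<omega>"
    using AE
  proof eventually_elim
    case (elim \<omega>)
    have "ennreal ?S * ?W \<omega> = ennreal (?S * (\<Sum>i. \<bar>\<psi> i\<bar> * (\<epsilon> (t - int i) \<omega>)\<^sup>2))"
      using elim S by (subst suminf_ennreal2) (simp_all add: ennreal_mult suminf_nonneg)
    then show ?case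
      using causal_square_bound(2)[OF elim] unfolding U_def by (simp add: ennreal_leI)
  qed
  then have "(\<integral>\<^sup>+\<omega>. ennreal ((U t \<omega>)\<^sup>2) \<partial>M) \<le> (\<integral>\<^sup>+\<omega>. ennreal ?S * ?W \<omega> \<partial>M)"
    by (rule nn_integral_mono_AE)
  also have "\<dots> = ennreal ?S * (\<integral>\<^sup>+\<omega>. ?W \<omega> \<partial>M)"
    by (rule nn_integral_cmult) measurable
  also have "\<dots> \<le> ennreal ?S * ennreal (?S * V)"
    by (rule mult_left_mono[OF W]) simp
  also have "\<dots> = ennreal CU"
    using S V_nonneg unfolding CU_def by (simp add: ennreal_mult[symmetric] power2_eq_square mult.assoc)
  finally have le: "(\<integral>\<^sup>+\<omega>. ennreal ((U t \<omega>)\<^sup>2) \<partial>M) \<le> ennreal CU" .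
  show "integrable M (\<lambda>\<omega>. (U t \<omega>)\<^sup>2)"
    using le_less_trans[OF le ennreal_less_top] by (intro integrableI_bounded) simp_all
  show "expectation (\<lambda>\<omega>. (U t \<omega>)\<^sup>2) \<le> CU"
    by (rule integral_real_bounded[OF _ le]) (simp add: CU_def V_nonneg)
qed

section \<open>Every stationary solution is the causal one\<close>

lemma v_measurable [measurable]: "v t \<in> borel_measurable M"
  using stationary_solution by (simp add: stationary_ar_solution_def strictly_stationary_def)

lemma v_distr: "distr M borel (v t) = distr M borel (v 0)"
proof -
  have comp: "distr (distr M (Pi\<^sub>M UNIV (\<lambda>_. borel)) (\<lambda>\<omega> s. v (s + h) \<omega>)) borel (\<lambda>y. y 0) = distr M borel (v h)" for h
  proof -
    have "(\<lambda>\<omega> s. v (s + h) \<omega>) \<in> measurable M (Pi\<^sub>M UNIV (\<lambda>_. borel))"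
      by (rule measurable_PiM_single') (auto simp: space_PiM)
    moreover have "(\<lambda>y. y 0) \<in> measurable (Pi\<^sub>M UNIV (\<lambda>_::int. borel :: real measure)) borel"
      by (rule measurable_component_singleton) simp
    ultimately show ?thesis by (subst distr_distr) (simp_all add: comp_def)
  qed
  have "distr M (Pi\<^sub>M UNIV (\<lambda>_. borel)) (\<lambda>\<omega> s. v (s + t) \<omega>) = distr M (Pi\<^sub>M UNIV (\<lambda>_. borel)) (\<lambda>\<omega> s. v (s + 0) \<omega>)"
    using stationary_solution by (simp add: stationary_ar_solution_def strictly_stationary_def)
  then have "distr M borel (v t) = distr (distr M (Pi\<^sub>M UNIV (\<lambda>_. borel)) (\<lambda>\<omega> s. v (s + 0) \<omega>)) borel (\<lambda>y. y 0)"
    unfolding comp[of t, symmetric] by simp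
  then show ?thesis unfolding comp[of 0] .
qed

lemma v_expectation:
  fixes f :: "real \<Rightarrow> real"
  assumes "f \<in> borel_measurable borel"
  shows "expectation (\<lambda>\<omega>. f (v t \<omega>)) = expectation (\<lambda>\<omega>. f (v 0 \<omega>))"
  using v_distr[of t] integral_distr[OF v_measurable[of t] assms] integral_distr[OF v_measurable[of 0] assms]
  by simp

lemma centered_recursion:
  "AE \<omega> in M. \<forall>t. v t \<omega> - \<mu> = (\<Sum>j=1..p. \<beta> j * (v (t - int j) \<omega> - \<mu>)) + \<epsilon> t \<omega>"
proof -
  have "AE \<omega> in M. \<forall>t. v t \<omega> = (\<Sum>j=1..p. \<beta> j * v (t - int j) \<omega>) + \<nu> + \<epsilon> t \<omega>"
    using stationary_solution by (simp add: stationary_ar_solution_def)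
  then show ?thesis
  proof eventually_elim
    case (elim \<omega>)
    show ?case
    proof
      fix t
      have "(\<Sum>j=1..p. \<beta> j * (v (t - int j) \<omega> - \<mu>))
          = (\<Sum>j=1..p. \<beta> j * v (t - int j) \<omega>) - (\<Sum>j=1..p. \<beta> j) * \<mu>"
        by (simp only: right_diff_distrib sum_subtractf sum_distrib_right)
      moreover have "\<nu> = \<mu> - (\<Sum>j=1..p. \<beta> j) * \<mu>" unfolding mean by (simp add: left_diff_distrib)
      ultimately show "v t \<omega> - \<mu> = (\<Sum>j=1..p. \<beta> j * (v (t - int j) \<omega> - \<mu>)) + \<epsilon> t \<omega>"
        using elim[rule_format, of t] by linarith
    qed
  qed
qed

text \<open>The iterated recursion leaves a remainder with coefficients tending to 0, and by stationarity
  such a remainder tends to 0 in probability; so every stationary solution is the causal one.\<close>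

lemma stationary_solution_causal: "AE \<omega> in M. \<forall>t. v t \<omega> - \<mu> = U t \<omega>"
  unfolding AE_all_countable
proof
  fix t
  define Rm where "Rm k \<omega> = (\<Sum>j=1..p. c k j * (v (t - int k - int j) \<omega> - \<mu>))" for k \<omega>
  have [measurable]: "Rm k \<in> borel_measurable M" for k unfolding Rm_def[abs_def] by measurable
  have lim: "AE \<omega> in M. (\<lambda>k. Rm k \<omega>) \<longlonglongrightarrow> v t \<omega> - \<mu> - U t \<omega>"
    using centered_recursion U_summable[of t]
  proof eventually_elim
    case (elim \<omega>)
    have "Rm k \<omega> = v t \<omega> - \<mu> - (\<Sum>i\<le>k. \<psi> i * \<epsilon> (t - int i) \<omega>)" for k
      using iterate[of "\<lambda>t. v t \<omega> - \<mu>" "\<lambda>t. \<epsilon> t \<omega>" t k, OF elim(1)[rule_format]]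
      unfolding Rm_def by linarith
    moreover have "(\<lambda>k. v t \<omega> - \<mu> - (\<Sum>i\<le>k. \<psi> i * \<epsilon> (t - int i) \<omega>)) \<longlonglongrightarrow> v t \<omega> - \<mu> - U t \<omega>"
      unfolding U_def by (intro tendsto_diff tendsto_const summable_LIMSEQ' elim(2))
    ultimately show ?case by simp
  qed
  \<comment> \<open>No moment of \<open>v\<close> is known at this point, hence the truncation at 1.
    The limit computed here is compared below with the limit 0.\<close>
  have "(\<lambda>k. expectation (\<lambda>\<omega>. min 1 \<bar>Rm k \<omega>\<bar>)) \<longlonglongrightarrow> expectation (\<lambda>\<omega>. min 1 \<bar>v t \<omega> - \<mu> - U t \<omega>\<bar>)"
  proof (rule integral_dominated_convergence[where w="\<lambda>_. 1"])
    show "AE \<omega> in M. (\<lambda>k. min 1 \<bar>Rm k \<omega>\<bar>) \<longlonglongrightarrow> min 1 \<bar>v t \<omega> - \<mu> - U t \<omega>\<bar>"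
      using lim by eventually_elim (rule tendsto_min[OF tendsto_const tendsto_rabs])
  qed auto
  moreover have "(\<lambda>k. expectation (\<lambda>\<omega>. min 1 \<bar>Rm k \<omega>\<bar>)) \<longlonglongrightarrow> 0"
  proof (rule tendsto_sandwich[of "\<lambda>_. 0"])
    have "expectation (\<lambda>\<omega>. min 1 \<bar>Rm k \<omega>\<bar>) \<le> (\<Sum>j=1..p. expectation (\<lambda>\<omega>. min 1 \<bar>c k j * (v 0 \<omega> - \<mu>)\<bar>))" for k
    proof -
      have int: "integrable M (\<lambda>\<omega>. min 1 \<bar>c k j * (v s \<omega> - \<mu>)\<bar>)" for j s
        by (rule integrable_const_bound[of _ 1]) auto
      have "expectation (\<lambda>\<omega>. min 1 \<bar>Rm k \<omega>\<bar>)
          \<le> expectation (\<lambda>\<omega>. \<Sum>j=1..p. min 1 \<bar>c k j * (v (t - int k - int j) \<omega> - \<mu>)\<bar>)"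
      proof (rule integral_mono)
        show "integrable M (\<lambda>\<omega>. min 1 \<bar>Rm k \<omega>\<bar>)"
          by (rule integrable_const_bound[of _ 1]) auto
        show "min 1 \<bar>Rm k \<omega>\<bar> \<le> (\<Sum>j=1..p. min 1 \<bar>c k j * (v (t - int k - int j) \<omega> - \<mu>)\<bar>)" for \<omega>
          unfolding Rm_def by (rule min_one_abs_sum_le) simp
      qed (use int in auto)
      also have "\<dots> = (\<Sum>j=1..p. expectation (\<lambda>\<omega>. min 1 \<bar>c k j * (v (t - int k - int j) \<omega> - \<mu>)\<bar>))"
        using int by (simp add: Bochner_Integration.integral_sum)
      also have "\<dots> = (\<Sum>j=1..p. expectation (\<lambda>\<omega>. min 1 \<bar>c k j * (v 0 \<omega> - \<mu>)\<bar>))"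
      \<comment> \<open>Stationarity moves every lag to time 0, after which k occurs only in the
        coefficient \<open>c k j\<close>.\<close>
      proof (rule sum.cong[OF refl])
        fix j
        show "expectation (\<lambda>\<omega>. min 1 \<bar>c k j * (v (t - int k - int j) \<omega> - \<mu>)\<bar>)
            = expectation (\<lambda>\<omega>. min 1 \<bar>c k j * (v 0 \<omega> - \<mu>)\<bar>)"
          by (rule v_expectation[of "\<lambda>y. min 1 \<bar>c k j * (y - \<mu>)\<bar>"]) measurable
      qed
      finally show ?thesis .
    qed
    then show "\<forall>\<^sub>F k in sequentially. expectation (\<lambda>\<omega>. min 1 \<bar>Rm k \<omega>\<bar>)
        \<le> (\<Sum>j=1..p. expectation (\<lambda>\<omega>. min 1 \<bar>c k j * (v 0 \<omega> - \<mu>)\<bar>))" by simp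
    show "(\<lambda>k. \<Sum>j=1..p. expectation (\<lambda>\<omega>. min 1 \<bar>c k j * (v 0 \<omega> - \<mu>)\<bar>)) \<longlonglongrightarrow> 0"
    proof (rule tendsto_null_sum)
      fix j
      have "(\<lambda>k. expectation (\<lambda>\<omega>. min 1 \<bar>c k j * (v 0 \<omega> - \<mu>)\<bar>)) \<longlonglongrightarrow> expectation (\<lambda>\<omega>. 0)"
      proof (rule integral_dominated_convergence[where w="\<lambda>_. 1"])
        have "(\<lambda>k. min 1 \<bar>c k j * (v 0 \<omega> - \<mu>)\<bar>) \<longlonglongrightarrow> min 1 \<bar>0 * (v 0 \<omega> - \<mu>)\<bar>" for \<omega>
          by (intro tendsto_min tendsto_const tendsto_rabs tendsto_mult c_lim)
        then show "AE \<omega> in M. (\<lambda>k. min 1 \<bar>c k j * (v 0 \<omega> - \<mu>)\<bar>) \<longlonglongrightarrow> 0" by simp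
      qed auto
      then show "(\<lambda>k. expectation (\<lambda>\<omega>. min 1 \<bar>c k j * (v 0 \<omega> - \<mu>)\<bar>)) \<longlonglongrightarrow> 0" by simp
    qed
  qed auto
  ultimately have "expectation (\<lambda>\<omega>. min 1 \<bar>v t \<omega> - \<mu> - U t \<omega>\<bar>) = 0"
    by (rule LIMSEQ_unique)
  moreover have "integrable M (\<lambda>\<omega>. min 1 \<bar>v t \<omega> - \<mu> - U t \<omega>\<bar>)"
    by (rule integrable_const_bound[of _ 1]) auto
  ultimately have "AE \<omega> in M. min 1 \<bar>v t \<omega> - \<mu> - U t \<omega>\<bar> = 0"
    using integral_nonneg_eq_0_iff_AE[of M "\<lambda>\<omega>. min 1 \<bar>v t \<omega> - \<mu> - U t \<omega>\<bar>"] by simp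
  then show "AE \<omega> in M. v t \<omega> - \<mu> = U t \<omega>"
    by eventually_elim (auto simp: min_def split: if_splits)
qed

end

section \<open>Expansion of the compensator\<close>

text \<open>\<open>gx\<close> stands for g_0(x), and \<open>L\<close> is a common Lipschitz constant
  of both distribution functions that also bounds \<open>gx\<close>. The condition
  \<open>n_large\<close> makes the minimum in the contamination rate inactive, so the rate is
  exactly \<gamma> / sqrt n.\<close>

locale outlier_expansion = outlier_bounds M p \<beta> \<nu> G0 H P\<xi> n \<gamma> \<rho> \<epsilon> v z \<xi> \<mu> V \<psi> c
  for M :: "'w measure"
    and p :: nat and \<beta> :: "nat \<Rightarrow> real" and \<nu> :: real
    and G0 H :: "real \<Rightarrow> real" and P\<xi> :: "real measure"
    and n :: nat and \<gamma> \<rho> :: real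
    and \<epsilon> v z \<xi> :: "int \<Rightarrow> 'w \<Rightarrow> real"
    and \<mu> V :: real and \<psi> :: "nat \<Rightarrow> real" and c :: "nat \<Rightarrow> nat \<Rightarrow> real" +
  fixes x \<Theta> \<Gamma> R K L gx :: real
  assumes \<gamma>_range: "0 \<le> \<gamma>" "\<gamma> \<le> \<Gamma>" and \<rho>_range: "0 \<le> \<rho>" "\<rho> \<le> R"
    and n_large: "\<Gamma> \<le> sqrt (real n)" and \<Theta>_nonneg: "0 \<le> \<Theta>"
    and \<xi>_law: "real_distribution P\<xi>"
    and char_at_1: "(\<Sum>j=1..p. \<beta> j) \<noteq> 1"
    and K_nonneg: "0 \<le> K" and L_nonneg: "0 \<le> L"
    and G0_taylor: "\<bar>G0 (x + w) - G0 x - gx * w\<bar> \<le> K * w\<^sup>2"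
    and gx_bound: "\<bar>gx\<bar> \<le> L"
    and G0_lip: "\<bar>G0 (y + w) - G0 y\<bar> \<le> L * \<bar>w\<bar>" and H_lip: "\<bar>H (y + w) - H y\<bar> \<le> L * \<bar>w\<bar>"
    and G0_range: "0 \<le> G0 y" "G0 y \<le> 1" and H_range: "0 \<le> H y" "H y \<le> 1"
    and G0_measurable [measurable]: "G0 \<in> borel_measurable borel"
    and H_measurable [measurable]: "H \<in> borel_measurable borel"
begin

text \<open>
  \<open>Z\<close> and \<open>Xi\<close> are versions of \<open>z\<close> and \<open>\<xi>\<close> that are \<open>{0, 1}\<close>-valued, respectively measurable, at all
  times. With \<open>aa = - \<alpha>\<^sub>t\<^sub>n\<close>, the threshold of the paper is \<open>x + (aa + pert \<tau> 0)\<close>, where \<open>\<tau> 0\<close> stands for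
  \<open>\<tau>\<^sub>0\<close>; the parameter \<open>s\<close> of \<open>pert \<tau> s\<close> adds a slack that dominates the effect of changing each
  coordinate of \<open>\<tau>\<close> by at most \<open>\<bar>s\<bar>\<close>.
\<close>

definition J where "J = {1 - int p..int n}"

definition q where "q = 1 / sqrt (real n)"

text \<open>The extra 1 leaves room for a slack with |s| \<le> 1.\<close>

abbreviation "\<theta> \<equiv> \<Theta> + 1"

abbreviation "F \<equiv> mixture_cdf G0 H \<rho> n"

definition Z where "Z t \<omega> = (of_bool (t \<in> J \<and> z t \<omega> = 1) :: real)"

definition Xi where "Xi t \<omega> = (if t \<in> J then \<xi> t \<omega> else 0)"

text \<open>\<open>cc\<close> and \<open>ee\<close> are envelopes for the process part and the
  outlier part of the perturbation; the 1 in \<open>cc\<close> belongs to \<tau>_0. The number of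
  outliers among the p + 1 relevant times is \<open>zz\<close>.\<close>

definition cc where "cc t \<omega> = 1 + (\<Sum>j=1..p. \<bar>U (t - int j) \<omega>\<bar>)"

definition ee where "ee t \<omega> = (\<Sum>j=1..p. Z (t - int j) \<omega> * \<bar>Xi (t - int j) \<omega>\<bar>)"

definition zz where "zz t \<omega> = (\<Sum>j=0..p. Z (t - int j) \<omega>)"

definition aa where "aa t \<omega> = (\<Sum>j=0..p. (\<beta>(0 := -1)) j * (Z (t - int j) \<omega> * Xi (t - int j) \<omega>))"

definition lin where "lin \<tau> t \<omega> = \<tau> 0 + (\<Sum>j=1..p. \<tau> j * U (t - int j) \<omega>)" for \<tau> :: "nat \<Rightarrow> real"

definition pert where
  "pert \<tau> s t \<omega> = q * lin \<tau> t \<omega> + q * (\<Sum>j=1..p. \<tau> j * (Z (t - int j) \<omega> * Xi (t - int j) \<omega>))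
     + s * (q * (cc t \<omega> + ee t \<omega>))" for \<tau> :: "nat \<Rightarrow> real" and s :: real

definition D where
  "D \<tau> s t \<omega> = of_bool (\<epsilon> t \<omega> \<le> x + (aa t \<omega> + pert \<tau> s t \<omega>)) - of_bool (\<epsilon> t \<omega> \<le> x)
     - (F (x + (aa t \<omega> + pert \<tau> s t \<omega>)) - F x)" for \<tau> :: "nat \<Rightarrow> real" and s :: real

lemma q_pos: "0 < q" and q_sq: "real n * (q * q) = 1" and q_n: "q * real n * q = 1"
  using n_pos by (auto simp: q_def field_simps)

lemma \<gamma>_rate: "local_rate \<gamma> n = \<gamma> * q" and \<gamma>_rate_le: "\<gamma> * q \<le> \<Gamma> * q" "0 \<le> \<gamma> * q" "\<gamma> * q \<le> 1"
proof -
  show "\<gamma> * q \<le> \<Gamma> * q" "0 \<le> \<gamma> * q" using \<gamma>_range q_pos by (simp_all add: mult_right_mono)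
  have "\<Gamma> * q \<le> 1" using n_large n_pos unfolding q_def by (simp add: field_simps)
  then show "\<gamma> * q \<le> 1" using \<open>\<gamma> * q \<le> \<Gamma> * q\<close> by linarith
  then show "local_rate \<gamma> n = \<gamma> * q" unfolding local_rate_def q_def by simp
qed

lemma \<Gamma>_nonneg: "0 \<le> \<Gamma>" and R_nonneg: "0 \<le> R"
  using \<gamma>_range \<rho>_range by linarith+

lemma \<rho>_rate: "0 \<le> local_rate \<rho> n" "local_rate \<rho> n \<le> 1" "local_rate \<rho> n \<le> R * q"
proof -
  show "0 \<le> local_rate \<rho> n" "local_rate \<rho> n \<le> 1" using \<rho>_range unfolding local_rate_def by auto
  have "local_rate \<rho> n \<le> \<rho> * q" unfolding local_rate_def q_def by simp
  also have "\<dots> \<le> R * q" using \<rho>_range q_pos by (simp add: mult_right_mono)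
  finally show "local_rate \<rho> n \<le> R * q" .
qed

lemma F_measurable [measurable]: "F \<in> borel_measurable borel"
  unfolding mixture_cdf_def[abs_def] by measurable

lemma F_eq: "F y = G0 y + local_rate \<rho> n * (H y - G0 y)"
  by (simp add: mixture_cdf_def algebra_simps)

lemma increment_le_1: "\<bar>G0 y - G0 y'\<bar> \<le> 1" "\<bar>H y - H y'\<bar> \<le> 1"
  using G0_range[of y] G0_range[of y'] H_range[of y] H_range[of y'] by auto

lemma Z_cases: "Z t \<omega> = 0 \<or> Z t \<omega> = 1" and Z_nonneg: "0 \<le> Z t \<omega>" and Z_le_1: "Z t \<omega> \<le> 1"
  by (auto simp: Z_def)

lemma cc_ge_1: "1 \<le> cc t \<omega>" unfolding cc_def by (simp add: sum_nonneg)

lemma ee_nonneg: "0 \<le> ee t \<omega>" unfolding ee_def by (intro sum_nonneg mult_nonneg_nonneg Z_nonneg) simp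

lemma zz_nonneg: "0 \<le> zz t \<omega>" unfolding zz_def by (intro sum_nonneg Z_nonneg)

lemma Z_le_zz: "j \<le> p \<Longrightarrow> Z (t - int j) \<omega> \<le> zz t \<omega>"
  unfolding zz_def by (rule member_le_sum) (auto simp: Z_nonneg)

lemma zz_cases:
  obtains "zz t \<omega> = 0" "\<And>j. j \<le> p \<Longrightarrow> Z (t - int j) \<omega> = 0" | "1 \<le> zz t \<omega>"
proof (cases "\<exists>j\<le>p. Z (t - int j) \<omega> = 1")
  case True
  then show ?thesis using Z_le_zz that(2) by metis
next
  case False
  then have 0: "Z (t - int j) \<omega> = 0" if "j \<le> p" for j using Z_cases that by blast
  then have "zz t \<omega> = 0" unfolding zz_def by (intro sum.neutral) auto
  then show ?thesis using 0 that(1) by blast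
qed

lemma lin_bound:
  assumes \<tau>: "\<And>j. j \<le> p \<Longrightarrow> \<bar>\<tau> j\<bar> \<le> \<Theta>"
  shows "\<bar>lin \<tau> t \<omega>\<bar> \<le> \<Theta> * cc t \<omega>"
proof -
  have "\<bar>\<Sum>j=1..p. \<tau> j * U (t - int j) \<omega>\<bar> \<le> (\<Sum>j=1..p. \<Theta> * \<bar>U (t - int j) \<omega>\<bar>)"
    by (rule order_trans[OF sum_abs sum_mono]) (use \<tau> in \<open>auto simp: abs_mult intro: mult_right_mono\<close>)
  then show ?thesis
    using \<tau>[of 0] unfolding lin_def cc_def by (simp add: sum_distrib_left[symmetric] distrib_left)
qed

lemma pert_bound:
  assumes \<tau>: "\<And>j. j \<le> p \<Longrightarrow> \<bar>\<tau> j\<bar> \<le> \<Theta>" and s: "\<bar>s\<bar> \<le> 1"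
  shows "\<bar>pert \<tau> s t \<omega>\<bar> \<le> \<theta> * q * (cc t \<omega> + ee t \<omega>)"
proof -
  have "\<bar>\<Sum>j=1..p. \<tau> j * (Z (t - int j) \<omega> * Xi (t - int j) \<omega>)\<bar> \<le> (\<Sum>j=1..p. \<Theta> * (Z (t - int j) \<omega> * \<bar>Xi (t - int j) \<omega>\<bar>))"
    by (rule order_trans[OF sum_abs sum_mono])
      (use \<tau> in \<open>auto simp: abs_mult Z_nonneg intro!: mult_right_mono\<close>)
  then have 1: "\<bar>\<Sum>j=1..p. \<tau> j * (Z (t - int j) \<omega> * Xi (t - int j) \<omega>)\<bar> \<le> \<Theta> * ee t \<omega>"
    unfolding ee_def by (simp add: sum_distrib_left[symmetric])
  have "0 \<le> q * (cc t \<omega> + ee t \<omega>)"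
    using q_pos cc_ge_1[of t \<omega>] ee_nonneg[of t \<omega>] by simp
  then have 2: "\<bar>s * (q * (cc t \<omega> + ee t \<omega>))\<bar> \<le> q * (cc t \<omega> + ee t \<omega>)"
    using mult_right_mono[OF s, of "q * (cc t \<omega> + ee t \<omega>)"] by (simp only: abs_mult[of s] abs_of_nonneg mult_1)
  have "\<bar>pert \<tau> s t \<omega>\<bar> \<le> q * \<bar>lin \<tau> t \<omega>\<bar> + q * \<bar>\<Sum>j=1..p. \<tau> j * (Z (t - int j) \<omega> * Xi (t - int j) \<omega>)\<bar>
      + \<bar>s * (q * (cc t \<omega> + ee t \<omega>))\<bar>"
    unfolding pert_def using q_pos
    by (intro order_trans[OF abs_triangle_ineq] add_mono) (simp_all add: abs_mult)
  also have "\<dots> \<le> q * (\<Theta> * cc t \<omega>) + q * (\<Theta> * ee t \<omega>) + q * (cc t \<omega> + ee t \<omega>)"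
    using q_pos lin_bound[of \<tau> t \<omega>, OF \<tau>] 1 2 by (intro add_mono mult_left_mono) auto
  also have "\<dots> = \<theta> * q * (cc t \<omega> + ee t \<omega>)" by (simp add: algebra_simps)
  finally show ?thesis .
qed

lemma no_outlier:
  assumes "\<And>j. j \<le> p \<Longrightarrow> Z (t - int j) \<omega> = 0"
  shows "aa t \<omega> = 0" "ee t \<omega> = 0" "pert \<tau> s t \<omega> = q * lin \<tau> t \<omega> + s * (q * cc t \<omega>)"
proof -
  show "aa t \<omega> = 0" unfolding aa_def by (intro sum.neutral) (auto simp: assms)
  show ee: "ee t \<omega> = 0" unfolding ee_def by (intro sum.neutral) (auto simp: assms)
  have "(\<Sum>j=1..p. \<tau> j * (Z (t - int j) \<omega> * Xi (t - int j) \<omega>)) = 0"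
    by (intro sum.neutral) (auto simp: assms)
  then show "pert \<tau> s t \<omega> = q * lin \<tau> t \<omega> + s * (q * cc t \<omega>)" unfolding pert_def ee by simp
qed

text \<open>Without outliers only the perturbation of order \<open>q\<close> shifts the argument,
  and the Lipschitz bound applies. With at least one outlier the trivial bound 1 is absorbed by
  \<open>zz\<close>, whatever the outlier sizes.\<close>

lemma lipschitz_increment_bound:
  assumes \<tau>: "\<And>j. j \<le> p \<Longrightarrow> \<bar>\<tau> j\<bar> \<le> \<Theta>" and s: "\<bar>s\<bar> \<le> 1"
    and lip: "\<And>w. \<bar>f (x + w) - f x\<bar> \<le> L * \<bar>w\<bar>" and one: "\<And>y y'. \<bar>f y - f y'\<bar> \<le> (1 :: real)"
  shows "\<bar>f (x + (aa t \<omega> + pert \<tau> s t \<omega>)) - f x\<bar> \<le> zz t \<omega> + L * \<theta> * q * cc t \<omega>"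
proof (cases rule: zz_cases[of t \<omega>])
  case 1
  have "\<bar>f (x + (aa t \<omega> + pert \<tau> s t \<omega>)) - f x\<bar> \<le> L * \<bar>pert \<tau> s t \<omega>\<bar>"
    using lip[of "pert \<tau> s t \<omega>"] no_outlier(1)[OF 1(2)] by simp
  also have "\<dots> \<le> L * (\<theta> * q * (cc t \<omega> + ee t \<omega>))"
    by (rule mult_left_mono[OF pert_bound[of \<tau> s t \<omega>, OF \<tau> s] L_nonneg])
  finally show ?thesis using no_outlier(2)[OF 1(2)] 1(1) by (simp add: mult.assoc)
next
  case 2
  have "0 \<le> L * \<theta> * q * cc t \<omega>" using L_nonneg \<Theta>_nonneg q_pos cc_ge_1[of t \<omega>] by simp
  then show ?thesis using 2 one[of "x + (aa t \<omega> + pert \<tau> s t \<omega>)" x] by linarith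
qed

lemma mixture_increment_bound:
  assumes \<tau>: "\<And>j. j \<le> p \<Longrightarrow> \<bar>\<tau> j\<bar> \<le> \<Theta>" and s: "\<bar>s\<bar> \<le> 1"
  shows "\<bar>F (x + (aa t \<omega> + pert \<tau> s t \<omega>)) - F x\<bar> \<le> zz t \<omega> + L * \<theta> * q * cc t \<omega>"
proof (rule lipschitz_increment_bound[OF \<tau> s])
  have conv: "\<bar>F y - F y'\<bar> \<le> B" if "\<bar>G0 y - G0 y'\<bar> \<le> B" "\<bar>H y - H y'\<bar> \<le> B" for y y' B
  proof -
    let ?r = "local_rate \<rho> n"
    have "F y - F y' = (1 - ?r) * (G0 y - G0 y') + ?r * (H y - H y')"
      by (simp add: mixture_cdf_def algebra_simps)
    also have "\<bar>\<dots>\<bar> \<le> (1 - ?r) * \<bar>G0 y - G0 y'\<bar> + ?r * \<bar>H y - H y'\<bar>"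
      using \<rho>_rate by (intro order_trans[OF abs_triangle_ineq]) (simp add: abs_mult)
    also have "\<dots> \<le> (1 - ?r) * B + ?r * B"
      using \<rho>_rate that by (intro add_mono mult_left_mono) auto
    finally show ?thesis by (simp add: algebra_simps)
  qed
  show "\<bar>F (x + w) - F x\<bar> \<le> L * \<bar>w\<bar>" for w by (rule conv[OF G0_lip H_lip])
  show "\<bar>F y - F y'\<bar> \<le> 1" for y y' by (rule conv[OF increment_le_1])
qed

text \<open>Four sources: the Taylor remainder at clean times; the interaction of process and
  outliers, counted twice because the subtracted linear term costs as much as the Lipschitz bound;
  the product of \<tau> with lagged outliers, truncated at 1; and the deviation of the mixture from
  G_0.\<close>

definition err where
  "err t \<omega> = K * (\<theta> * q * cc t \<omega>)\<^sup>2 + 2 * (L * \<theta> * q) * (cc t \<omega> * zz t \<omega>)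
     + (\<Sum>j=1..p. Z (t - int j) \<omega> * min 1 (L * \<theta> * q * \<bar>Xi (t - int j) \<omega>\<bar>))
     + 2 * (R * q) * (zz t \<omega> + L * \<theta> * q * cc t \<omega>)"

text \<open>At clean times this is Taylor's formula, and the linear effect of the slack gives the
  last term. At contaminated times the jump \<open>aa\<close> stays inside G_0 and only the small
  perturbation is removed; truncation keeps huge outliers harmless.\<close>

lemma G0_increment_expansion:
  assumes \<tau>: "\<And>j. j \<le> p \<Longrightarrow> \<bar>\<tau> j\<bar> \<le> \<Theta>" and s: "\<bar>s\<bar> \<le> 1"
  shows "\<bar>G0 (x + (aa t \<omega> + pert \<tau> s t \<omega>)) - G0 (x + aa t \<omega>) - gx * (q * lin \<tau> t \<omega>)\<bar>
    \<le> K * (\<theta> * q * cc t \<omega>)\<^sup>2 + 2 * (L * \<theta> * q) * (cc t \<omega> * zz t \<omega>)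
       + (\<Sum>j=1..p. Z (t - int j) \<omega> * min 1 (L * \<theta> * q * \<bar>Xi (t - int j) \<omega>\<bar>))
       + L * \<bar>s\<bar> * q * cc t \<omega>" (is "?lhs \<le> ?A + ?B + ?C + ?E")
proof (cases rule: zz_cases[of t \<omega>])
  case 1
  let ?w = "pert \<tau> s t \<omega>"
  have aa: "aa t \<omega> = 0" and w: "?w = q * lin \<tau> t \<omega> + s * (q * cc t \<omega>)"
    using no_outlier[OF 1(2)] by auto
  have "\<bar>?w\<bar> \<le> \<theta> * q * cc t \<omega>"
    using pert_bound[of \<tau> s t \<omega>, OF \<tau> s] no_outlier(2)[OF 1(2)] by simp
  then have "?w\<^sup>2 \<le> (\<theta> * q * cc t \<omega>)\<^sup>2"
    using power_mono[OF _ abs_ge_zero, of ?w _ 2] by simp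
  then have w1: "\<bar>G0 (x + ?w) - G0 x - gx * ?w\<bar> \<le> ?A"
    using order_trans[OF G0_taylor mult_left_mono[OF _ K_nonneg]] by blast
  have w2: "\<bar>gx * (s * (q * cc t \<omega>))\<bar> \<le> ?E"
  proof -
    have "\<bar>gx * (s * (q * cc t \<omega>))\<bar> = \<bar>gx\<bar> * (\<bar>s\<bar> * (q * cc t \<omega>))"
      using q_pos cc_ge_1[of t \<omega>] by (simp add: abs_mult)
    also have "\<dots> \<le> L * (\<bar>s\<bar> * (q * cc t \<omega>))"
      using gx_bound q_pos cc_ge_1[of t \<omega>] by (intro mult_right_mono) auto
    finally show ?thesis by (simp add: mult.assoc)
  qed
  have lhs: "?lhs = \<bar>(G0 (x + ?w) - G0 x - gx * ?w) + gx * (s * (q * cc t \<omega>))\<bar>"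
  proof -
    have "gx * ?w = gx * (q * lin \<tau> t \<omega>) + gx * (s * (q * cc t \<omega>))"
      by (simp only: w distrib_left)
    then show ?thesis unfolding aa by simp
  qed
  have C: "0 \<le> ?C"
    using L_nonneg \<Theta>_nonneg q_pos by (intro sum_nonneg mult_nonneg_nonneg Z_nonneg) auto
  have B: "?B = 0" using 1(1) by simp
  have "\<bar>(G0 (x + ?w) - G0 x - gx * ?w) + gx * (s * (q * cc t \<omega>))\<bar> \<le> ?A + ?E"
    by (rule order_trans[OF abs_triangle_ineq add_mono[OF w1 w2]])
  then have "?lhs \<le> ?A + ?E" unfolding lhs .
  moreover have "a \<le> A + B + C + E" if "a \<le> A + E" "B = 0" "0 \<le> C" for a A B C E :: real
    using that by linarith
  ultimately show ?thesis using B C by blast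
next
  case 2
  let ?w = "pert \<tau> s t \<omega>" and ?l = "L * \<theta> * q"
  have l: "0 \<le> ?l" using L_nonneg \<Theta>_nonneg q_pos by simp
  have "\<bar>G0 (x + aa t \<omega> + ?w) - G0 (x + aa t \<omega>)\<bar> \<le> min 1 (L * \<bar>?w\<bar>)"
    using G0_lip[of "x + aa t \<omega>" ?w] increment_le_1(1) by simp
  also have "\<dots> \<le> min 1 (?l * cc t \<omega> + ?l * ee t \<omega>)"
    using mult_left_mono[OF pert_bound[of \<tau> s t \<omega>, OF \<tau> s] L_nonneg] by (simp add: algebra_simps)
  \<comment> \<open>Only the outlier part has to stay truncated; the process part is
    integrable.\<close>
  also have "\<dots> \<le> ?l * cc t \<omega> + min 1 (?l * ee t \<omega>)"
    using mult_nonneg_nonneg[OF l, of "cc t \<omega>"] cc_ge_1[of t \<omega>] by (simp add: min_def)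
  also have "min 1 (?l * ee t \<omega>) \<le> ?C"
  proof -
    have "min 1 (?l * ee t \<omega>) = min 1 \<bar>\<Sum>j=1..p. ?l * (Z (t - int j) \<omega> * \<bar>Xi (t - int j) \<omega>\<bar>)\<bar>"
      using mult_nonneg_nonneg[OF l ee_nonneg[of t \<omega>]] unfolding ee_def
      by (simp only: sum_distrib_left abs_of_nonneg)
    also have "\<dots> \<le> (\<Sum>j=1..p. min 1 \<bar>?l * (Z (t - int j) \<omega> * \<bar>Xi (t - int j) \<omega>\<bar>)\<bar>)"
      by (rule min_one_abs_sum_le) simp
    also have "\<dots> = ?C"
    proof (rule sum.cong[OF refl])
      fix j
      show "min 1 \<bar>?l * (Z (t - int j) \<omega> * \<bar>Xi (t - int j) \<omega>\<bar>)\<bar> = Z (t - int j) \<omega> * min 1 (?l * \<bar>Xi (t - int j) \<omega>\<bar>)"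
        using Z_cases[of "t - int j" \<omega>]
      proof
        assume "Z (t - int j) \<omega> = 1"
        then show ?thesis by (simp only: mult_1 abs_of_nonneg[OF mult_nonneg_nonneg[OF l abs_ge_zero]])
      qed simp
    qed
    finally show ?thesis .
  qed
  finally have 3: "\<bar>G0 (x + aa t \<omega> + ?w) - G0 (x + aa t \<omega>)\<bar> \<le> ?l * cc t \<omega> + ?C" by simp
  have 4: "\<bar>gx * (q * lin \<tau> t \<omega>)\<bar> \<le> ?l * cc t \<omega>"
  proof -
    have "\<bar>gx * (q * lin \<tau> t \<omega>)\<bar> = \<bar>gx\<bar> * (q * \<bar>lin \<tau> t \<omega>\<bar>)" using q_pos by (simp add: abs_mult)
    also have "\<dots> \<le> L * (q * (\<Theta> * cc t \<omega>))"
      using q_pos gx_bound lin_bound[of \<tau> t \<omega>, OF \<tau>] L_nonneg by (intro mult_mono) auto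
    also have "\<dots> \<le> L * (q * (\<theta> * cc t \<omega>))"
      using q_pos L_nonneg cc_ge_1[of t \<omega>] by (intro mult_left_mono mult_right_mono) auto
    finally show ?thesis by (simp add: algebra_simps)
  qed
  have "?l * cc t \<omega> \<le> ?l * (cc t \<omega> * zz t \<omega>)"
    using mult_left_mono[OF 2, of "cc t \<omega>"] cc_ge_1[of t \<omega>] l by (intro mult_left_mono) auto
  moreover have "0 \<le> ?A" using K_nonneg by simp
  moreover have "0 \<le> ?E" using L_nonneg q_pos cc_ge_1[of t \<omega>] by simp
  moreover have "?lhs \<le> \<bar>G0 (x + aa t \<omega> + ?w) - G0 (x + aa t \<omega>)\<bar> + \<bar>gx * (q * lin \<tau> t \<omega>)\<bar>"
    unfolding add.assoc[symmetric] by (rule abs_triangle_ineq4)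
  ultimately show ?thesis using 3 4 by linarith
qed

text \<open>F differs from G_0 by the mixture weight, at most R q, times H - G_0. That weight
  multiplies increments which are themselves small in mean.\<close>

lemma mixture_increment_expansion:
  assumes \<tau>: "\<And>j. j \<le> p \<Longrightarrow> \<bar>\<tau> j\<bar> \<le> \<Theta>" and s: "\<bar>s\<bar> \<le> 1"
  shows "\<bar>F (x + (aa t \<omega> + pert \<tau> s t \<omega>)) - F x - (G0 (x + aa t \<omega>) - G0 x) - gx * (q * lin \<tau> t \<omega>)\<bar>
    \<le> err t \<omega> + L * \<bar>s\<bar> * q * cc t \<omega>"
proof -
  let ?y = "x + (aa t \<omega> + pert \<tau> s t \<omega>)" and ?r = "local_rate \<rho> n" and ?b = "zz t \<omega> + L * \<theta> * q * cc t \<omega>"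
  have b: "\<bar>G0 ?y - G0 x\<bar> \<le> ?b" "\<bar>H ?y - H x\<bar> \<le> ?b"
    using lipschitz_increment_bound[of \<tau> s G0 t \<omega>, OF \<tau> s G0_lip increment_le_1(1)]
      lipschitz_increment_bound[of \<tau> s H t \<omega>, OF \<tau> s H_lip increment_le_1(2)] by blast+
  have "\<bar>(H ?y - H x) - (G0 ?y - G0 x)\<bar> \<le> 2 * ?b"
    unfolding mult_2 by (rule order_trans[OF abs_triangle_ineq4 add_mono[OF b(2,1)]])
  then have r: "\<bar>?r * ((H ?y - H x) - (G0 ?y - G0 x))\<bar> \<le> (R * q) * (2 * ?b)"
    using \<rho>_rate R_nonneg q_pos unfolding abs_mult by (intro mult_mono) auto
  have eq: "F ?y - F x - (G0 (x + aa t \<omega>) - G0 x) - gx * (q * lin \<tau> t \<omega>)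
      = (G0 ?y - G0 (x + aa t \<omega>) - gx * (q * lin \<tau> t \<omega>)) + ?r * ((H ?y - H x) - (G0 ?y - G0 x))"
    unfolding F_eq by (simp add: algebra_simps)
  have "\<bar>F ?y - F x - (G0 (x + aa t \<omega>) - G0 x) - gx * (q * lin \<tau> t \<omega>)\<bar>
     \<le> (K * (\<theta> * q * cc t \<omega>)\<^sup>2 + 2 * (L * \<theta> * q) * (cc t \<omega> * zz t \<omega>)
       + (\<Sum>j=1..p. Z (t - int j) \<omega> * min 1 (L * \<theta> * q * \<bar>Xi (t - int j) \<omega>\<bar>))
       + L * \<bar>s\<bar> * q * cc t \<omega>) + (R * q) * (2 * ?b)"
    unfolding eq
    by (rule order_trans[OF abs_triangle_ineq add_mono[OF G0_increment_expansion[of \<tau> s t \<omega>, OF \<tau> s] r]])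
  also have "\<dots> = err t \<omega> + L * \<bar>s\<bar> * q * cc t \<omega>"
    unfolding err_def by (simp only: ac_simps)
  finally show ?thesis .
qed

section \<open>The martingale part\<close>

definition I where "I = (UNIV <+> J <+> J :: (int + int + int) set)"

text \<open>Innovations strictly before t, together with the outlier indicators and sizes of all
  observation times, later ones included: the outliers are independent of the innovations, so they
  may be frozen throughout.\<close>

definition past where "past t = ({..<t} <+> J <+> J :: (int + int + int) set)"

abbreviation "Fil \<equiv> coord_algebra M X"

lemma X_indep_I: "indep_vars (\<lambda>_. borel) X I"
  using X_indep by (simp add: I_def J_def)

lemma coord_measurable_M:
  assumes "A \<subseteq> I" "f \<in> measurable (Fil A) N"
  shows "f \<in> measurable M N"
  by (rule measurable_coord_algebra_mono[OF assms(2)])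
    (use assms(1) X_indep_I in \<open>auto simp: indep_vars_def\<close>)

lemma coord_\<epsilon>: "Inl t \<in> A \<Longrightarrow> \<epsilon> t \<in> borel_measurable (Fil A)"
  using measurable_coord[of "Inl t" A X M] by simp

lemma coord_U: "(\<And>s. s \<le> t \<Longrightarrow> Inl s \<in> A) \<Longrightarrow> U t \<in> borel_measurable (Fil A)"
  unfolding U_def[abs_def]
  by (intro borel_measurable_suminf borel_measurable_times borel_measurable_const coord_\<epsilon>) simp

lemma coord_Z:
  assumes "t \<in> J \<Longrightarrow> Inr (Inl t) \<in> A"
  shows "Z t \<in> borel_measurable (Fil A)"
proof (cases "t \<in> J")
  case True
  then have [measurable]: "z t \<in> borel_measurable (Fil A)"
    using measurable_coord[of "Inr (Inl t)" A X M] assms by simp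
  have "Z t = (\<lambda>\<omega>. if z t \<omega> = 1 then 1 else 0)" using True by (auto simp: Z_def)
  then show ?thesis by simp
next
  case False
  then have "Z t = (\<lambda>\<omega>. 0)" by (auto simp: Z_def)
  then show ?thesis by simp
qed

lemma coord_Xi:
  assumes "t \<in> J \<Longrightarrow> Inr (Inr t) \<in> A"
  shows "Xi t \<in> borel_measurable (Fil A)"
proof (cases "t \<in> J")
  case True
  then have "Xi t = \<xi> t" by (auto simp: Xi_def)
  then show ?thesis using measurable_coord[of "Inr (Inr t)" A X M] assms True by simp
next
  case False
  then have "Xi t = (\<lambda>\<omega>. 0)" by (auto simp: Xi_def)
  then show ?thesis by simp
qed

lemma Z_measurable [measurable]: "Z t \<in> borel_measurable M"
  by (rule coord_measurable_M[OF subset_refl coord_Z]) (auto simp: I_def)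

lemma Xi_measurable [measurable]: "Xi t \<in> borel_measurable M"
  by (rule coord_measurable_M[OF subset_refl coord_Xi]) (auto simp: I_def)

lemma zz_measurable [measurable]: "zz t \<in> borel_measurable M"
  unfolding zz_def[abs_def] by measurable

lemma cc_measurable [measurable]: "cc t \<in> borel_measurable M"
  unfolding cc_def[abs_def] by measurable

lemma aa_measurable [measurable]: "aa t \<in> borel_measurable M"
  unfolding aa_def[abs_def] by measurable

lemma past_subset: "past t \<subseteq> I"
  unfolding past_def I_def by auto

text \<open>The process enters only at lags j \<ge> 1, and \<open>U (t - int j)\<close> is built
  from innovations up to t - j; so the threshold at time t does not involve
  \<open>\<epsilon> t\<close>.\<close>

lemma shift_coord: 
  assumes "t \<le> t'"
  shows "(\<lambda>\<omega>. aa t \<omega> + pert \<tau> s t \<omega>) \<in> borel_measurable (Fil (past t'))"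
proof -
  have Z: "Z r \<in> borel_measurable (Fil (past t'))" and Xi: "Xi r \<in> borel_measurable (Fil (past t'))" for r
    by (auto intro!: coord_Z coord_Xi simp: past_def)
  have U: "U (t - int j) \<in> borel_measurable (Fil (past t'))" if "j \<in> {1..p}" for j
    using that assms by (intro coord_U) (auto simp: past_def)
  show ?thesis unfolding pert_def aa_def lin_def cc_def ee_def
    by (intro borel_measurable_add borel_measurable_times borel_measurable_const borel_measurable_sum
        borel_measurable_abs Z Xi U)
qed

lemma shift_measurable [measurable]: "(\<lambda>\<omega>. aa t \<omega> + pert \<tau> s t \<omega>) \<in> borel_measurable M"
  by (rule coord_measurable_M[OF past_subset shift_coord[OF order_refl]])

lemma D_coord:
  assumes "t < t'"
  shows "D \<tau> s t \<in> borel_measurable (Fil (past t'))"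
proof -
  have \<epsilon>: "\<epsilon> t \<in> borel_measurable (Fil (past t'))"
    using assms by (intro coord_\<epsilon>) (auto simp: past_def)
  have w: "(\<lambda>\<omega>. aa t \<omega> + pert \<tau> s t \<omega>) \<in> borel_measurable (Fil (past t'))"
    using assms by (intro shift_coord) simp
  have "(\<lambda>y. of_bool (fst y \<le> x + snd y) - of_bool (fst y \<le> x) - (F (x + snd y) - F x) :: real)
      \<in> borel_measurable (borel \<Otimes>\<^sub>M borel)"
    by (intro borel_measurable_diff borel_measurable_of_bool) measurable
  from measurable_compose[OF measurable_Pair[OF \<epsilon> w] this]
  show ?thesis by (simp add: D_def[abs_def])
qed

lemma D_measurable [measurable]: "D \<tau> s t \<in> borel_measurable M"
  by (rule coord_measurable_M[OF past_subset D_coord[of t "t + 1"]]) simp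

lemma F_increment_le_1: "\<bar>F y - F y'\<bar> \<le> 1"
proof -
  have "0 \<le> F y \<and> F y \<le> 1" for y
  proof -
    have "F y \<le> (1 - local_rate \<rho> n) * 1 + local_rate \<rho> n * 1"
      unfolding mixture_cdf_def using \<rho>_rate G0_range H_range by (intro add_mono mult_left_mono) auto
    then show ?thesis unfolding mixture_cdf_def using \<rho>_rate G0_range H_range by simp
  qed
  then show ?thesis by (smt (verit))
qed

lemma D_bound: "\<bar>D \<tau> s t \<omega>\<bar> \<le> 2"
proof -
  have "\<bar>of_bool A - of_bool B - y\<bar> \<le> 2" if "\<bar>y\<bar> \<le> 1" for A B and y :: real
    using that by (auto simp: of_bool_def)
  then show ?thesis unfolding D_def using F_increment_le_1 by blast
qed

lemma \<epsilon>_distr: "real_distribution (distr M borel (\<epsilon> t))" "cdf (distr M borel (\<epsilon> t)) = F"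
  by (simp_all add: real_distribution_distr innovation_cdf)

text \<open>Given the past (and all outliers), the innovation \<open>\<epsilon> t\<close> has distribution function \<open>F\<close>,
  so the summands \<open>D \<tau> s t\<close> are martingale differences.\<close>

lemma D_orthogonal_less:
  assumes "t1 < t2"
  shows "expectation (\<lambda>\<omega>. D \<tau> s t1 \<omega> * D \<tau> s t2 \<omega>) = 0"
proof -
  let ?f = "\<lambda>y. fst (fst y) * (of_bool (snd y \<le> x + snd (fst y)) - of_bool (snd y \<le> x)
     - (F (x + snd (fst y)) - F x)) :: real"
  have Y: "(\<lambda>\<omega>. (D \<tau> s t1 \<omega>, aa t2 \<omega> + pert \<tau> s t2 \<omega>)) \<in> measurable (Fil (past t2)) (borel \<Otimes>\<^sub>M borel)"
    by (intro measurable_Pair D_coord[OF assms] shift_coord order_refl)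
  have E: "\<epsilon> t2 \<in> borel_measurable (Fil {Inl t2})" by (rule coord_\<epsilon>) simp
  have int: "integrable M (\<lambda>\<omega>. D \<tau> s t1 \<omega> * D \<tau> s t2 \<omega>)"
  proof (rule integrable_const_bound[of _ 4])
    show "AE \<omega> in M. norm (D \<tau> s t1 \<omega> * D \<tau> s t2 \<omega>) \<le> 4"
      using mult_mono[OF D_bound[of \<tau> s t1] D_bound[of \<tau> s t2]] by (simp add: abs_mult)
  qed measurable
  have "expectation (\<lambda>\<omega>. D \<tau> s t1 \<omega> * D \<tau> s t2 \<omega>)
     = expectation (\<lambda>\<omega>. ?f ((D \<tau> s t1 \<omega>, aa t2 \<omega> + pert \<tau> s t2 \<omega>), \<epsilon> t2 \<omega>))"
    by (simp add: D_def[of _ _ t2])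
  also have "\<dots> = expectation (\<lambda>\<omega>. LINT e|distr M borel (\<epsilon> t2). ?f ((D \<tau> s t1 \<omega>, aa t2 \<omega> + pert \<tau> s t2 \<omega>), e))"
  proof (rule expectation_iterated_coord_algebra[OF X_indep_I past_subset _ _ Y E])
    show "{Inl t2} \<subseteq> I" by (auto simp: I_def)
    show "past t2 \<inter> {Inl t2} = {}" by (auto simp: past_def)
    show "?f \<in> borel_measurable ((borel \<Otimes>\<^sub>M borel) \<Otimes>\<^sub>M borel)"
      by (intro borel_measurable_times borel_measurable_diff borel_measurable_of_bool) measurable
    show "integrable M (\<lambda>\<omega>. ?f ((D \<tau> s t1 \<omega>, aa t2 \<omega> + pert \<tau> s t2 \<omega>), \<epsilon> t2 \<omega>))"
      using int by (simp add: D_def[of _ _ t2])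
  qed
  \<comment> \<open>For fixed earlier values the inner integral is that of a centred step
    difference, which is 0.\<close>
  also have "\<dots> = expectation (\<lambda>\<omega>. 0)"
    using step_variance_le(1)[OF \<epsilon>_distr(1)[of t2]] unfolding \<epsilon>_distr(2) by simp
  finally show ?thesis by simp
qed

lemma D_orthogonal: "t1 \<noteq> t2 \<Longrightarrow> expectation (\<lambda>\<omega>. D \<tau> s t1 \<omega> * D \<tau> s t2 \<omega>) = 0"
  using D_orthogonal_less[of t1 t2 \<tau> s] D_orthogonal_less[of t2 t1 \<tau> s]
  by (cases "t1 < t2") (simp_all add: mult.commute)

section \<open>Moment bounds for the process, the indicators and the martingale differences\<close>

definition C1 where "C1 = 1 + CU"

definition C2 where "C2 = real (p + 1) * (1 + real p * CU)"

lemma CU_nonneg: "0 \<le> CU" unfolding CU_def using V_nonneg by simp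

lemma U_abs: "integrable M (\<lambda>\<omega>. \<bar>U t \<omega>\<bar>)" "expectation (\<lambda>\<omega>. \<bar>U t \<omega>\<bar>) \<le> C1"
proof -
  show int: "integrable M (\<lambda>\<omega>. \<bar>U t \<omega>\<bar>)"
    using square_integrable_imp_integrable[OF U_measurable U_sq] by simp
  have "expectation (\<lambda>\<omega>. \<bar>U t \<omega>\<bar>) \<le> expectation (\<lambda>\<omega>. 1 + (U t \<omega>)\<^sup>2)"
  proof (rule integral_mono[OF int])
    show "\<bar>U t \<omega>\<bar> \<le> 1 + (U t \<omega>)\<^sup>2" for \<omega>
      using sum_squares_bound[of 1 "\<bar>U t \<omega>\<bar>"] by simp
  qed (use U_sq in simp)
  also have "\<dots> \<le> C1" using U_sq[of t] U_var[of t] by (simp add: C1_def prob_space)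
  finally show "expectation (\<lambda>\<omega>. \<bar>U t \<omega>\<bar>) \<le> C1" .
qed

lemma cc_sq: "integrable M (\<lambda>\<omega>. (cc t \<omega>)\<^sup>2)" "expectation (\<lambda>\<omega>. (cc t \<omega>)\<^sup>2) \<le> C2"
proof -
  let ?g = "\<lambda>\<omega>. real (p + 1) * (1 + (\<Sum>j=1..p. (U (t - int j) \<omega>)\<^sup>2))"
  have le: "(cc t \<omega>)\<^sup>2 \<le> ?g \<omega>" for \<omega>
  proof -
    \<comment> \<open>Writing \<open>cc\<close> as a sum of p + 1 terms lets the Cauchy-Schwarz
      inequality produce the factor p + 1 of \<open>C2\<close>.\<close>
    have "(\<Sum>j=0..p. if j = 0 then 1 else \<bar>U (t - int j) \<omega>\<bar>) = cc t \<omega>"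
      by (subst sum.atLeast_Suc_atMost) (auto simp: cc_def)
    from this[symmetric] have "(cc t \<omega>)\<^sup>2 \<le> (\<Sum>j=0..p. (if j = 0 then 1 else \<bar>U (t - int j) \<omega>\<bar>)\<^sup>2) * real (card {0..p})"
      by (simp only: sum_squared_le_sum_of_squares)
    also have "(\<Sum>j=0..p. (if j = 0 then 1 else \<bar>U (t - int j) \<omega>\<bar>)\<^sup>2) = 1 + (\<Sum>j=1..p. (U (t - int j) \<omega>)\<^sup>2)"
      by (subst sum.atLeast_Suc_atMost) auto
    finally show ?thesis by (simp add: mult.commute)
  qed
  have int: "integrable M ?g" using U_sq by simp
  show "integrable M (\<lambda>\<omega>. (cc t \<omega>)\<^sup>2)"
  proof (rule Bochner_Integration.integrable_bound[OF int])
    have "norm ((cc t \<omega>)\<^sup>2) \<le> norm (?g \<omega>)" for \<omega>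
      using le[of \<omega>] order_trans[OF zero_le_power2 le[of \<omega>]]
      by (simp only: real_norm_def abs_of_nonneg zero_le_power2)
    then show "AE \<omega> in M. norm ((cc t \<omega>)\<^sup>2) \<le> norm (?g \<omega>)" by (rule AE_I2)
  qed measurable
  then have "expectation (\<lambda>\<omega>. (cc t \<omega>)\<^sup>2) \<le> expectation ?g"
    using le by (intro integral_mono int) auto
  also have "\<dots> = real (p + 1) * (1 + (\<Sum>j=1..p. expectation (\<lambda>\<omega>. (U (t - int j) \<omega>)\<^sup>2)))"
    using U_sq by (simp add: prob_space)
  also have "\<dots> \<le> real (p + 1) * (1 + (\<Sum>j=1..p. CU))"
    using U_var by (intro mult_left_mono add_left_mono sum_mono) auto
  finally show "expectation (\<lambda>\<omega>. (cc t \<omega>)\<^sup>2) \<le> C2" by (simp add: C2_def)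
qed

lemma cc_int: "integrable M (cc t)" "expectation (cc t) \<le> C2"
proof -
  show int: "integrable M (cc t)"
    using square_integrable_imp_integrable[OF cc_measurable cc_sq(1)] .
  have "expectation (cc t) \<le> expectation (\<lambda>\<omega>. (cc t \<omega>)\<^sup>2)"
    using self_le_power[OF cc_ge_1, of 2] by (intro integral_mono int cc_sq) auto
  then show "expectation (cc t) \<le> C2" using cc_sq(2) by (rule order_trans)
qed

lemma Z_int: "integrable M (Z t)" "expectation (Z t) \<le> \<gamma> * q" "t \<in> J \<Longrightarrow> expectation (Z t) = \<gamma> * q"
proof -
  show "integrable M (Z t)"
    by (rule integrable_const_bound[of _ 1]) (simp_all add: Z_le_1 abs_of_nonneg Z_nonneg)
  show eq: "expectation (Z t) = \<gamma> * q" if "t \<in> J" for t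
  proof -
    have [measurable]: "z t \<in> borel_measurable M"
      using coord_measurable_M[OF subset_refl measurable_coord[of "Inr (Inl t)" I X M]] that
      by (auto simp: I_def)
    have "expectation (Z t) = expectation (indicator {\<omega> \<in> space M. z t \<omega> = 1})"
      by (rule Bochner_Integration.integral_cong) (use that in \<open>auto simp: Z_def indicator_def\<close>)
    also have "\<dots> = prob {\<omega> \<in> space M. z t \<omega> = 1}" by simp
    also have "\<dots> = \<gamma> * q" using indicator_one[of t] that by (simp add: J_def \<gamma>_rate)
    finally show ?thesis .
  qed
  show "expectation (Z t) \<le> \<gamma> * q"
  proof (cases "t \<in> J")
    case False
    then have "Z t = (\<lambda>\<omega>. 0)" by (auto simp: Z_def)
    then show ?thesis using \<gamma>_rate_le by simp
  qed (simp add: eq)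
qed

lemma zz_int: "integrable M (zz t)" "expectation (zz t) \<le> real (p + 1) * (\<Gamma> * q)"
proof -
  show "integrable M (zz t)" unfolding zz_def[abs_def] using Z_int(1) by simp
  have "expectation (zz t) = (\<Sum>j=0..p. expectation (Z (t - int j)))"
    unfolding zz_def[abs_def] using Z_int(1) by simp
  also have "\<dots> \<le> (\<Sum>j=0..p. \<Gamma> * q)"
    using order_trans[OF Z_int(2) \<gamma>_rate_le(1)] by (intro sum_mono)
  finally show "expectation (zz t) \<le> real (p + 1) * (\<Gamma> * q)" by simp
qed

definition CM where "CM = real (p + 1) * \<Gamma> + L * \<theta> * C2"

text \<open>Freezing the threshold bounds the conditional variance by the increment of F. Its mean
  is of order q, because an outlier has probability at most \<Gamma> q and the remaining shift is of
  order q.\<close>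

lemma D_sq:
  assumes \<tau>: "\<And>j. j \<le> p \<Longrightarrow> \<bar>\<tau> j\<bar> \<le> \<Theta>" and s: "\<bar>s\<bar> \<le> 1"
  shows "integrable M (\<lambda>\<omega>. (D \<tau> s t \<omega>)\<^sup>2)" and "expectation (\<lambda>\<omega>. (D \<tau> s t \<omega>)\<^sup>2) \<le> q * CM"
proof -
  let ?f = "\<lambda>y. (of_bool (snd y \<le> x + fst y) - of_bool (snd y \<le> x) - (F (x + fst y) - F x))\<^sup>2 :: real"
  show int: "integrable M (\<lambda>\<omega>. (D \<tau> s t \<omega>)\<^sup>2)"
  proof (rule integrable_const_bound[of _ 4])
    show "AE \<omega> in M. norm ((D \<tau> s t \<omega>)\<^sup>2) \<le> 4"
      using power_mono[OF D_bound abs_ge_zero, of \<tau> s t _ 2] by simp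
  qed measurable
  have "expectation (\<lambda>\<omega>. (D \<tau> s t \<omega>)\<^sup>2) = expectation (\<lambda>\<omega>. ?f (aa t \<omega> + pert \<tau> s t \<omega>, \<epsilon> t \<omega>))"
    by (simp add: D_def)
  also have "\<dots> = expectation (\<lambda>\<omega>. LINT e|distr M borel (\<epsilon> t). ?f (aa t \<omega> + pert \<tau> s t \<omega>, e))"
  proof (rule expectation_iterated_coord_algebra[OF X_indep_I past_subset _ _ shift_coord[OF order_refl] coord_\<epsilon>])
    show "{Inl t} \<subseteq> I" by (auto simp: I_def)
    show "past t \<inter> {Inl t} = {}" by (auto simp: past_def)
    show "?f \<in> borel_measurable (borel \<Otimes>\<^sub>M borel)"
      by (intro borel_measurable_power borel_measurable_diff borel_measurable_of_bool) measurable
    show "integrable M (\<lambda>\<omega>. ?f (aa t \<omega> + pert \<tau> s t \<omega>, \<epsilon> t \<omega>))" using int by (simp add: D_def)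
  qed simp
  also have "\<dots> \<le> expectation (\<lambda>\<omega>. zz t \<omega> + L * \<theta> * q * cc t \<omega>)"
  proof (rule integral_mono')
    show "integrable M (\<lambda>\<omega>. zz t \<omega> + L * \<theta> * q * cc t \<omega>)" using zz_int cc_int by simp
    fix \<omega>
    have "(LINT e|distr M borel (\<epsilon> t). ?f (aa t \<omega> + pert \<tau> s t \<omega>, e))
        \<le> \<bar>F (x + (aa t \<omega> + pert \<tau> s t \<omega>)) - F x\<bar>"
      using step_variance_le(2)[OF \<epsilon>_distr(1)[of t]] unfolding \<epsilon>_distr(2) by simp
    also have "\<dots> \<le> zz t \<omega> + L * \<theta> * q * cc t \<omega>"
      by (rule mixture_increment_bound[of \<tau> s t \<omega>, OF \<tau> s])
    finally show "(LINT e|distr M borel (\<epsilon> t). ?f (aa t \<omega> + pert \<tau> s t \<omega>, e)) \<le> zz t \<omega> + L * \<theta> * q * cc t \<omega>" .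
    show "0 \<le> zz t \<omega> + L * \<theta> * q * cc t \<omega>"
      using zz_nonneg[of t \<omega>] L_nonneg \<Theta>_nonneg q_pos cc_ge_1[of t \<omega>] by simp
  qed
  also have "\<dots> = expectation (zz t) + L * \<theta> * q * expectation (cc t)"
    using zz_int cc_int by simp
  also have "\<dots> \<le> real (p + 1) * (\<Gamma> * q) + L * \<theta> * q * C2"
    using zz_int(2) cc_int(2) L_nonneg \<Theta>_nonneg q_pos by (intro add_mono mult_left_mono) auto
  also have "\<dots> = q * CM" by (simp only: CM_def distrib_left ac_simps)
  finally show "expectation (\<lambda>\<omega>. (D \<tau> s t \<omega>)\<^sup>2) \<le> q * CM" .
qed

text \<open>n orthogonal terms of variance at most q CM, normalised by q, leave sqrt (q CM) because
  n q^2 = 1.\<close>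

lemma D_sum:
  assumes \<tau>: "\<And>j. j \<le> p \<Longrightarrow> \<bar>\<tau> j\<bar> \<le> \<Theta>" and s: "\<bar>s\<bar> \<le> 1"
  shows "integrable M (\<lambda>\<omega>. \<bar>q * (\<Sum>t\<in>{1..int n}. D \<tau> s t \<omega>)\<bar>)"
    and "expectation (\<lambda>\<omega>. \<bar>q * (\<Sum>t\<in>{1..int n}. D \<tau> s t \<omega>)\<bar>) \<le> sqrt (q * CM)"
proof -
  note b = expectation_abs_sum_uncorrelated[of "{1..int n}" "D \<tau> s" "q * CM", OF _ D_measurable
      D_sq(1)[of \<tau> s, OF \<tau> s] D_orthogonal D_sq(2)[of \<tau> s, OF \<tau> s]]
  show "integrable M (\<lambda>\<omega>. \<bar>q * (\<Sum>t\<in>{1..int n}. D \<tau> s t \<omega>)\<bar>)"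
    using b(1) by (simp add: abs_mult)
  have "expectation (\<lambda>\<omega>. \<bar>q * (\<Sum>t\<in>{1..int n}. D \<tau> s t \<omega>)\<bar>)
      = q * expectation (\<lambda>\<omega>. \<bar>\<Sum>t\<in>{1..int n}. D \<tau> s t \<omega>\<bar>)"
    using q_pos by (simp add: abs_mult)
  also have "\<dots> \<le> q * sqrt (real n * (q * CM))"
    using b(2) q_pos by (intro mult_left_mono) simp_all
  also have "\<dots> = sqrt (q * q * (real n * (q * CM)))"
    using q_pos by (simp add: real_sqrt_mult)
  also have "q * q * (real n * (q * CM)) = q * CM"
    using q_sq by (simp add: mult.assoc[symmetric] mult.commute[of "q * q"])
  finally show "expectation (\<lambda>\<omega>. \<bar>q * (\<Sum>t\<in>{1..int n}. D \<tau> s t \<omega>)\<bar>) \<le> sqrt (q * CM)" .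
qed

section \<open>Expectation of the remainder\<close>

definition \<phi> where "\<phi> a = G0 (x + a) - G0 x"

abbreviation "b \<equiv> \<beta>(0 := -1)"

text \<open>The mean effect of a single outlier at lag j, that is, the j-th summand of the
  shift.\<close>

definition m where "m j = (LINT s|P\<xi>. \<phi> (b j * s))"

lemma \<phi>_measurable [measurable]: "\<phi> \<in> borel_measurable borel"
  unfolding \<phi>_def[abs_def] by measurable

lemma \<phi>_bound: "\<bar>\<phi> a\<bar> \<le> 1" and \<phi>_0: "\<phi> 0 = 0"
  unfolding \<phi>_def using increment_le_1(1) by auto

lemma Xi_law: "t \<in> J \<Longrightarrow> distr M borel (Xi t) = P\<xi>"
proof -
  assume t: "t \<in> J"
  then have "Xi t = \<xi> t" by (auto simp: Xi_def)
  then show ?thesis using outlier_law[of t] t by (simp add: J_def)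
qed

lemma integrable_bounded_law:
  assumes "f \<in> borel_measurable borel" "\<And>s. \<bar>f s\<bar> \<le> (1 :: real)"
  shows "integrable P\<xi> f"
proof -
  interpret \<xi>: real_distribution P\<xi> by (rule \<xi>_law)
  show ?thesis by (rule \<xi>.integrable_const_bound[of _ 1]) (use assms in auto)
qed

lemma m_sum: "outlier_shift p \<beta> G0 P\<xi> x = (\<Sum>j=0..p. m j)"
proof -
  interpret \<xi>: real_distribution P\<xi> by (rule \<xi>_law)
  have "integrable P\<xi> (\<lambda>s. G0 (x + b j * s))" for j
    using G0_range by (intro integrable_bounded_law) (auto simp: abs_le_iff intro: order_trans[of _ 0])
  then have "m j = (LINT s|P\<xi>. G0 (x + b j * s)) - G0 x" for j
    unfolding m_def \<phi>_def using \<xi>.prob_space by simp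
  then show ?thesis unfolding outlier_shift_def by simp
qed

lemma m_bound: "\<bar>m j\<bar> \<le> 1"
proof -
  interpret \<xi>: real_distribution P\<xi> by (rule \<xi>_law)
  have int: "integrable P\<xi> (\<lambda>s. \<phi> (b j * s))"
    by (rule integrable_bounded_law) (auto simp: \<phi>_bound)
  have "\<bar>m j\<bar> \<le> (LINT s|P\<xi>. \<bar>\<phi> (b j * s)\<bar>)"
    unfolding m_def by (rule integral_abs_bound)
  also have "\<dots> \<le> (LINT s|P\<xi>. 1)" using int by (intro integral_mono) (auto simp: \<phi>_bound)
  finally show ?thesis using \<xi>.prob_space by simp
qed

lemma Z_f_Xi:
  assumes f[measurable]: "f \<in> borel_measurable borel" and f1: "\<And>s. \<bar>f s\<bar> \<le> 1"
  shows "integrable M (\<lambda>\<omega>. Z t \<omega> * f (Xi t \<omega>))"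
    and "t \<in> J \<Longrightarrow> expectation (\<lambda>\<omega>. Z t \<omega> * f (Xi t \<omega>)) = \<gamma> * q * (LINT s|P\<xi>. f s)"
proof -
  show int: "integrable M (\<lambda>\<omega>. Z t \<omega> * f (Xi t \<omega>))" for t
  proof (rule integrable_const_bound[of _ 1])
    have "\<bar>Z t \<omega> * f (Xi t \<omega>)\<bar> \<le> 1 * 1" for \<omega>
      unfolding abs_mult by (intro mult_mono f1) (simp_all add: Z_nonneg Z_le_1)
    then show "AE \<omega> in M. norm (Z t \<omega> * f (Xi t \<omega>)) \<le> 1" by simp
  qed measurable
  assume t: "t \<in> J"
  have "expectation (\<lambda>\<omega>. Z t \<omega> * f (Xi t \<omega>)) = expectation (Z t) * expectation (\<lambda>\<omega>. f (Xi t \<omega>))"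
  proof (rule expectation_mult_coord_algebra[OF X_indep_I, of "{Inr (Inl t)}" "{Inr (Inr t)}"])
    show "Z t \<in> borel_measurable (Fil {Inr (Inl t)})" by (rule coord_Z) simp
    have "Xi t \<in> borel_measurable (Fil {Inr (Inr t)})" by (rule coord_Xi) simp
    then show "(\<lambda>\<omega>. f (Xi t \<omega>)) \<in> borel_measurable (Fil {Inr (Inr t)})"
      by (rule measurable_compose[OF _ f])
  qed (use t int in \<open>auto simp: I_def\<close>)
  also have "expectation (\<lambda>\<omega>. f (Xi t \<omega>)) = (LINT s|distr M borel (Xi t). f s)"
    by (subst integral_distr) simp_all
  finally show "expectation (\<lambda>\<omega>. Z t \<omega> * f (Xi t \<omega>)) = \<gamma> * q * (LINT s|P\<xi>. f s)"
    using t by (simp add: Xi_law Z_int(3))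
qed

text \<open>The inequality 2ab \<le> a^2 + b^2 with weight sqrt q balances the mean of
  \<open>Z\<close>, of order q, against the second moment of \<open>cc\<close>, of order 1. The
  resulting order sqrt q is all that \<open>err_bound\<close> requires.\<close>

lemma cc_Z:
  shows "integrable M (\<lambda>\<omega>. cc t \<omega> * Z r \<omega>)"
    and "expectation (\<lambda>\<omega>. cc t \<omega> * Z r \<omega>) \<le> sqrt q * (\<Gamma> + C2)"
proof -
  let ?r = "sqrt q"
  have r: "0 < ?r" "q / ?r = ?r" using q_pos by (simp_all add: real_div_sqrt)
  have le: "cc t \<omega> * Z r \<omega> \<le> Z r \<omega> / ?r + ?r * (cc t \<omega>)\<^sup>2" for \<omega>
  proof -
    have "0 \<le> Z r \<omega> / ?r" using r Z_nonneg[of r \<omega>] by simp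
    moreover have "cc t \<omega> * 1 \<le> 1 / ?r + ?r * (cc t \<omega>)\<^sup>2"
    proof -
      have "2 * (?r * cc t \<omega>) * 1 \<le> (?r * cc t \<omega>)\<^sup>2 + 1\<^sup>2" by (rule sum_squares_bound)
      moreover have "0 \<le> ?r * cc t \<omega>" using r cc_ge_1[of t \<omega>] by simp
      ultimately have "?r * cc t \<omega> \<le> (?r * cc t \<omega>)\<^sup>2 + 1" by simp
      also have "\<dots> = ?r * (1 / ?r + ?r * (cc t \<omega>)\<^sup>2)"
        using r by (simp add: distrib_left power2_eq_square mult.assoc mult.left_commute)
      finally show ?thesis using r by simp
    qed
    ultimately show ?thesis using Z_cases[of r \<omega>] r by auto
  qed
  have int': "integrable M (\<lambda>\<omega>. Z r \<omega> / ?r + ?r * (cc t \<omega>)\<^sup>2)" using Z_int cc_sq by simp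
  show int: "integrable M (\<lambda>\<omega>. cc t \<omega> * Z r \<omega>)"
  proof (rule Bochner_Integration.integrable_bound[OF cc_int(1)[of t]])
    have "\<bar>cc t \<omega> * Z r \<omega>\<bar> \<le> \<bar>cc t \<omega>\<bar> * 1" for \<omega>
      unfolding abs_mult by (intro mult_left_mono) (simp_all add: Z_nonneg Z_le_1)
    then show "AE \<omega> in M. norm (cc t \<omega> * Z r \<omega>) \<le> norm (cc t \<omega>)" by simp
  qed measurable
  have "expectation (\<lambda>\<omega>. cc t \<omega> * Z r \<omega>) \<le> expectation (\<lambda>\<omega>. Z r \<omega> / ?r + ?r * (cc t \<omega>)\<^sup>2)"
    using le by (intro integral_mono int int')
  also have "\<dots> = expectation (Z r) / ?r + ?r * expectation (\<lambda>\<omega>. (cc t \<omega>)\<^sup>2)"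
    using Z_int(1)[of r] cc_sq(1)[of t] by simp
  also have "\<dots> \<le> (\<Gamma> * q) / ?r + ?r * C2"
    using order_trans[OF Z_int(2) \<gamma>_rate_le(1), of r] cc_sq(2)[of t] r
    by (intro add_mono divide_right_mono mult_left_mono) auto
  also have "(\<Gamma> * q) / ?r = \<Gamma> * ?r" using r(2) by (simp only: times_divide_eq_right[symmetric])
  finally show "expectation (\<lambda>\<omega>. cc t \<omega> * Z r \<omega>) \<le> sqrt q * (\<Gamma> + C2)" by (simp add: algebra_simps)
qed

lemma cc_zz:
  shows "integrable M (\<lambda>\<omega>. cc t \<omega> * zz t \<omega>)"
    and "expectation (\<lambda>\<omega>. cc t \<omega> * zz t \<omega>) \<le> real (p + 1) * (sqrt q * (\<Gamma> + C2))"
proof -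
  show "integrable M (\<lambda>\<omega>. cc t \<omega> * zz t \<omega>)"
    unfolding zz_def sum_distrib_left using cc_Z by simp
  have "expectation (\<lambda>\<omega>. cc t \<omega> * zz t \<omega>) = (\<Sum>j=0..p. expectation (\<lambda>\<omega>. cc t \<omega> * Z (t - int j) \<omega>))"
    unfolding zz_def sum_distrib_left using cc_Z by simp
  also have "\<dots> \<le> (\<Sum>j=0..p. sqrt q * (\<Gamma> + C2))" by (intro sum_mono cc_Z)
  finally show "expectation (\<lambda>\<omega>. cc t \<omega> * zz t \<omega>) \<le> real (p + 1) * (sqrt q * (\<Gamma> + C2))" by simp
qed

definition \<kappa> where "\<kappa> = (LINT s|P\<xi>. min 1 (L * \<theta> * q * \<bar>s\<bar>))"

lemma L\<theta>q_nonneg: "0 \<le> L * \<theta> * q" using L_nonneg \<Theta>_nonneg q_pos by simp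

lemma \<kappa>_nonneg: "0 \<le> \<kappa>"
  unfolding \<kappa>_def by (rule Bochner_Integration.integral_nonneg) (simp add: L\<theta>q_nonneg)

lemma lag_in_J: "t \<in> {1..int n} \<Longrightarrow> j \<le> p \<Longrightarrow> t - int j \<in> J"
  by (auto simp: J_def)

text \<open>The sum over t is multiplied by q, and n q = 1 / q. Each term therefore carries one
  factor q to be cancelled and a further vanishing factor: q, sqrt q or
  \<open>\<kappa>\<close>.\<close>

definition err_bound where
  "err_bound = (K * \<theta>\<^sup>2 * C2) * (q * q) + (2 * (L * \<theta>) * (real (p + 1) * (\<Gamma> + C2)) * sqrt q) * q
     + (real p * \<Gamma> * \<kappa>) * q + (2 * R * (real (p + 1) * \<Gamma> + L * \<theta> * C2)) * (q * q)"

lemma err_expectation: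
  assumes t: "t \<in> {1..int n}"
  shows "integrable M (err t)" and "expectation (err t) \<le> err_bound"
proof -
  let ?g = "\<lambda>s. min 1 (L * \<theta> * q * \<bar>s\<bar>)"
  have g: "?g \<in> borel_measurable borel" "\<And>s. \<bar>?g s\<bar> \<le> 1"
    using L\<theta>q_nonneg by (auto simp: abs_le_iff)
  note Zg = Z_f_Xi[OF g]
  have sq: "(\<theta> * q * cc t \<omega>)\<^sup>2 = \<theta>\<^sup>2 * (q * q) * (cc t \<omega>)\<^sup>2" for \<omega>
    by (simp add: power_mult_distrib power2_eq_square)
  show "integrable M (err t)"
    unfolding err_def[abs_def] sq using cc_sq cc_zz Zg(1) zz_int cc_int by simp
  have "expectation (err t) = K * (\<theta>\<^sup>2 * (q * q) * expectation (\<lambda>\<omega>. (cc t \<omega>)\<^sup>2))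
      + 2 * (L * \<theta> * q) * expectation (\<lambda>\<omega>. cc t \<omega> * zz t \<omega>)
      + (\<Sum>j=1..p. expectation (\<lambda>\<omega>. Z (t - int j) \<omega> * ?g (Xi (t - int j) \<omega>)))
      + 2 * (R * q) * (expectation (zz t) + L * \<theta> * q * expectation (cc t))"
    unfolding err_def[abs_def] sq using cc_sq cc_zz Zg(1) zz_int cc_int by simp
  \<comment> \<open>The law of \<open>Z\<close> and \<open>Xi\<close> is known on \<open>J\<close>
    only; starting observations at 1 - p puts all p lags of the times 1 to n into
    \<open>J\<close>.\<close>
  also have "(\<Sum>j=1..p. expectation (\<lambda>\<omega>. Z (t - int j) \<omega> * ?g (Xi (t - int j) \<omega>))) = (\<Sum>j=1..p. \<gamma> * q * \<kappa>)"
    unfolding \<kappa>_def using t lag_in_J by (intro sum.cong refl Zg(2)) auto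
  also have "K * (\<theta>\<^sup>2 * (q * q) * expectation (\<lambda>\<omega>. (cc t \<omega>)\<^sup>2))
      + 2 * (L * \<theta> * q) * expectation (\<lambda>\<omega>. cc t \<omega> * zz t \<omega>) + (\<Sum>j=1..p. \<gamma> * q * \<kappa>)
      + 2 * (R * q) * (expectation (zz t) + L * \<theta> * q * expectation (cc t))
     \<le> K * (\<theta>\<^sup>2 * (q * q) * C2) + 2 * (L * \<theta> * q) * (real (p + 1) * (sqrt q * (\<Gamma> + C2)))
      + (\<Sum>j=1..p. \<Gamma> * q * \<kappa>) + 2 * (R * q) * (real (p + 1) * (\<Gamma> * q) + L * \<theta> * q * C2)"
    using cc_sq(2)[of t] cc_zz(2)[of t] zz_int(2)[of t] cc_int(2)[of t] K_nonneg L\<theta>q_nonneg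
      R_nonneg q_pos \<kappa>_nonneg \<gamma>_rate_le(1)
    by (intro add_mono mult_left_mono sum_mono mult_right_mono) auto
  also have "\<dots> = err_bound"
    unfolding err_bound_def by (simp add: algebra_simps)
  finally show "expectation (err t) \<le> err_bound" .
qed

section \<open>The shift caused by isolated outliers\<close>

text \<open>Counts ordered pairs of distinct outliers in the window of p + 1 times: 0 for at most
  one outlier, and at least 1 otherwise.\<close>

definition pairs where
  "pairs t \<omega> = (\<Sum>i=0..p. \<Sum>j\<in>{0..p} - {i}. Z (t - int i) \<omega> * Z (t - int j) \<omega>)"

lemma pairs_nonneg: "0 \<le> pairs t \<omega>"
  unfolding pairs_def by (intro sum_nonneg mult_nonneg_nonneg Z_nonneg)

text \<open>With at most one outlier both sides agree exactly, since \<phi> vanishes at 0. With two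
  or more, the left side is at most 1 + (p + 1), which is the origin of the factor p + 2.\<close>

lemma single_outlier_expansion:
  "\<bar>\<phi> (aa t \<omega>) - (\<Sum>j=0..p. Z (t - int j) \<omega> * \<phi> (b j * Xi (t - int j) \<omega>))\<bar> \<le> real (p + 2) * pairs t \<omega>"
  (is "\<bar>?l - ?r\<bar> \<le> _")
proof (cases "\<exists>i\<in>{0..p}. Z (t - int i) \<omega> = 1")
  case False
  then have 0: "Z (t - int j) \<omega> = 0" if "j \<le> p" for j using Z_cases that by fastforce
  then have "?r = 0" by (intro sum.neutral) auto
  moreover have "?l = 0" using no_outlier(1)[OF 0] \<phi>_0 by simp
  ultimately show ?thesis using pairs_nonneg[of t \<omega>] by simp
next
  case True
  then obtain i where i: "i \<in> {0..p}" "Z (t - int i) \<omega> = 1" by blast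
  show ?thesis
  proof (cases "\<exists>k\<in>{0..p} - {i}. Z (t - int k) \<omega> = 1")
    case True
    then obtain k where k: "k \<in> {0..p} - {i}" "Z (t - int k) \<omega> = 1" by blast
    have "Z (t - int i) \<omega> * Z (t - int k) \<omega> \<le> (\<Sum>j\<in>{0..p} - {i}. Z (t - int i) \<omega> * Z (t - int j) \<omega>)"
      by (rule member_le_sum[OF k(1)]) (simp_all add: Z_nonneg)
    also have "\<dots> \<le> pairs t \<omega>"
      unfolding pairs_def
      by (rule member_le_sum[OF i(1), of "\<lambda>i. \<Sum>j\<in>{0..p} - {i}. Z (t - int i) \<omega> * Z (t - int j) \<omega>"])
        (auto intro!: sum_nonneg mult_nonneg_nonneg Z_nonneg)
    finally have 1: "1 \<le> pairs t \<omega>" using i k by simp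
    have "\<bar>?r\<bar> \<le> (\<Sum>j=0..p. 1 * 1)"
      by (rule order_trans[OF sum_abs sum_mono]) (unfold abs_mult, intro mult_mono, auto simp: \<phi>_bound Z_nonneg Z_le_1)
    then have "\<bar>?r\<bar> \<le> real (p + 1)" by simp
    then have "\<bar>?l - ?r\<bar> \<le> real (p + 2)" using abs_triangle_ineq4[of ?l ?r] \<phi>_bound[of "aa t \<omega>"] by simp
    also have "\<dots> \<le> real (p + 2) * pairs t \<omega>" using mult_left_mono[OF 1, of "real (p + 2)"] by simp
    finally show ?thesis .
  next
    case False
    then have 0: "Z (t - int k) \<omega> = 0" if "k \<in> {0..p} - {i}" for k using Z_cases that by blast
    have "?r = (\<Sum>j\<in>{i}. Z (t - int j) \<omega> * \<phi> (b j * Xi (t - int j) \<omega>))"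
      using i(1) 0 by (intro sum.mono_neutral_right) auto
    moreover have "aa t \<omega> = (\<Sum>j\<in>{i}. b j * (Z (t - int j) \<omega> * Xi (t - int j) \<omega>))"
      unfolding aa_def using i(1) 0 by (intro sum.mono_neutral_right) auto
    ultimately have "?l = ?r" using i(2) by simp
    then show ?thesis using pairs_nonneg[of t \<omega>] by simp
  qed
qed

lemma pairs_expectation:
  "integrable M (pairs t)" "expectation (pairs t) \<le> (real (p + 1))\<^sup>2 * (\<Gamma> * q)\<^sup>2"
proof -
  have int: "integrable M (\<lambda>\<omega>. Z r \<omega> * Z s \<omega>)" for r s
  proof (rule integrable_const_bound[of _ 1])
    have "\<bar>Z r \<omega> * Z s \<omega>\<bar> \<le> 1 * 1" for \<omega>
      unfolding abs_mult by (intro mult_mono) (simp_all add: Z_nonneg Z_le_1)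
    then show "AE \<omega> in M. norm (Z r \<omega> * Z s \<omega>) \<le> 1" by simp
  qed measurable
  have EZ: "expectation (\<lambda>\<omega>. Z r \<omega> * Z s \<omega>) \<le> (\<Gamma> * q)\<^sup>2" if "r \<noteq> s" for r s
  proof -
    have "expectation (\<lambda>\<omega>. Z r \<omega> * Z s \<omega>) = expectation (Z r) * expectation (Z s)"
    proof (rule expectation_mult_coord_algebra[OF X_indep_I, of "{Inr (Inl r)} \<inter> I" "{Inr (Inl s)} \<inter> I"])
      show "Z r \<in> borel_measurable (Fil ({Inr (Inl r)} \<inter> I))"
        "Z s \<in> borel_measurable (Fil ({Inr (Inl s)} \<inter> I))"
        by (auto intro!: coord_Z simp: I_def)
    qed (use that int in auto)
    also have "\<dots> \<le> (\<Gamma> * q) * (\<Gamma> * q)"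
      using order_trans[OF Z_int(2) \<gamma>_rate_le(1)] \<Gamma>_nonneg q_pos
      by (intro mult_mono) (auto intro!: Bochner_Integration.integral_nonneg Z_nonneg)
    finally show ?thesis by (simp add: power2_eq_square)
  qed
  show "integrable M (pairs t)" unfolding pairs_def[abs_def] using int by simp
  have "expectation (pairs t) = (\<Sum>i=0..p. \<Sum>j\<in>{0..p} - {i}. expectation (\<lambda>\<omega>. Z (t - int i) \<omega> * Z (t - int j) \<omega>))"
    unfolding pairs_def[abs_def] using int by simp
  also have "\<dots> \<le> (\<Sum>i=0..p. \<Sum>j\<in>{0..p} - {i}. (\<Gamma> * q)\<^sup>2)"
    by (intro sum_mono EZ) auto
  also have "\<dots> \<le> (\<Sum>i=0..p. \<Sum>j=0..p. (\<Gamma> * q)\<^sup>2)"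
    by (intro sum_mono sum_mono2) auto
  also have "\<dots> = (real (p + 1))\<^sup>2 * (\<Gamma> * q)\<^sup>2" by (simp add: power2_eq_square mult.assoc)
  finally show "expectation (pairs t) \<le> (real (p + 1))\<^sup>2 * (\<Gamma> * q)\<^sup>2" .
qed

text \<open>For a fixed lag, distinct times t use disjoint coordinates, so the centred summands are
  independent. Their variance is at most the probability of an outlier, because each uncentred
  summand is bounded by \<open>Z\<close> \<le> 1.\<close>

lemma outlier_lln:
  assumes j: "j \<le> p"
  shows "integrable M (\<lambda>\<omega>. \<bar>\<Sum>t\<in>{1..int n}. Z (t - int j) \<omega> * \<phi> (b j * Xi (t - int j) \<omega>) - \<gamma> * q * m j\<bar>)"
    and "expectation (\<lambda>\<omega>. \<bar>\<Sum>t\<in>{1..int n}. Z (t - int j) \<omega> * \<phi> (b j * Xi (t - int j) \<omega>) - \<gamma> * q * m j\<bar>)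
      \<le> sqrt (real n * (\<Gamma> * q))"
proof -
  let ?Y = "\<lambda>t \<omega>. Z (t - int j) \<omega> * \<phi> (b j * Xi (t - int j) \<omega>)"
  let ?D = "\<lambda>t \<omega>. ?Y t \<omega> - \<gamma> * q * m j"
  have f: "(\<lambda>s. \<phi> (b j * s)) \<in> borel_measurable borel" by measurable
  note Y = Z_f_Xi[OF f \<phi>_bound]
  have mean: "expectation (?Y t) = \<gamma> * q * m j" if "t \<in> {1..int n}" for t
    using Y(2)[OF lag_in_J[OF that j]] by (simp add: m_def)
  have Ybound: "\<bar>?Y t \<omega>\<bar> \<le> Z (t - int j) \<omega>" for t \<omega>
    using mult_left_mono[OF \<phi>_bound Z_nonneg] by (simp add: abs_mult Z_nonneg)
  have Y1: "\<bar>?Y t \<omega>\<bar> \<le> 1" for t \<omega> using Ybound Z_le_1 by (rule order_trans)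
  have gm: "\<bar>\<gamma> * q * m j\<bar> \<le> 1"
    using mult_mono[OF \<gamma>_rate_le(3) m_bound[of j]] \<gamma>_rate_le(2)
    by (simp only: abs_mult[of "\<gamma> * q"] abs_of_nonneg mult_1 zero_le_one abs_ge_zero)
  have D2: "\<bar>?D t \<omega>\<bar> \<le> 2" for t \<omega>
    using abs_triangle_ineq4[of "?Y t \<omega>" "\<gamma> * q * m j"] Y1[of t \<omega>] gm by linarith
  have Dint: "integrable M (?D t)" for t using Y(1) by simp
  have Dm[measurable]: "?D t \<in> borel_measurable M" for t by measurable
  have prod: "integrable M (\<lambda>\<omega>. ?D s \<omega> * ?D t \<omega>)" for s t
  proof (rule integrable_const_bound[of _ 4])
    have "\<bar>?D s \<omega> * ?D t \<omega>\<bar> \<le> 2 * 2" for \<omega> unfolding abs_mult by (intro mult_mono D2) auto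
    then show "AE \<omega> in M. norm (?D s \<omega> * ?D t \<omega>) \<le> 4" by simp
  qed measurable
  have sq: "integrable M (\<lambda>\<omega>. (?D t \<omega>)\<^sup>2)" for t
    using prod[of t t] by (simp only: power2_eq_square)
  have orth: "expectation (\<lambda>\<omega>. ?D s \<omega> * ?D t \<omega>) = 0" if st: "s \<in> {1..int n}" "t \<in> {1..int n}" "s \<noteq> t" for s t
  proof -
    let ?A = "\<lambda>t. {Inr (Inl (t - int j)), Inr (Inr (t - int j))}"
    have meas: "?D t \<in> borel_measurable (Fil (?A t))" for t
    proof -
      have "Xi (t - int j) \<in> borel_measurable (Fil (?A t))" by (rule coord_Xi) simp
      note Xi = measurable_compose[OF this f]
      have "Z (t - int j) \<in> borel_measurable (Fil (?A t))" by (rule coord_Z) simp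
      then show ?thesis by (intro borel_measurable_diff borel_measurable_times borel_measurable_const Xi)
    qed
    have sub: "?A t \<subseteq> I" if "t \<in> {1..int n}" for t using lag_in_J[OF that j] by (auto simp: I_def)
    have "expectation (\<lambda>\<omega>. ?D s \<omega> * ?D t \<omega>) = expectation (?D s) * expectation (?D t)"
      by (rule expectation_mult_coord_algebra[OF X_indep_I sub sub _ meas meas prod]) (use st in auto)
    also have "expectation (?D s) = 0" using Y(1) mean[OF st(1)] by (simp add: prob_space)
    finally show ?thesis by simp
  qed
  have var: "expectation (\<lambda>\<omega>. (?D t \<omega>)\<^sup>2) \<le> \<Gamma> * q" if t: "t \<in> {1..int n}" for t
  proof -
    have Ysq: "integrable M (\<lambda>\<omega>. (?Y t \<omega>)\<^sup>2)"
    proof (rule integrable_const_bound[of _ 1])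
      have "norm ((?Y t \<omega>)\<^sup>2) \<le> 1" for \<omega>
        using power_mono[OF Y1 abs_ge_zero, of t \<omega> 2] by simp
      then show "AE \<omega> in M. norm ((?Y t \<omega>)\<^sup>2) \<le> 1" by simp
    qed measurable
    have "expectation (\<lambda>\<omega>. (?D t \<omega>)\<^sup>2) = variance (?Y t)" using mean[OF t] by simp
    also have "\<dots> = expectation (\<lambda>\<omega>. (?Y t \<omega>)\<^sup>2) - (expectation (?Y t))\<^sup>2"
      by (rule variance_eq[OF Y(1) Ysq])
    also have "\<dots> \<le> expectation (\<lambda>\<omega>. (?Y t \<omega>)\<^sup>2)" by simp
    also have "\<dots> \<le> expectation (Z (t - int j))"
    proof (rule integral_mono[OF Ysq Z_int(1)])
      fix \<omega>
      have "(?Y t \<omega>)\<^sup>2 = \<bar>?Y t \<omega>\<bar> * \<bar>?Y t \<omega>\<bar>" by (simp add: power2_eq_square abs_mult_self_eq)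
      also have "\<dots> \<le> Z (t - int j) \<omega> * 1" by (intro mult_mono Ybound Y1 Z_nonneg) simp
      finally show "(?Y t \<omega>)\<^sup>2 \<le> Z (t - int j) \<omega>" by simp
    qed
    also have "\<dots> \<le> \<Gamma> * q" by (rule order_trans[OF Z_int(2) \<gamma>_rate_le(1)])
    finally show ?thesis .
  qed
  note b = expectation_abs_sum_uncorrelated[of "{1..int n}" ?D "\<Gamma> * q", OF _ Dm sq orth var]
  show "integrable M (\<lambda>\<omega>. \<bar>\<Sum>t\<in>{1..int n}. ?D t \<omega>\<bar>)" by (rule b(1)) auto
  have "expectation (\<lambda>\<omega>. \<bar>\<Sum>t\<in>{1..int n}. ?D t \<omega>\<bar>) \<le> sqrt (real (card {1..int n}) * (\<Gamma> * q))"
    by (rule b(2)) auto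
  then show "expectation (\<lambda>\<omega>. \<bar>\<Sum>t\<in>{1..int n}. ?D t \<omega>\<bar>) \<le> sqrt (real n * (\<Gamma> * q))" by simp
qed

section \<open>Partial sums of the lagged process\<close>

definition S where "S j \<omega> = (\<Sum>t\<in>{1..int n}. U (t - int j) \<omega>)"

lemma S_int: "integrable M (S j)"
  unfolding S_def[abs_def]
  using square_integrable_imp_integrable[OF U_measurable U_sq] by simp

text \<open>Raising the lag by one changes the sum only at its two ends, so each step costs at most
  two first moments of \<open>U\<close>.\<close>

lemma S_shift: "expectation (\<lambda>\<omega>. \<bar>S j \<omega> - S 0 \<omega>\<bar>) \<le> 2 * real j * C1"
proof (induction j)
  case (Suc j)
  have eq: "S j \<omega> - S (Suc j) \<omega> = U (int n - int j) \<omega> - U (0 - int j) \<omega>" for \<omega>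
  proof -
    have "S j \<omega> - S (Suc j) \<omega> = (\<Sum>t\<in>{1..int n}. U (t - int j) \<omega> - U (t - 1 - int j) \<omega>)"
      unfolding S_def sum_subtractf[symmetric] by (simp add: algebra_simps)
    also have "\<dots> = U (int n - int j) \<omega> - U (0 - int j) \<omega>"
      by (rule sum_int_telescope[of "\<lambda>t. U (t - int j) \<omega>"])
    finally show ?thesis .
  qed
  have "expectation (\<lambda>\<omega>. \<bar>S (Suc j) \<omega> - S 0 \<omega>\<bar>)
      \<le> expectation (\<lambda>\<omega>. \<bar>S j \<omega> - S 0 \<omega>\<bar> + (\<bar>U (int n - int j) \<omega>\<bar> + \<bar>U (0 - int j) \<omega>\<bar>))"
  proof (rule integral_mono)
    show "\<bar>S (Suc j) \<omega> - S 0 \<omega>\<bar> \<le> \<bar>S j \<omega> - S 0 \<omega>\<bar> + (\<bar>U (int n - int j) \<omega>\<bar> + \<bar>U (0 - int j) \<omega>\<bar>)" for \<omega>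
      using eq[of \<omega>] by linarith
  qed (use S_int U_abs in auto)
  also have "\<dots> = expectation (\<lambda>\<omega>. \<bar>S j \<omega> - S 0 \<omega>\<bar>)
      + (expectation (\<lambda>\<omega>. \<bar>U (int n - int j) \<omega>\<bar>) + expectation (\<lambda>\<omega>. \<bar>U (0 - int j) \<omega>\<bar>))"
    using S_int U_abs by simp
  also have "\<dots> \<le> 2 * real j * C1 + (C1 + C1)"
    by (intro add_mono Suc U_abs)
  finally show ?case by (simp add: algebra_simps)
qed simp

lemma innovation_lln: "integrable M (\<lambda>\<omega>. \<bar>\<Sum>t\<in>{1..int n}. \<epsilon> t \<omega>\<bar>)"
  "expectation (\<lambda>\<omega>. \<bar>\<Sum>t\<in>{1..int n}. \<epsilon> t \<omega>\<bar>) \<le> sqrt (real n * V)"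
proof -
  have orth: "expectation (\<lambda>\<omega>. \<epsilon> s \<omega> * \<epsilon> t \<omega>) = 0" if "s \<noteq> t" for s t
  proof -
    have "expectation (\<lambda>\<omega>. \<epsilon> s \<omega> * \<epsilon> t \<omega>) = expectation (\<epsilon> s) * expectation (\<epsilon> t)"
    proof (rule expectation_mult_coord_algebra[OF X_indep_I, of "{Inl s}" "{Inl t}"])
      show "\<epsilon> s \<in> borel_measurable (Fil {Inl s})" "\<epsilon> t \<in> borel_measurable (Fil {Inl t})"
        by (auto intro: coord_\<epsilon>)
      show "integrable M (\<lambda>\<omega>. \<epsilon> s \<omega> * \<epsilon> t \<omega>)"
        by (rule integrable_mult_square) (auto intro: \<epsilon>_sq)
    qed (use that in \<open>auto simp: I_def\<close>)
    then show ?thesis by (simp add: \<epsilon>_mean)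
  qed
  note b = expectation_abs_sum_uncorrelated[of "{1..int n}" \<epsilon> V, OF _ \<epsilon>_measurable \<epsilon>_sq orth \<epsilon>_var]
  show "integrable M (\<lambda>\<omega>. \<bar>\<Sum>t\<in>{1..int n}. \<epsilon> t \<omega>\<bar>)" by (rule b(1)) auto
  have "expectation (\<lambda>\<omega>. \<bar>\<Sum>t\<in>{1..int n}. \<epsilon> t \<omega>\<bar>) \<le> sqrt (real (card {1..int n}) * V)"
    by (rule b(2)) auto
  then show "expectation (\<lambda>\<omega>. \<bar>\<Sum>t\<in>{1..int n}. \<epsilon> t \<omega>\<bar>) \<le> sqrt (real n * V)" by simp
qed

text \<open>Summing the recursion over \<open>t\<close> expresses the sum of the process by that of the innovations
  and boundary terms, because \<open>\<Sum>\<beta> \<noteq> 1\<close>.\<close>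

lemma S_0_bound:
  "AE \<omega> in M. \<bar>1 - (\<Sum>j=1..p. \<beta> j)\<bar> * \<bar>S 0 \<omega>\<bar>
     \<le> (\<Sum>j=1..p. \<bar>\<beta> j\<bar> * \<bar>S j \<omega> - S 0 \<omega>\<bar>) + \<bar>\<Sum>t\<in>{1..int n}. \<epsilon> t \<omega>\<bar>"
  using centered_recursion stationary_solution_causal
proof eventually_elim
  case (elim \<omega>)
  have ar: "U t \<omega> = (\<Sum>j=1..p. \<beta> j * U (t - int j) \<omega>) + \<epsilon> t \<omega>" for t
    using elim(1)[rule_format, of t] by (simp only: elim(2)[rule_format])
  have "S 0 \<omega> = (\<Sum>t\<in>{1..int n}. U t \<omega>)" unfolding S_def by simp
  also have "\<dots> = (\<Sum>t\<in>{1..int n}. (\<Sum>j=1..p. \<beta> j * U (t - int j) \<omega>) + \<epsilon> t \<omega>)"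
    by (rule sum.cong[OF refl ar])
  also have "\<dots> = (\<Sum>j=1..p. \<beta> j * S j \<omega>) + (\<Sum>t\<in>{1..int n}. \<epsilon> t \<omega>)"
    unfolding S_def sum.distrib by (subst sum.swap) (simp add: sum_distrib_left)
  finally have S0: "S 0 \<omega> = (\<Sum>j=1..p. \<beta> j * S j \<omega>) + (\<Sum>t\<in>{1..int n}. \<epsilon> t \<omega>)" .
  have Sd: "(\<Sum>j=1..p. \<beta> j * (S j \<omega> - S 0 \<omega>)) = (\<Sum>j=1..p. \<beta> j * S j \<omega>) - (\<Sum>j=1..p. \<beta> j) * S 0 \<omega>"
    by (simp only: right_diff_distrib sum_subtractf sum_distrib_right)
  have "(1 - (\<Sum>j=1..p. \<beta> j)) * S 0 \<omega> = (\<Sum>j=1..p. \<beta> j * (S j \<omega> - S 0 \<omega>)) + (\<Sum>t\<in>{1..int n}. \<epsilon> t \<omega>)"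
    unfolding Sd left_diff_distrib using S0 by linarith
  then have "\<bar>1 - (\<Sum>j=1..p. \<beta> j)\<bar> * \<bar>S 0 \<omega>\<bar> = \<bar>(\<Sum>j=1..p. \<beta> j * (S j \<omega> - S 0 \<omega>)) + (\<Sum>t\<in>{1..int n}. \<epsilon> t \<omega>)\<bar>"
    by (simp only: abs_mult[symmetric])
  also have "\<dots> \<le> \<bar>\<Sum>j=1..p. \<beta> j * (S j \<omega> - S 0 \<omega>)\<bar> + \<bar>\<Sum>t\<in>{1..int n}. \<epsilon> t \<omega>\<bar>"
    by (rule abs_triangle_ineq)
  also have "\<bar>\<Sum>j=1..p. \<beta> j * (S j \<omega> - S 0 \<omega>)\<bar> \<le> (\<Sum>j=1..p. \<bar>\<beta> j\<bar> * \<bar>S j \<omega> - S 0 \<omega>\<bar>)"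
    using sum_abs[of "\<lambda>j. \<beta> j * (S j \<omega> - S 0 \<omega>)"] by (simp add: abs_mult)
  finally show ?case by simp
qed

definition CS where
  "CS = ((\<Sum>j=1..p. \<bar>\<beta> j\<bar>) * (2 * real p * C1) + sqrt V) / \<bar>1 - (\<Sum>j=1..p. \<beta> j)\<bar> + 2 * real p * C1"

lemma C1_nonneg: "0 \<le> C1" unfolding C1_def using CU_nonneg by simp

text \<open>The innovation sum is of order sqrt n in mean and the boundary terms are bounded;
  dividing by |1 - \<Sum>\<beta>| transfers this to the process. The term linear in \<tau>_1 carries
  the factor q^2, so it vanishes like q.\<close>

lemma process_lln:
  assumes j: "j \<le> p"
  shows "expectation (\<lambda>\<omega>. \<bar>S j \<omega>\<bar>) \<le> sqrt (real n) * CS"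
proof -
  let ?d = "\<bar>1 - (\<Sum>j=1..p. \<beta> j)\<bar>" and ?B = "(\<Sum>j=1..p. \<bar>\<beta> j\<bar>)" and ?c = "2 * real p * C1"
  have d: "0 < ?d" using char_at_1 by simp
  have n1: "1 \<le> sqrt (real n)" using n_pos by simp
  have shift: "expectation (\<lambda>\<omega>. \<bar>S i \<omega> - S 0 \<omega>\<bar>) \<le> ?c" if "i \<le> p" for i
    using S_shift[of i] mult_right_mono[of "2 * real i" "2 * real p" C1] C1_nonneg that by simp
  have "?d * expectation (\<lambda>\<omega>. \<bar>S 0 \<omega>\<bar>) = expectation (\<lambda>\<omega>. ?d * \<bar>S 0 \<omega>\<bar>)" by simp
  also have "\<dots> \<le> expectation (\<lambda>\<omega>. (\<Sum>j=1..p. \<bar>\<beta> j\<bar> * \<bar>S j \<omega> - S 0 \<omega>\<bar>) + \<bar>\<Sum>t\<in>{1..int n}. \<epsilon> t \<omega>\<bar>)"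
    by (rule integral_mono_AE[OF _ _ S_0_bound]) (use S_int innovation_lln(1) in simp_all)
  also have "\<dots> = (\<Sum>j=1..p. \<bar>\<beta> j\<bar> * expectation (\<lambda>\<omega>. \<bar>S j \<omega> - S 0 \<omega>\<bar>))
      + expectation (\<lambda>\<omega>. \<bar>\<Sum>t\<in>{1..int n}. \<epsilon> t \<omega>\<bar>)"
    using S_int innovation_lln(1) by simp
  also have "\<dots> \<le> (\<Sum>j=1..p. \<bar>\<beta> j\<bar> * ?c) + sqrt (real n * V)"
    using shift innovation_lln(2) by (intro add_mono sum_mono mult_left_mono) auto
  also have "\<dots> = ?B * ?c + sqrt (real n) * sqrt V"
    by (simp add: sum_distrib_right real_sqrt_mult)
  also have "\<dots> \<le> sqrt (real n) * (?B * ?c) + sqrt (real n) * sqrt V"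
    using mult_right_mono[OF n1, of "?B * ?c"] C1_nonneg by (simp add: sum_nonneg)
  finally have "?d * expectation (\<lambda>\<omega>. \<bar>S 0 \<omega>\<bar>) \<le> sqrt (real n) * (?B * ?c + sqrt V)"
    by (simp only: distrib_left)
  then have S0: "expectation (\<lambda>\<omega>. \<bar>S 0 \<omega>\<bar>) \<le> sqrt (real n) * ((?B * ?c + sqrt V) / ?d)"
    using d by (simp add: pos_le_divide_eq mult.commute)
  have "expectation (\<lambda>\<omega>. \<bar>S j \<omega>\<bar>) \<le> expectation (\<lambda>\<omega>. \<bar>S 0 \<omega>\<bar> + \<bar>S j \<omega> - S 0 \<omega>\<bar>)"
    by (rule integral_mono) (use S_int in auto)
  also have "\<dots> = expectation (\<lambda>\<omega>. \<bar>S 0 \<omega>\<bar>) + expectation (\<lambda>\<omega>. \<bar>S j \<omega> - S 0 \<omega>\<bar>)"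
    using S_int by simp
  also have "\<dots> \<le> sqrt (real n) * ((?B * ?c + sqrt V) / ?d) + ?c"
    by (intro add_mono S0 shift j)
  also have "\<dots> \<le> sqrt (real n) * ((?B * ?c + sqrt V) / ?d) + sqrt (real n) * ?c"
    using mult_right_mono[OF n1, of ?c] C1_nonneg by simp
  also have "\<dots> = sqrt (real n) * CS" unfolding CS_def by (simp only: distrib_left)
  finally show ?thesis .
qed

section \<open>A remainder that does not depend on the perturbation\<close>

definition Zn where
  "Zn \<omega> = q * (\<Sum>t\<in>{1..int n}. err t \<omega>)
     + \<bar>q * (\<Sum>t\<in>{1..int n}. \<phi> (aa t \<omega>)) - \<gamma> * outlier_shift p \<beta> G0 P\<xi> x\<bar>
     + q * q * (L * \<Theta>) * (\<Sum>j=1..p. \<bar>S j \<omega>\<bar>)"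

definition Bn where "Bn \<omega> = L * (q * q) * (\<Sum>t\<in>{1..int n}. cc t \<omega>)"

text \<open>The right side contains \<tau> no more, which gives uniformity over all perturbations
  pathwise. The slack appears only as the coefficient of \<open>Bn\<close>, whose mean is bounded
  but does not tend to 0.\<close>

lemma compensator_expansion:
  assumes \<tau>: "\<And>j. j \<le> p \<Longrightarrow> \<bar>\<tau> j\<bar> \<le> \<Theta>" and s: "\<bar>s\<bar> \<le> 1"
  shows "\<bar>q * (\<Sum>t\<in>{1..int n}. F (x + (aa t \<omega> + pert \<tau> s t \<omega>)) - F x) - gx * \<tau> 0
      - \<gamma> * outlier_shift p \<beta> G0 P\<xi> x\<bar> \<le> Zn \<omega> + \<bar>s\<bar> * Bn \<omega>"
proof -
  let ?T = "{1..int n}" and ?\<Delta> = "\<gamma> * outlier_shift p \<beta> G0 P\<xi> x"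
  let ?e = "\<lambda>t. F (x + (aa t \<omega> + pert \<tau> s t \<omega>)) - F x - \<phi> (aa t \<omega>) - gx * (q * lin \<tau> t \<omega>)"
  have e: "\<bar>q * (\<Sum>t\<in>?T. ?e t)\<bar> \<le> q * (\<Sum>t\<in>?T. err t \<omega>) + \<bar>s\<bar> * Bn \<omega>"
  proof -
    have "\<bar>\<Sum>t\<in>?T. ?e t\<bar> \<le> (\<Sum>t\<in>?T. err t \<omega> + L * \<bar>s\<bar> * q * cc t \<omega>)"
      unfolding \<phi>_def
      by (rule order_trans[OF sum_abs sum_mono]) (rule mixture_increment_expansion[of \<tau> s _ \<omega>, OF \<tau> s])
    then have "q * \<bar>\<Sum>t\<in>?T. ?e t\<bar> \<le> q * (\<Sum>t\<in>?T. err t \<omega> + L * \<bar>s\<bar> * q * cc t \<omega>)"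
      using q_pos by (intro mult_left_mono) auto
    also have "\<dots> = q * (\<Sum>t\<in>?T. err t \<omega>) + \<bar>s\<bar> * Bn \<omega>"
      unfolding Bn_def sum.distrib sum_distrib_left[symmetric] by (simp add: algebra_simps)
    finally show ?thesis using q_pos by (simp add: abs_mult)
  qed
  \<comment> \<open>The normalisation q n q = 1 leaves exactly gx \<tau>_0; the \<tau>_1 part is
    reduced to the partial sums \<open>S j\<close>.\<close>
  have lin: "q * (\<Sum>t\<in>?T. gx * (q * lin \<tau> t \<omega>)) = gx * \<tau> 0 + q * q * gx * (\<Sum>j=1..p. \<tau> j * S j \<omega>)"
  proof -
    have "(\<Sum>t\<in>?T. lin \<tau> t \<omega>) = real n * \<tau> 0 + (\<Sum>j=1..p. \<tau> j * S j \<omega>)"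
      unfolding lin_def S_def sum.distrib by (subst sum.swap) (simp add: sum_distrib_left)
    then have "q * (\<Sum>t\<in>?T. gx * (q * lin \<tau> t \<omega>)) = q * (gx * (q * (real n * \<tau> 0 + (\<Sum>j=1..p. \<tau> j * S j \<omega>))))"
      by (simp only: sum_distrib_left[symmetric])
    also have "\<dots> = (q * real n * q) * (gx * \<tau> 0) + q * q * gx * (\<Sum>j=1..p. \<tau> j * S j \<omega>)"
      by (simp only: distrib_left ac_simps)
    finally show ?thesis unfolding q_n by simp
  qed
  have linS: "\<bar>q * q * gx * (\<Sum>j=1..p. \<tau> j * S j \<omega>)\<bar> \<le> q * q * (L * \<Theta>) * (\<Sum>j=1..p. \<bar>S j \<omega>\<bar>)"
  proof -
    have "\<bar>\<Sum>j=1..p. \<tau> j * S j \<omega>\<bar> \<le> (\<Sum>j=1..p. \<Theta> * \<bar>S j \<omega>\<bar>)"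
      by (rule order_trans[OF sum_abs sum_mono]) (use \<tau> in \<open>auto simp: abs_mult intro: mult_right_mono\<close>)
    then have "\<bar>gx\<bar> * \<bar>\<Sum>j=1..p. \<tau> j * S j \<omega>\<bar> \<le> L * (\<Theta> * (\<Sum>j=1..p. \<bar>S j \<omega>\<bar>))"
      using gx_bound L_nonneg by (intro mult_mono) (simp_all add: sum_distrib_left)
    then have "(q * q) * (\<bar>gx\<bar> * \<bar>\<Sum>j=1..p. \<tau> j * S j \<omega>\<bar>) \<le> (q * q) * (L * (\<Theta> * (\<Sum>j=1..p. \<bar>S j \<omega>\<bar>)))"
      using q_pos by (intro mult_left_mono) auto
    then show ?thesis using q_pos by (simp add: abs_mult mult.assoc)
  qed
  have eq: "q * (\<Sum>t\<in>?T. F (x + (aa t \<omega> + pert \<tau> s t \<omega>)) - F x) - gx * \<tau> 0 - ?\<Delta>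
      = q * (\<Sum>t\<in>?T. ?e t) + (q * (\<Sum>t\<in>?T. \<phi> (aa t \<omega>)) - ?\<Delta>) + q * q * gx * (\<Sum>j=1..p. \<tau> j * S j \<omega>)"
  proof -
    have "(\<Sum>t\<in>?T. F (x + (aa t \<omega> + pert \<tau> s t \<omega>)) - F x)
        = (\<Sum>t\<in>?T. ?e t) + (\<Sum>t\<in>?T. \<phi> (aa t \<omega>)) + (\<Sum>t\<in>?T. gx * (q * lin \<tau> t \<omega>))"
      unfolding sum.distrib[symmetric] by simp
    then show ?thesis using lin by (simp add: distrib_left)
  qed
  have tri: "\<bar>a + b + c\<bar> \<le> (A + C) + B + D" if "\<bar>a\<bar> \<le> A + B" "\<bar>b\<bar> = C" "\<bar>c\<bar> \<le> D" for a b c A B C D :: real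
    using that by linarith
  have "\<bar>q * (\<Sum>t\<in>?T. ?e t) + (q * (\<Sum>t\<in>?T. \<phi> (aa t \<omega>)) - ?\<Delta>) + q * q * gx * (\<Sum>j=1..p. \<tau> j * S j \<omega>)\<bar>
    \<le> (q * (\<Sum>t\<in>?T. err t \<omega>) + \<bar>q * (\<Sum>t\<in>?T. \<phi> (aa t \<omega>)) - ?\<Delta>\<bar>) + \<bar>s\<bar> * Bn \<omega>
      + q * q * (L * \<Theta>) * (\<Sum>j=1..p. \<bar>S j \<omega>\<bar>)"
    by (rule tri[OF e refl linS])
  then show ?thesis unfolding eq Zn_def by (simp only: ac_simps)
qed

lemma Bn_expectation: "integrable M Bn" "expectation Bn \<le> L * C2"
proof -
  show "integrable M Bn" unfolding Bn_def[abs_def] using cc_int by simp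
  have "expectation Bn = L * (q * q) * (\<Sum>t\<in>{1..int n}. expectation (cc t))"
    unfolding Bn_def[abs_def] using cc_int by simp
  also have "\<dots> \<le> L * (q * q) * (\<Sum>t\<in>{1..int n}. C2)"
    using L_nonneg q_pos cc_int by (intro mult_left_mono sum_mono) auto
  also have "\<dots> = L * C2 * (real n * (q * q))" by simp
  finally show "expectation Bn \<le> L * C2" unfolding q_sq by simp
qed

lemma err_sum_expectation:
  "integrable M (\<lambda>\<omega>. q * (\<Sum>t\<in>{1..int n}. err t \<omega>))"
  "expectation (\<lambda>\<omega>. q * (\<Sum>t\<in>{1..int n}. err t \<omega>)) \<le> (K * \<theta>\<^sup>2 * C2) * q
     + 2 * (L * \<theta>) * (real (p + 1) * (\<Gamma> + C2)) * sqrt q + real p * \<Gamma> * \<kappa>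
     + 2 * R * (real (p + 1) * \<Gamma> + L * \<theta> * C2) * q"
proof -
  show "integrable M (\<lambda>\<omega>. q * (\<Sum>t\<in>{1..int n}. err t \<omega>))" using err_expectation(1) by auto
  have "expectation (\<lambda>\<omega>. q * (\<Sum>t\<in>{1..int n}. err t \<omega>)) = q * (\<Sum>t\<in>{1..int n}. expectation (err t))"
    using err_expectation(1) by (simp add: Bochner_Integration.integral_sum)
  also have "\<dots> \<le> q * (\<Sum>t\<in>{1..int n}. err_bound)"
    using q_pos err_expectation(2) by (intro mult_left_mono sum_mono) auto
  also have "\<dots> = (q * real n) * err_bound" by simp
  also have "\<dots> = (q * real n * q) * ((K * \<theta>\<^sup>2 * C2) * q
     + 2 * (L * \<theta>) * (real (p + 1) * (\<Gamma> + C2)) * sqrt q + real p * \<Gamma> * \<kappa>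
     + 2 * R * (real (p + 1) * \<Gamma> + L * \<theta> * C2) * q)"
    unfolding err_bound_def by (simp only: distrib_left ac_simps)
  finally show "expectation (\<lambda>\<omega>. q * (\<Sum>t\<in>{1..int n}. err t \<omega>)) \<le> (K * \<theta>\<^sup>2 * C2) * q
     + 2 * (L * \<theta>) * (real (p + 1) * (\<Gamma> + C2)) * sqrt q + real p * \<Gamma> * \<kappa>
     + 2 * R * (real (p + 1) * \<Gamma> + L * \<theta> * C2) * q"
    unfolding q_n by simp
qed

text \<open>Windows with several outliers cost order n q (\<Gamma> q)^2 = \<Gamma>^2 q; the
  fluctuations of the p + 1 isolated-outlier sums cost sqrt (\<Gamma> q) each.\<close>

lemma shift_expectation:
  "integrable M (\<lambda>\<omega>. \<bar>q * (\<Sum>t\<in>{1..int n}. \<phi> (aa t \<omega>)) - \<gamma> * outlier_shift p \<beta> G0 P\<xi> x\<bar>)"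
  "expectation (\<lambda>\<omega>. \<bar>q * (\<Sum>t\<in>{1..int n}. \<phi> (aa t \<omega>)) - \<gamma> * outlier_shift p \<beta> G0 P\<xi> x\<bar>)
    \<le> real (p + 2) * (real (p + 1))\<^sup>2 * \<Gamma>\<^sup>2 * q + real (p + 1) * sqrt (\<Gamma> * q)"
proof -
  let ?T = "{1..int n}" and ?\<Delta> = "\<gamma> * outlier_shift p \<beta> G0 P\<xi> x"
  let ?Y = "\<lambda>j t \<omega>. Z (t - int j) \<omega> * \<phi> (b j * Xi (t - int j) \<omega>)"
  let ?R = "\<lambda>j \<omega>. \<Sum>t\<in>?T. ?Y j t \<omega> - \<gamma> * q * m j"
  have "integrable M (\<lambda>\<omega>. \<phi> (aa t \<omega>))" for t
    by (rule integrable_const_bound[of _ 1]) (auto simp: \<phi>_bound)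
  then show int: "integrable M (\<lambda>\<omega>. \<bar>q * (\<Sum>t\<in>?T. \<phi> (aa t \<omega>)) - ?\<Delta>\<bar>)" by simp
  have le: "\<bar>q * (\<Sum>t\<in>?T. \<phi> (aa t \<omega>)) - ?\<Delta>\<bar>
      \<le> q * (\<Sum>t\<in>?T. real (p + 2) * pairs t \<omega>) + q * (\<Sum>j=0..p. \<bar>?R j \<omega>\<bar>)" for \<omega>
  proof -
    have "q * (\<Sum>t\<in>?T. \<gamma> * q * m j) = \<gamma> * m j" for j
    proof -
      have "q * (\<Sum>t\<in>?T. \<gamma> * q * m j) = (q * real n * q) * (\<gamma> * m j)" by simp
      then show ?thesis unfolding q_n by simp
    qed
    then have \<Delta>: "?\<Delta> = q * (\<Sum>j=0..p. \<Sum>t\<in>?T. \<gamma> * q * m j)"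
      unfolding m_sum by (simp only: sum_distrib_left)
    have sw: "(\<Sum>t\<in>?T. \<Sum>j=0..p. ?Y j t \<omega>) = (\<Sum>j=0..p. \<Sum>t\<in>?T. ?Y j t \<omega>)"
      by (rule sum.swap)
    have eq: "q * (\<Sum>t\<in>?T. \<phi> (aa t \<omega>)) - ?\<Delta>
        = q * (\<Sum>t\<in>?T. \<phi> (aa t \<omega>) - (\<Sum>j=0..p. ?Y j t \<omega>)) + q * (\<Sum>j=0..p. ?R j \<omega>)"
      by (simp only: \<Delta> sum_subtractf sw right_diff_distrib add_diff_eq diff_add_cancel)
    have "\<bar>q * (\<Sum>t\<in>?T. \<phi> (aa t \<omega>)) - ?\<Delta>\<bar> \<le> \<bar>q * (\<Sum>t\<in>?T. \<phi> (aa t \<omega>) - (\<Sum>j=0..p. ?Y j t \<omega>))\<bar> + \<bar>q * (\<Sum>j=0..p. ?R j \<omega>)\<bar>"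
      unfolding eq by (rule abs_triangle_ineq)
    also have "\<dots> \<le> q * (\<Sum>t\<in>?T. real (p + 2) * pairs t \<omega>) + q * (\<Sum>j=0..p. \<bar>?R j \<omega>\<bar>)"
    proof (rule add_mono)
      have "\<bar>\<Sum>t\<in>?T. \<phi> (aa t \<omega>) - (\<Sum>j=0..p. ?Y j t \<omega>)\<bar> \<le> (\<Sum>t\<in>?T. real (p + 2) * pairs t \<omega>)"
        by (rule order_trans[OF sum_abs sum_mono[OF single_outlier_expansion]])
      then show "\<bar>q * (\<Sum>t\<in>?T. \<phi> (aa t \<omega>) - (\<Sum>j=0..p. ?Y j t \<omega>))\<bar> \<le> q * (\<Sum>t\<in>?T. real (p + 2) * pairs t \<omega>)"
        using q_pos by (simp add: abs_mult)
      show "\<bar>q * (\<Sum>j=0..p. ?R j \<omega>)\<bar> \<le> q * (\<Sum>j=0..p. \<bar>?R j \<omega>\<bar>)"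
        using q_pos sum_abs[of "\<lambda>j. ?R j \<omega>" "{0..p}"] by (simp add: abs_mult)
    qed
    finally show ?thesis .
  qed
  have Rint: "integrable M (\<lambda>\<omega>. \<Sum>j=0..p. \<bar>?R j \<omega>\<bar>)"
    by (rule Bochner_Integration.integrable_sum) (rule outlier_lln(1), simp)
  have "expectation (\<lambda>\<omega>. \<bar>q * (\<Sum>t\<in>?T. \<phi> (aa t \<omega>)) - ?\<Delta>\<bar>)
      \<le> expectation (\<lambda>\<omega>. q * (\<Sum>t\<in>?T. real (p + 2) * pairs t \<omega>) + q * (\<Sum>j=0..p. \<bar>?R j \<omega>\<bar>))"
    using int le pairs_expectation(1) Rint by (intro integral_mono) auto
  also have "\<dots> = q * (\<Sum>t\<in>?T. real (p + 2) * expectation (pairs t)) + q * expectation (\<lambda>\<omega>. \<Sum>j=0..p. \<bar>?R j \<omega>\<bar>)"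
    using pairs_expectation(1) Rint by simp
  also have "expectation (\<lambda>\<omega>. \<Sum>j=0..p. \<bar>?R j \<omega>\<bar>) = (\<Sum>j=0..p. expectation (\<lambda>\<omega>. \<bar>?R j \<omega>\<bar>))"
    by (rule Bochner_Integration.integral_sum) (rule outlier_lln(1), simp)
  also have "q * (\<Sum>t\<in>?T. real (p + 2) * expectation (pairs t)) + q * (\<Sum>j=0..p. expectation (\<lambda>\<omega>. \<bar>?R j \<omega>\<bar>))
     \<le> q * (\<Sum>t\<in>?T. real (p + 2) * ((real (p + 1))\<^sup>2 * (\<Gamma> * q)\<^sup>2)) + q * (\<Sum>j=0..p. sqrt (real n * (\<Gamma> * q)))"
    using q_pos by (intro add_mono mult_left_mono sum_mono pairs_expectation(2) outlier_lln(2)) auto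
  also have "\<dots> = (q * real n * q) * (real (p + 2) * (real (p + 1))\<^sup>2 * \<Gamma>\<^sup>2 * q)
      + real (p + 1) * (q * sqrt (real n * (\<Gamma> * q)))"
    by (simp add: power_mult_distrib power2_eq_square)
  also have "q * sqrt (real n * (\<Gamma> * q)) = sqrt ((real n * (q * q)) * (\<Gamma> * q))"
    using q_pos by (simp add: real_sqrt_mult)
  finally show "expectation (\<lambda>\<omega>. \<bar>q * (\<Sum>t\<in>?T. \<phi> (aa t \<omega>)) - ?\<Delta>\<bar>)
    \<le> real (p + 2) * (real (p + 1))\<^sup>2 * \<Gamma>\<^sup>2 * q + real (p + 1) * sqrt (\<Gamma> * q)"
    unfolding q_n q_sq by simp
qed

definition Zbound where
  "Zbound = (K * \<theta>\<^sup>2 * C2) * q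
     + 2 * (L * \<theta>) * (real (p + 1) * (\<Gamma> + C2)) * sqrt q + real p * \<Gamma> * \<kappa>
     + 2 * R * (real (p + 1) * \<Gamma> + L * \<theta> * C2) * q
     + (real (p + 2) * (real (p + 1))\<^sup>2 * \<Gamma>\<^sup>2 * q + real (p + 1) * sqrt (\<Gamma> * q))
     + L * \<Theta> * real p * CS * q"

lemma Zn_expectation: "integrable M Zn" "expectation Zn \<le> Zbound"
proof -
  have Sint: "integrable M (\<lambda>\<omega>. q * q * (L * \<Theta>) * (\<Sum>j=1..p. \<bar>S j \<omega>\<bar>))" using S_int by simp
  show "integrable M Zn"
    unfolding Zn_def[abs_def]
    by (intro Bochner_Integration.integrable_add err_sum_expectation(1) shift_expectation(1) Sint)
  have "expectation (\<lambda>\<omega>. q * q * (L * \<Theta>) * (\<Sum>j=1..p. \<bar>S j \<omega>\<bar>)) = q * q * (L * \<Theta>) * (\<Sum>j=1..p. expectation (\<lambda>\<omega>. \<bar>S j \<omega>\<bar>))"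
    using S_int by simp
  also have "\<dots> \<le> q * q * (L * \<Theta>) * (\<Sum>j=1..p. sqrt (real n) * CS)"
    using L_nonneg \<Theta>_nonneg q_pos process_lln by (intro mult_left_mono sum_mono) auto
  also have "\<dots> = (q * sqrt (real n)) * (L * \<Theta> * real p * CS * q)" by simp
  also have "q * sqrt (real n) = 1" using n_pos by (simp add: q_def)
  finally have Sexp: "expectation (\<lambda>\<omega>. q * q * (L * \<Theta>) * (\<Sum>j=1..p. \<bar>S j \<omega>\<bar>)) \<le> L * \<Theta> * real p * CS * q" by simp
  have "expectation Zn = expectation (\<lambda>\<omega>. q * (\<Sum>t\<in>{1..int n}. err t \<omega>))
     + expectation (\<lambda>\<omega>. \<bar>q * (\<Sum>t\<in>{1..int n}. \<phi> (aa t \<omega>)) - \<gamma> * outlier_shift p \<beta> G0 P\<xi> x\<bar>)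
     + expectation (\<lambda>\<omega>. q * q * (L * \<Theta>) * (\<Sum>j=1..p. \<bar>S j \<omega>\<bar>))"
    unfolding Zn_def[abs_def]
    by (subst Bochner_Integration.integral_add Bochner_Integration.integral_add,
        intro Bochner_Integration.integrable_add err_sum_expectation(1) shift_expectation(1), rule Sint)
      (subst Bochner_Integration.integral_add, rule err_sum_expectation(1), rule shift_expectation(1), rule refl)
  also have "\<dots> \<le> Zbound"
    unfolding Zbound_def by (intro add_mono err_sum_expectation(2) shift_expectation(2) Sexp)
  finally show "expectation Zn \<le> Zbound" .
qed

section \<open>Uniformity over the perturbation\<close>

text \<open>A single measurable majorant of the supremum. The maximum over the finite net is
  replaced by a sum, both signs of the slack serve the two sides of the bracket, and L s pays for
  replacing \<tau>_0 by the net value in the linear term.\<close>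

definition W where
  "W N s \<omega> = (\<Sum>g\<in>N. \<bar>q * (\<Sum>t\<in>{1..int n}. D g s t \<omega>)\<bar> + \<bar>q * (\<Sum>t\<in>{1..int n}. D g (- s) t \<omega>)\<bar>)
     + Zn \<omega> + s * Bn \<omega> + L * s"

definition step where
  "step \<tau> s \<omega> = q * (\<Sum>t\<in>{1..int n}. of_bool (\<epsilon> t \<omega> \<le> x + (aa t \<omega> + pert \<tau> s t \<omega>)) - of_bool (\<epsilon> t \<omega> \<le> x))"

lemma step_bound:
  assumes g: "\<And>j. j \<le> p \<Longrightarrow> \<bar>g j\<bar> \<le> \<Theta>" and s: "\<bar>s\<bar> \<le> 1"
  shows "\<bar>step g s \<omega> - gx * g 0 - \<gamma> * outlier_shift p \<beta> G0 P\<xi> x\<bar>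
    \<le> \<bar>q * (\<Sum>t\<in>{1..int n}. D g s t \<omega>)\<bar> + (Zn \<omega> + \<bar>s\<bar> * Bn \<omega>)"
proof -
  let ?C = "q * (\<Sum>t\<in>{1..int n}. F (x + (aa t \<omega> + pert g s t \<omega>)) - F x)"
  have "step g s \<omega> = q * (\<Sum>t\<in>{1..int n}. D g s t \<omega>) + ?C"
    unfolding step_def D_def distrib_left[symmetric] sum.distrib[symmetric] by simp
  then have eq: "step g s \<omega> - gx * g 0 - \<gamma> * outlier_shift p \<beta> G0 P\<xi> x
      = q * (\<Sum>t\<in>{1..int n}. D g s t \<omega>) + (?C - gx * g 0 - \<gamma> * outlier_shift p \<beta> G0 P\<xi> x)"
    by simp
  show ?thesis
    unfolding eq by (rule order_trans[OF abs_triangle_ineq add_left_mono[OF compensator_expansion[of g s \<omega>, OF g s]]])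
qed

lemma pert_diff:
  assumes "\<And>j. j \<le> p \<Longrightarrow> \<bar>\<tau> j - g j\<bar> \<le> s"
  shows "\<bar>pert \<tau> 0 t \<omega> - pert g 0 t \<omega>\<bar> \<le> s * (q * (cc t \<omega> + ee t \<omega>))"
proof -
  let ?u = "\<lambda>j. U (t - int j) \<omega>" and ?y = "\<lambda>j. Z (t - int j) \<omega> * Xi (t - int j) \<omega>"
  have bd: "\<bar>\<Sum>j=1..p. (\<tau> j - g j) * f j\<bar> \<le> s * (\<Sum>j=1..p. \<bar>f j\<bar>)" for f :: "nat \<Rightarrow> real"
    unfolding sum_distrib_left
    by (rule order_trans[OF sum_abs sum_mono]) (use assms in \<open>auto simp: abs_mult intro: mult_right_mono\<close>)
  have y: "(\<Sum>j=1..p. \<bar>?y j\<bar>) = ee t \<omega>"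
    unfolding ee_def by (simp add: abs_mult Z_nonneg)
  have eq: "pert \<tau> 0 t \<omega> - pert g 0 t \<omega>
      = q * ((\<tau> 0 - g 0) + (\<Sum>j=1..p. (\<tau> j - g j) * ?u j) + (\<Sum>j=1..p. (\<tau> j - g j) * ?y j))"
    unfolding pert_def lin_def by (simp add: left_diff_distrib sum_subtractf algebra_simps)
  have "\<bar>pert \<tau> 0 t \<omega> - pert g 0 t \<omega>\<bar> = q * \<bar>(\<tau> 0 - g 0) + (\<Sum>j=1..p. (\<tau> j - g j) * ?u j) + (\<Sum>j=1..p. (\<tau> j - g j) * ?y j)\<bar>"
    unfolding eq by (simp only: abs_mult[of q] abs_of_pos[OF q_pos])
  also have "\<dots> \<le> q * (s + s * (\<Sum>j=1..p. \<bar>?u j\<bar>) + s * ee t \<omega>)"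
    using q_pos assms[of 0] bd[of ?u] bd[of ?y] unfolding y
    by (intro mult_left_mono order_trans[OF abs_triangle_ineq] add_mono) auto
  also have "\<dots> = s * (q * (cc t \<omega> + ee t \<omega>))"
    unfolding cc_def by (simp add: algebra_simps)
  finally show ?thesis .
qed

lemma pert_shift: "pert g s t \<omega> = pert g 0 t \<omega> + s * (q * (cc t \<omega> + ee t \<omega>))"
  unfolding pert_def by simp

text \<open>Moving from \<tau> to g changes the perturbation at time t by at most s times its
  envelope, and this is exactly the slack added or subtracted. Monotonicity of the indicator in its
  threshold does the rest.\<close>

lemma step_bracket:
  assumes "\<And>j. j \<le> p \<Longrightarrow> \<bar>\<tau> j - g j\<bar> \<le> s"
  shows "step g (- s) \<omega> \<le> step \<tau> 0 \<omega>" "step \<tau> 0 \<omega> \<le> step g s \<omega>"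
proof -
  have bd: "pert \<tau> 0 t \<omega> \<le> pert g s t \<omega>" "pert g (- s) t \<omega> \<le> pert \<tau> 0 t \<omega>" for t
    using pert_diff[of \<tau> g s t \<omega>, OF assms] unfolding pert_shift[of g s] pert_shift[of g "- s"] by auto
  have ob: "(of_bool A :: real) - c \<le> of_bool B - c" if "A \<Longrightarrow> B" for A B c
    using that by (auto simp: of_bool_def)
  have mono: "step f a \<omega> \<le> step f' a' \<omega>" if le: "\<And>t. pert f a t \<omega> \<le> pert f' a' t \<omega>" for f a f' a'
    unfolding step_def
  proof (intro mult_left_mono sum_mono ob)
    fix t assume "\<epsilon> t \<omega> \<le> x + (aa t \<omega> + pert f a t \<omega>)"
    then show "\<epsilon> t \<omega> \<le> x + (aa t \<omega> + pert f' a' t \<omega>)" using le[of t] by linarith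
  qed (use q_pos in simp)
  show "step g (- s) \<omega> \<le> step \<tau> 0 \<omega>" by (rule mono[OF bd(2)])
  show "step \<tau> 0 \<omega> \<le> step g s \<omega>" by (rule mono[OF bd(1)])
qed

lemma sup_bound:
  assumes s: "0 \<le> s" "s \<le> 1" and N: "finite N" "\<And>g i. g \<in> N \<Longrightarrow> i \<le> p \<Longrightarrow> \<bar>g i\<bar> \<le> \<Theta>"
    and net: "g \<in> N" "\<And>j. j \<le> p \<Longrightarrow> \<bar>\<tau> j - g j\<bar> \<le> s"
  shows "\<bar>step \<tau> 0 \<omega> - gx * \<tau> 0 - \<gamma> * outlier_shift p \<beta> G0 P\<xi> x\<bar> \<le> W N s \<omega>"
proof -
  let ?M = "\<lambda>g s. \<bar>q * (\<Sum>t\<in>{1..int n}. D g s t \<omega>)\<bar>" and ?\<Delta> = "\<gamma> * outlier_shift p \<beta> G0 P\<xi> x"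
  have up: "\<bar>step g s \<omega> - gx * g 0 - ?\<Delta>\<bar> \<le> ?M g s + (Zn \<omega> + s * Bn \<omega>)"
    using step_bound[of g s \<omega>, OF N(2)[OF net(1)]] s by simp
  have lo: "\<bar>step g (- s) \<omega> - gx * g 0 - ?\<Delta>\<bar> \<le> ?M g (- s) + (Zn \<omega> + s * Bn \<omega>)"
    using step_bound[of g "- s" \<omega>, OF N(2)[OF net(1)]] s by simp
  have "\<bar>gx * (\<tau> 0 - g 0)\<bar> \<le> L * s"
    using net(2)[of 0] gx_bound s unfolding abs_mult by (intro mult_mono) auto
  then have lip: "\<bar>gx * \<tau> 0 - gx * g 0\<bar> \<le> L * s" by (simp only: right_diff_distrib)
  have memb: "?M g s + ?M g (- s) \<le> (\<Sum>g\<in>N. ?M g s + ?M g (- s))"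
    by (rule member_le_sum[OF net(1), of "\<lambda>g. ?M g s + ?M g (- s)"]) (use N(1) in auto)
  \<comment> \<open>The bracketing inequality in plain real numbers: \<open>a\<close> lies between
    \<open>a1\<close> and \<open>a2\<close>, both close to c' + d, and \<open>S\<close> covers the
    martingale terms of both ends.\<close>
  have gen: "\<bar>a - c - d\<bar> \<le> S + Zw + B + l"
    if "a1 \<le> a" "a \<le> a2" "\<bar>a2 - c' - d\<bar> \<le> m2 + (Zw + B)" "\<bar>a1 - c' - d\<bar> \<le> m1 + (Zw + B)"
      "\<bar>c - c'\<bar> \<le> l" "m2 + m1 \<le> S" "0 \<le> m1" "0 \<le> m2" for a a1 a2 c c' d m1 m2 Zw B S l :: real
    using that by linarith
  show ?thesis unfolding W_def
    by (rule gen[OF step_bracket[of \<tau> g s \<omega>, OF net(2)] up lo lip memb]) auto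
qed

lemma W_expectation:
  assumes s: "0 \<le> s" "s \<le> 1" and N: "finite N" "\<And>g i. g \<in> N \<Longrightarrow> i \<le> p \<Longrightarrow> \<bar>g i\<bar> \<le> \<Theta>"
  shows "integrable M (W N s)"
    and "expectation (W N s) \<le> real (card N) * (2 * sqrt (q * CM)) + Zbound + s * (L * C2 + L)"
proof -
  let ?M = "\<lambda>g s \<omega>. \<bar>q * (\<Sum>t\<in>{1..int n}. D g s t \<omega>)\<bar>"
  have Mi: "integrable M (?M g \<sigma>)" "expectation (?M g \<sigma>) \<le> sqrt (q * CM)"
    if "g \<in> N" "\<bar>\<sigma>\<bar> \<le> 1" for g \<sigma>
    using D_sum[of g \<sigma>, OF N(2)[OF that(1)] that(2)] by auto
  have s': "\<bar>s\<bar> \<le> 1" "\<bar>- s\<bar> \<le> 1" using s by auto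
  have sumi: "integrable M (\<lambda>\<omega>. \<Sum>g\<in>N. ?M g s \<omega> + ?M g (- s) \<omega>)"
    using Mi(1)[OF _ s'(1)] Mi(1)[OF _ s'(2)] by (intro Bochner_Integration.integrable_sum Bochner_Integration.integrable_add)
  have Bi: "integrable M (\<lambda>\<omega>. s * Bn \<omega>)" using Bn_expectation(1) by simp
  show "integrable M (W N s)"
    unfolding W_def[abs_def] using sumi Bi Zn_expectation(1) by (intro Bochner_Integration.integrable_add) auto
  have "expectation (\<lambda>\<omega>. \<Sum>g\<in>N. ?M g s \<omega> + ?M g (- s) \<omega>) = (\<Sum>g\<in>N. expectation (?M g s) + expectation (?M g (- s)))"
    using Mi(1)[OF _ s'(1)] Mi(1)[OF _ s'(2)]
    by (subst Bochner_Integration.integral_sum) (auto intro!: sum.cong Bochner_Integration.integral_add)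
  also have "\<dots> \<le> (\<Sum>g\<in>N. sqrt (q * CM) + sqrt (q * CM))"
    using Mi(2)[OF _ s'(1)] Mi(2)[OF _ s'(2)] by (intro sum_mono add_mono)
  finally have sume: "expectation (\<lambda>\<omega>. \<Sum>g\<in>N. ?M g s \<omega> + ?M g (- s) \<omega>) \<le> real (card N) * (2 * sqrt (q * CM))"
    by simp
  have "expectation (W N s) = expectation (\<lambda>\<omega>. \<Sum>g\<in>N. ?M g s \<omega> + ?M g (- s) \<omega>) + expectation Zn + s * expectation Bn + L * s"
    unfolding W_def[abs_def] using sumi Bn_expectation(1) Zn_expectation(1) by (simp add: prob_space)
  also have "\<dots> \<le> real (card N) * (2 * sqrt (q * CM)) + Zbound + s * (L * C2) + L * s"
    using s L_nonneg by (intro add_mono sume Zn_expectation(2) mult_left_mono Bn_expectation(2)) auto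
  finally show "expectation (W N s) \<le> real (card N) * (2 * sqrt (q * CM)) + Zbound + s * (L * C2 + L)"
    by (simp add: algebra_simps)
qed

text \<open>The two sides agree only on outcomes where \<open>v\<close> equals the causal series and
  the indicators are binary; both conditions hold almost surely.\<close>

lemma step_eq:
  assumes vU: "\<forall>t. v t \<omega> - \<mu> = U t \<omega>" and z: "\<forall>t\<in>J. z t \<omega> = 0 \<or> z t \<omega> = 1"
    and \<tau>: "\<And>j. \<tau> j = (if j = 0 then \<tau>0 else \<tau>1 j)"
  shows "sqrt (real n) * (perturbed_emp_cdf p \<beta> n \<epsilon> (\<lambda>t \<omega>. v t \<omega> - \<mu>) z \<xi> x \<tau>0 \<tau>1 \<omega> - emp_cdf n \<epsilon> x \<omega>)
    = step \<tau> 0 \<omega>"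
proof -
  have zZ: "z r \<omega> = Z r \<omega>" "\<xi> r \<omega> = Xi r \<omega>" if "r \<in> J" for r
    using z that by (auto simp: Z_def Xi_def)
  have lag: "z (t - int j) \<omega> = Z (t - int j) \<omega>" "\<xi> (t - int j) \<omega> = Xi (t - int j) \<omega>"
    if "t \<in> {1..int n}" "j \<le> p" for t j
    using zZ[OF lag_in_J[OF that]] by auto
  have arg: "x + (\<Sum>j=1..p. \<tau>1 j * (v (t - int j) \<omega> - \<mu>)) / sqrt (real n) + \<tau>0 / sqrt (real n)
       - outlier_term p \<beta> z \<xi> t \<omega> + (\<Sum>j=1..p. \<tau>1 j / sqrt (real n) * z (t - int j) \<omega> * \<xi> (t - int j) \<omega>)
     = x + (aa t \<omega> + pert \<tau> 0 t \<omega>)" if t: "t \<in> {1..int n}" for t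
  proof -
    have a: "aa t \<omega> = - outlier_term p \<beta> z \<xi> t \<omega>"
    proof -
      have "aa t \<omega> = - (Z t \<omega> * Xi t \<omega>) + (\<Sum>j=1..p. \<beta> j * (Z (t - int j) \<omega> * Xi (t - int j) \<omega>))"
        unfolding aa_def by (subst sum.atLeast_Suc_atMost) (auto intro!: sum.cong)
      also have "(\<Sum>j=1..p. \<beta> j * (Z (t - int j) \<omega> * Xi (t - int j) \<omega>))
          = (\<Sum>j=1..p. \<beta> j * z (t - int j) \<omega> * \<xi> (t - int j) \<omega>)"
        using lag[OF t] by (intro sum.cong) auto
      also have "Z t \<omega> * Xi t \<omega> = z t \<omega> * \<xi> t \<omega>" using lag[OF t, of 0] by simp
      finally show ?thesis unfolding outlier_term_def by simp
    qed
    have u: "(\<Sum>j=1..p. \<tau>1 j * (v (t - int j) \<omega> - \<mu>)) / sqrt (real n) = q * (\<Sum>j=1..p. \<tau> j * U (t - int j) \<omega>)"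
    proof -
      have "(\<Sum>j=1..p. \<tau>1 j * (v (t - int j) \<omega> - \<mu>)) = (\<Sum>j=1..p. \<tau> j * U (t - int j) \<omega>)"
        by (intro sum.cong refl) (simp add: vU \<tau>)
      then show ?thesis by (simp add: q_def)
    qed
    have y: "(\<Sum>j=1..p. \<tau>1 j / sqrt (real n) * z (t - int j) \<omega> * \<xi> (t - int j) \<omega>)
        = q * (\<Sum>j=1..p. \<tau> j * (Z (t - int j) \<omega> * Xi (t - int j) \<omega>))"
      unfolding sum_distrib_left using lag[OF t] by (intro sum.cong refl) (simp add: \<tau> q_def)
    have "q * \<tau> 0 = \<tau>0 / sqrt (real n)" by (simp add: \<tau> q_def)
    then show ?thesis unfolding u y a pert_def lin_def by (simp add: distrib_left)
  qed
  have "perturbed_emp_cdf p \<beta> n \<epsilon> (\<lambda>t \<omega>. v t \<omega> - \<mu>) z \<xi> x \<tau>0 \<tau>1 \<omega> - emp_cdf n \<epsilon> x \<omega>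
     = (\<Sum>t\<in>{1..int n}. of_bool (\<epsilon> t \<omega> \<le> x + (aa t \<omega> + pert \<tau> 0 t \<omega>)) - of_bool (\<epsilon> t \<omega> \<le> x)) / real n"
    unfolding perturbed_emp_cdf_def emp_cdf_def diff_divide_distrib[symmetric] sum_subtractf[symmetric]
    by (intro arg_cong[where f="\<lambda>y. y / real n"] sum.cong refl) (simp only: arg)
  moreover have "sqrt (real n) * (y / real n) = q * y" for y
    unfolding q_def using n_pos by (simp add: field_simps)
  ultimately show ?thesis unfolding step_def by simp
qed

lemma z_binary: "AE \<omega> in M. \<forall>t\<in>J. z t \<omega> = 0 \<or> z t \<omega> = 1"
proof (rule AE_finite_allI)
  show "finite J" by (simp add: J_def)
  fix t assume t: "t \<in> J"
  then have [measurable]: "z t \<in> borel_measurable M"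
    using coord_measurable_M[OF subset_refl measurable_coord[of "Inr (Inl t)" I X M]] by (auto simp: I_def)
  have "prob {\<omega> \<in> space M. z t \<omega> = 0 \<or> z t \<omega> = 1}
      = prob ({\<omega> \<in> space M. z t \<omega> = 0} \<union> {\<omega> \<in> space M. z t \<omega> = 1})"
    by (rule arg_cong[where f=prob]) auto
  also have "\<dots> = prob {\<omega> \<in> space M. z t \<omega> = 0} + prob {\<omega> \<in> space M. z t \<omega> = 1}"
    by (rule finite_measure_Union) auto
  also have "\<dots> = 1" using indicator_one[of t] indicator_zero[of t] t by (simp add: J_def)
  finally show "AE \<omega> in M. z t \<omega> = 0 \<or> z t \<omega> = 1"
    by (subst (asm) prob_Collect_eq_1) auto
qed

lemma prob_sup_bound:
  assumes s: "0 < s" "s \<le> 1" and N: "finite N" "\<And>g i. g \<in> N \<Longrightarrow> i \<le> p \<Longrightarrow> \<bar>g i\<bar> \<le> \<Theta>"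
    and net: "\<And>\<tau>. (\<And>i. i \<le> p \<Longrightarrow> \<bar>\<tau> i\<bar> \<le> \<Theta>) \<Longrightarrow> \<exists>g\<in>N. \<forall>i\<le>p. \<bar>\<tau> i - g i\<bar> \<le> s"
    and \<delta>: "0 < \<delta>"
  shows "prob {\<omega> \<in> space M.
      (SUP (\<tau>0, \<tau>1) \<in> {(\<tau>0, \<tau>1). \<bar>\<tau>0\<bar> \<le> \<Theta> \<and> L2_set \<tau>1 {1..p} \<le> \<Theta>}.
        \<bar>sqrt (real n) * (perturbed_emp_cdf p \<beta> n \<epsilon> (\<lambda>t \<omega>. v t \<omega> - \<mu>) z \<xi> x \<tau>0 \<tau>1 \<omega> - emp_cdf n \<epsilon> x \<omega>)
          - gx * \<tau>0 - \<gamma> * outlier_shift p \<beta> G0 P\<xi> x\<bar>) > \<delta>}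
    \<le> (real (card N) * (2 * sqrt (q * CM)) + Zbound + s * (L * C2 + L)) / \<delta>" (is "prob ?A \<le> _")
proof -
  let ?S = "{(\<tau>0, \<tau>1). \<bar>\<tau>0\<bar> \<le> \<Theta> \<and> L2_set \<tau>1 {1..p} \<le> \<Theta>}"
  have We: "integrable M (W N s)"
      "expectation (W N s) \<le> real (card N) * (2 * sqrt (q * CM)) + Zbound + s * (L * C2 + L)"
    using s N by (intro W_expectation; simp)+
  have [measurable]: "W N s \<in> borel_measurable M" using We(1) by simp
  have AE: "AE \<omega> in M. (SUP (\<tau>0, \<tau>1) \<in> ?S.
        \<bar>sqrt (real n) * (perturbed_emp_cdf p \<beta> n \<epsilon> (\<lambda>t \<omega>. v t \<omega> - \<mu>) z \<xi> x \<tau>0 \<tau>1 \<omega> - emp_cdf n \<epsilon> x \<omega>)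
          - gx * \<tau>0 - \<gamma> * outlier_shift p \<beta> G0 P\<xi> x\<bar>) \<le> W N s \<omega> \<and> 0 \<le> W N s \<omega>"
    using stationary_solution_causal z_binary
  proof eventually_elim
    case (elim \<omega>)
    have bd: "\<bar>sqrt (real n) * (perturbed_emp_cdf p \<beta> n \<epsilon> (\<lambda>t \<omega>. v t \<omega> - \<mu>) z \<xi> x \<tau>0 \<tau>1 \<omega> - emp_cdf n \<epsilon> x \<omega>)
          - gx * \<tau>0 - \<gamma> * outlier_shift p \<beta> G0 P\<xi> x\<bar> \<le> W N s \<omega>"
      if \<tau>01: "\<bar>\<tau>0\<bar> \<le> \<Theta>" "L2_set \<tau>1 {1..p} \<le> \<Theta>" for \<tau>0 \<tau>1
    proof -
      \<comment> \<open>Both parameters are merged into one vector. Each coordinate is bounded by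
        the Euclidean norm, so the ball lies in the cube covered by the net.\<close>
      define \<tau> where "\<tau> j = (if j = 0 then \<tau>0 else \<tau>1 j)" for j :: nat
      have "\<bar>\<tau> j\<bar> \<le> \<Theta>" if "j \<le> p" for j
      proof (cases "j = 0")
        case False
        then have "\<bar>\<tau>1 j\<bar> \<le> L2_set (\<lambda>j. \<bar>\<tau>1 j\<bar>) {1..p}"
          using that by (intro member_le_L2_set) auto
        also have "\<dots> = L2_set \<tau>1 {1..p}" by (simp add: L2_set_def)
        finally show ?thesis using False \<tau>01 by (simp add: \<tau>_def)
      qed (simp add: \<tau>_def \<tau>01)
      then obtain g where g: "g \<in> N" "\<forall>i\<le>p. \<bar>\<tau> i - g i\<bar> \<le> s" using net by blast
      have "\<bar>step \<tau> 0 \<omega> - gx * \<tau> 0 - \<gamma> * outlier_shift p \<beta> G0 P\<xi> x\<bar> \<le> W N s \<omega>"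
        using s N g by (intro sup_bound[of s N g \<tau> \<omega>]) simp_all
      then show ?thesis unfolding step_eq[OF elim \<tau>_def] by (simp add: \<tau>_def)
    qed
    have L0: "L2_set (\<lambda>_. 0) {1..p} = 0" by (simp add: L2_set_def)
    \<comment> \<open>The zero perturbation makes the index set nonempty, as a supremum of reals
      requires, and yields W \<ge> 0 for Markov's inequality.\<close>
    have "(0, \<lambda>_. 0) \<in> ?S" using \<Theta>_nonneg L0 by simp
    then have "?S \<noteq> {}" by blast
    then have "(SUP (\<tau>0, \<tau>1) \<in> ?S.
        \<bar>sqrt (real n) * (perturbed_emp_cdf p \<beta> n \<epsilon> (\<lambda>t \<omega>. v t \<omega> - \<mu>) z \<xi> x \<tau>0 \<tau>1 \<omega> - emp_cdf n \<epsilon> x \<omega>)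
          - gx * \<tau>0 - \<gamma> * outlier_shift p \<beta> G0 P\<xi> x\<bar>) \<le> W N s \<omega>"
      by (rule cSUP_least) (use bd in auto)
    moreover have "0 \<le> W N s \<omega>"
      using order_trans[OF abs_ge_zero bd[of 0 "\<lambda>_. 0"]] \<Theta>_nonneg L0 by simp
    ultimately show ?case by blast
  qed
  \<comment> \<open>The comparison asks for measurability of the larger event only, so the
    uncountable supremum is never shown to be measurable.\<close>
  have "prob ?A \<le> prob {\<omega> \<in> space M. W N s \<omega> \<ge> \<delta>}"
    by (rule finite_measure_mono_AE) (use AE in \<open>auto elim!: eventually_mono\<close>)
  also have "\<dots> \<le> expectation (W N s) / \<delta>"
    by (rule integral_Markov_inequality_measure[OF We(1) sets.empty_sets _ \<delta>]) (use AE in eventually_elim, simp)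
  also have "\<dots> \<le> (real (card N) * (2 * sqrt (q * CM)) + Zbound + s * (L * C2 + L)) / \<delta>"
    using We(2) \<delta> by (intro divide_right_mono) auto
  finally show ?thesis .
qed

section \<open>Explicit dependence on the sample size and passage to the limit\<close>

definition E1 where
  "E1 = K * \<theta>\<^sup>2 * C2 + 2 * R * (real (p + 1) * \<Gamma> + L * \<theta> * C2)
     + real (p + 2) * (real (p + 1))\<^sup>2 * \<Gamma>\<^sup>2 + L * \<Theta> * real p * CS"

definition E2 where "E2 = 2 * (L * \<theta>) * (real (p + 1) * (\<Gamma> + C2))"

text \<open>Rewritten with n in place of the abbreviations of the locale, so that the limit can be
  taken outside it.\<close>

lemma Zbound_eq:
  "Zbound = E1 * (1 / sqrt (real n)) + E2 * sqrt (1 / sqrt (real n))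
     + real p * \<Gamma> * (LINT s|P\<xi>. min 1 (L * (\<Theta> + 1) * (1 / sqrt (real n)) * \<bar>s\<bar>))
     + real (p + 1) * sqrt (\<Gamma> * (1 / sqrt (real n)))"
  unfolding Zbound_def E1_def E2_def \<kappa>_def q_def[symmetric] by (simp add: algebra_simps)

end

theorem theorem2p1:
  fixes p :: nat and \<beta> :: "nat \<Rightarrow> real" and \<nu> \<mu> :: real
    and P0 PH P\<xi> :: "real measure"
    and G0 H g0 g0' h h' :: "real \<Rightarrow> real"
    and \<Gamma> R \<Theta> x \<delta> :: real
    and M :: "nat \<Rightarrow> real \<Rightarrow> real \<Rightarrow> 'w measure"
    and \<epsilon> v z \<xi> :: "nat \<Rightarrow> real \<Rightarrow> real \<Rightarrow> int \<Rightarrow> 'w \<Rightarrow> real"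
  assumes "p \<ge> 1"
    and "char_roots_inside p \<beta>"
    and "\<nu> = (1 - (\<Sum>j=1..p. \<beta> j)) * \<mu>"
    and "real_distribution P0" and "G0 = cdf P0"
    and "real_distribution PH" and "H = cdf PH"
    and "real_distribution P\<xi>"
    and "integrable P0 (\<lambda>s. s)" and "(LINT s|P0. s) = 0" and "integrable P0 (\<lambda>s. s\<^sup>2)"
    and "integrable PH (\<lambda>s. s)" and "(LINT s|PH. s) = 0" and "integrable PH (\<lambda>s. s\<^sup>2)"
    and "\<And>s. (G0 has_real_derivative g0 s) (at s)"
    and "\<And>s. (g0 has_real_derivative g0' s) (at s)" and "bounded (range g0')"
    and "\<And>s. (H has_real_derivative h s) (at s)"
    and "\<And>s. (h has_real_derivative h' s) (at s)" and "bounded (range h')"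
    and "\<Gamma> \<ge> 0" and "R \<ge> 0" and "\<Theta> \<ge> 0"
    and "\<And>n \<gamma> \<rho>. n \<ge> 1 \<Longrightarrow> \<gamma> \<in> {0..\<Gamma>} \<Longrightarrow> \<rho> \<in> {0..R} \<Longrightarrow>
           ar_outlier_model (M n \<gamma> \<rho>) p \<beta> \<nu> G0 H P\<xi> n \<gamma> \<rho>
             (\<epsilon> n \<gamma> \<rho>) (v n \<gamma> \<rho>) (z n \<gamma> \<rho>) (\<xi> n \<gamma> \<rho>)"
    and "\<delta> > 0"
  shows "(\<lambda>n. SUP (\<gamma>, \<rho>) \<in> {0..\<Gamma>} \<times> {0..R}.
            measure (M n \<gamma> \<rho>) {\<omega> \<in> space (M n \<gamma> \<rho>).
              (SUP (\<tau>0, \<tau>1) \<in> {(\<tau>0, \<tau>1). \<bar>\<tau>0\<bar> \<le> \<Theta> \<and> L2_set \<tau>1 {1..p} \<le> \<Theta>}.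
                 \<bar>sqrt (real n) *
                    (perturbed_emp_cdf p \<beta> n (\<epsilon> n \<gamma> \<rho>) (\<lambda>t \<omega>. v n \<gamma> \<rho> t \<omega> - \<mu>)
                       (z n \<gamma> \<rho>) (\<xi> n \<gamma> \<rho>) x \<tau>0 \<tau>1 \<omega>
                     - emp_cdf n (\<epsilon> n \<gamma> \<rho>) x \<omega>)
                  - g0 x * \<tau>0 - \<gamma> * outlier_shift p \<beta> G0 P\<xi> x\<bar>) > \<delta>}) \<longlonglongrightarrow> 0"
proof -
  note roots = assms(2) and mean = assms(3) and P0 = assms(4,5) and PH = assms(6,7)
    and P\<xi> = assms(8) and P0_mom = assms(9-11) and PH_mom = assms(12-14)
    and G0_deriv = assms(15,16) and H_deriv = assms(18,19) and nonneg = assms(21-23)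
    and model = assms(24) and \<delta> = assms(25)
  interpret P0: real_distribution P0 by (rule P0(1))
  interpret PH: real_distribution PH by (rule PH(1))
  obtain \<psi> c where \<psi>: "summable (\<lambda>i. \<bar>\<psi> i\<bar>)" and c: "\<And>j. (\<lambda>k. c k j) \<longlonglongrightarrow> 0"
    and iter: "\<And>(u :: int \<Rightarrow> real) e t k. (\<And>t. u t = (\<Sum>j=1..p. \<beta> j * u (t - int j)) + e t) \<Longrightarrow>
       u t = (\<Sum>i\<le>k. \<psi> i * e (t - int i)) + (\<Sum>j=1..p. c k j * u (t - int k - int j))"
    by (rule ar_iteration[OF roots]) blast
  obtain K0 KH where K0: "\<And>s. \<bar>g0' s\<bar> \<le> K0" and KH: "\<And>s. \<bar>h' s\<bar> \<le> KH"
    using assms(17,20) unfolding bounded_iff by auto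
  define K where "K = max K0 KH"
  have K: "\<And>s. \<bar>g0' s\<bar> \<le> K" "\<And>s. \<bar>h' s\<bar> \<le> K"
    using K0 KH unfolding K_def by (simp_all add: le_max_iff_disj)
  define L where "L = 1 + K"
  have K_nonneg: "0 \<le> K" using order_trans[OF abs_ge_zero K(1)] .
  have G0_range: "0 \<le> G0 y" "G0 y \<le> 1" and H_range: "0 \<le> H y" "H y \<le> 1" for y
    unfolding P0 PH by (rule P0.cdf_range PH.cdf_range)+
  note G0_bounds = bounded_density[of G0 g0 g0' K, OF G0_deriv K(1) G0_range]
  note H_bounds = bounded_density[of H h h' K, OF H_deriv K(2) H_range]
  have G0_meas: "G0 \<in> borel_measurable borel" and H_meas: "H \<in> borel_measurable borel"
    using G0_deriv(1) H_deriv(1)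
    by (auto intro!: borel_measurable_continuous_onI continuous_at_imp_continuous_on DERIV_isCont)
  define V where "V = (LINT s|P0. s\<^sup>2) + (LINT s|PH. s\<^sup>2)"
  \<comment> \<open>Otherwise w = 1 would be a characteristic root on the unit circle.\<close>
  have sum1: "(\<Sum>j=1..p. \<beta> j) \<noteq> 1"
  proof
    assume s1: "(\<Sum>j=1..p. \<beta> j) = 1"
    have "(1::complex) ^ p - (\<Sum>j=1..p. of_real (\<beta> j) * 1 ^ (p - j)) = of_real (1 - (\<Sum>j=1..p. \<beta> j))"
      by simp
    also have "\<dots> = 0" unfolding s1 by simp
    finally have "cmod 1 < 1" using roots unfolding char_roots_inside_def by blast
    then show False by simp
  qed
  have expansion: "outlier_expansion (M n \<gamma> \<rho>) p \<beta> \<nu> G0 H P\<xi> n \<gamma> \<rho> (\<epsilon> n \<gamma> \<rho>) (v n \<gamma> \<rho>) (z n \<gamma> \<rho>) (\<xi> n \<gamma> \<rho>)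
      \<mu> V \<psi> c x \<Theta> \<Gamma> R K L (g0 x)"
    if n: "n \<ge> 1" "\<Gamma> \<le> sqrt (real n)" and \<gamma>: "\<gamma> \<in> {0..\<Gamma>}" and \<rho>: "\<rho> \<in> {0..R}" for n \<gamma> \<rho>
  proof -
    interpret ar_outlier_model "M n \<gamma> \<rho>" p \<beta> \<nu> G0 H P\<xi> n \<gamma> \<rho> "\<epsilon> n \<gamma> \<rho>" "v n \<gamma> \<rho>" "z n \<gamma> \<rho>" "\<xi> n \<gamma> \<rho>"
      by (rule model[OF n(1) \<gamma> \<rho>])
    have \<rho>0: "0 \<le> \<rho>" using \<rho> by simp
    note mom = innovation_moments[OF P0 PH \<rho>0]
    have r: "0 \<le> local_rate \<rho> n" "local_rate \<rho> n \<le> 1" using \<rho>0 unfolding local_rate_def by auto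
    show ?thesis
    proof (intro outlier_expansion.intro outlier_bounds.intro outlier_bounds_axioms.intro outlier_expansion_axioms.intro)
      show "ar_outlier_model (M n \<gamma> \<rho>) p \<beta> \<nu> G0 H P\<xi> n \<gamma> \<rho> (\<epsilon> n \<gamma> \<rho>) (v n \<gamma> \<rho>) (z n \<gamma> \<rho>) (\<xi> n \<gamma> \<rho>)"
        by (rule model[OF n(1) \<gamma> \<rho>])
      show "integrable (M n \<gamma> \<rho>) (\<lambda>\<omega>. (\<epsilon> n \<gamma> \<rho> t \<omega>)\<^sup>2)" for t
        by (rule mom(1)[OF P0_mom(3) PH_mom(3)])
      show "expectation (\<epsilon> n \<gamma> \<rho> t) = 0" for t
        using mom(2)[OF P0_mom(1) PH_mom(1), of t] P0_mom(2) PH_mom(2) by simp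
      show "expectation (\<lambda>\<omega>. (\<epsilon> n \<gamma> \<rho> t \<omega>)\<^sup>2) \<le> V" for t
      proof -
        \<comment> \<open>Each mixture weight is at most 1, so the sum of both second moments works
          for every \<rho>.\<close>
        have "(1 - local_rate \<rho> n) * (LINT s|P0. s\<^sup>2) + local_rate \<rho> n * (LINT s|PH. s\<^sup>2) \<le> V"
          unfolding V_def using r by (intro add_mono mult_left_le_one_le) (auto intro!: Bochner_Integration.integral_nonneg)
        then show ?thesis unfolding mom(2)[OF P0_mom(3) PH_mom(3)] .
      qed
      show "u t = (\<Sum>i\<le>k. \<psi> i * e (t - int i)) + (\<Sum>j=1..p. c k j * u (t - int k - int j))"
        if "\<And>t. u t = (\<Sum>j=1..p. \<beta> j * u (t - int j)) + e t" for u e :: "int \<Rightarrow> real" and t k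
        by (rule iter) (rule that)
      show "\<bar>G0 (x + w) - G0 x - g0 x * w\<bar> \<le> K * w\<^sup>2" for w by (rule G0_bounds(1))
      show "\<bar>g0 x\<bar> \<le> L" unfolding L_def by (rule G0_bounds(2))
      show "\<bar>G0 (y + w) - G0 y\<bar> \<le> L * \<bar>w\<bar>" for y w unfolding L_def by (rule G0_bounds(3))
      show "\<bar>H (y + w) - H y\<bar> \<le> L * \<bar>w\<bar>" for y w unfolding L_def by (rule H_bounds(3))
      show "0 \<le> L" using K_nonneg unfolding L_def by simp
    qed (use n \<gamma> \<rho> nonneg P\<xi> mean \<psi> c sum1 K_nonneg G0_range H_range G0_meas H_meas in auto)
  qed
  \<comment> \<open>The exported constants take neither n nor \<gamma>, \<rho> or the probability
    space as arguments; hence \<open>bd\<close> bounds all models of one sample size at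
    once.\<close>
  define a1 a2 cm bb where "a1 = outlier_expansion.E1 p \<beta> V \<psi> \<Theta> \<Gamma> R K L"
    and "a2 = outlier_expansion.E2 p V \<psi> \<Theta> \<Gamma> L" and "cm = outlier_expansion.CM p V \<psi> \<Theta> \<Gamma> L"
    and "bb = L * outlier_expansion.C2 p V \<psi> + L"
  let ?\<kappa> = "\<lambda>n. LINT s|P\<xi>. min 1 (L * (\<Theta> + 1) * (1 / sqrt (real n)) * \<bar>s\<bar>)"
  define bd where "bd m s n = (real m * (2 * sqrt (1 / sqrt (real n) * cm))
      + (a1 * (1 / sqrt (real n)) + a2 * sqrt (1 / sqrt (real n)) + real p * \<Gamma> * ?\<kappa> n
         + real (p + 1) * sqrt (\<Gamma> * (1 / sqrt (real n)))) + s * bb) / \<delta>" for m :: nat and s and n :: nat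
  define pr where "pr n \<gamma> \<rho> = measure (M n \<gamma> \<rho>) {\<omega> \<in> space (M n \<gamma> \<rho>).
              (SUP (\<tau>0, \<tau>1) \<in> {(\<tau>0, \<tau>1). \<bar>\<tau>0\<bar> \<le> \<Theta> \<and> L2_set \<tau>1 {1..p} \<le> \<Theta>}.
                 \<bar>sqrt (real n) *
                    (perturbed_emp_cdf p \<beta> n (\<epsilon> n \<gamma> \<rho>) (\<lambda>t \<omega>. v n \<gamma> \<rho> t \<omega> - \<mu>)
                       (z n \<gamma> \<rho>) (\<xi> n \<gamma> \<rho>) x \<tau>0 \<tau>1 \<omega>
                     - emp_cdf n (\<epsilon> n \<gamma> \<rho>) x \<omega>)
                  - g0 x * \<tau>0 - \<gamma> * outlier_shift p \<beta> G0 P\<xi> x\<bar>) > \<delta>}" for n \<gamma> \<rho>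
  have q_lim: "(\<lambda>n. 1 / sqrt (real n)) \<longlonglongrightarrow> 0"
    by (intro tendsto_divide_0[OF tendsto_const] filterlim_at_top_imp_at_infinity
        filterlim_compose[OF sqrt_at_top] filterlim_real_sequentially)
  have \<kappa>_lim: "?\<kappa> \<longlonglongrightarrow> 0"
    by (rule truncated_moment_lim[OF P\<xi>])
      (use tendsto_mult_right_zero[OF q_lim] K_nonneg nonneg in \<open>auto simp: L_def\<close>)
  have bd_lim: "bd m s \<longlonglongrightarrow> s * bb / \<delta>" for m s
  proof -
    have "bd m s \<longlonglongrightarrow> (real m * (2 * sqrt (0 * cm)) + (a1 * 0 + a2 * sqrt 0 + real p * \<Gamma> * 0
         + real (p + 1) * sqrt (\<Gamma> * 0)) + s * bb) / \<delta>"
      unfolding bd_def using \<delta> by (intro tendsto_intros q_lim \<kappa>_lim) simp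
    then show ?thesis by simp
  qed
  show ?thesis
    unfolding pr_def[symmetric]
  proof (rule tendstoI)
    fix e :: real assume e: "0 < e"
    \<comment> \<open>The only part of the bound that survives as n grows is s bb / \<delta>; this
      choice keeps it at most e / 2. The added 1 avoids division by zero.\<close>
    define s where "s = min 1 (e * \<delta> / (2 * (\<bar>bb\<bar> + 1)))"
    have s: "0 < s" "s \<le> 1" using e \<delta> unfolding s_def by auto
    have sB: "s * bb / \<delta> < e"
    proof -
      have "s * bb \<le> (e * \<delta> / (2 * (\<bar>bb\<bar> + 1))) * (\<bar>bb\<bar> + 1)"
        using s e \<delta> unfolding s_def by (intro order_trans[OF mult_left_mono mult_right_mono]) auto
      also have "\<dots> = e * \<delta> / 2" by (simp add: field_simps)
      also have "\<dots> < e * \<delta>" using e \<delta> by simp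
      finally show ?thesis using \<delta> by (simp add: pos_divide_less_eq)
    qed
    obtain N :: "(nat \<Rightarrow> real) set" where N: "finite N" "\<And>g i. g \<in> N \<Longrightarrow> i \<le> p \<Longrightarrow> \<bar>g i\<bar> \<le> \<Theta>"
      "\<And>\<tau>. (\<And>i. i \<le> p \<Longrightarrow> \<bar>\<tau> i\<bar> \<le> \<Theta>) \<Longrightarrow> \<exists>g\<in>N. \<forall>i\<le>p. \<bar>\<tau> i - g i\<bar> \<le> s"
      by (rule finite_coordinate_net[OF s(1), of p \<Theta>]) blast
    have "\<forall>\<^sub>F n in sequentially. bd (card N) s n < e"
      by (rule order_tendstoD(2)[OF bd_lim sB])
    moreover have "\<forall>\<^sub>F n in sequentially. \<Gamma> \<le> sqrt (real n)"
      using filterlim_compose[OF sqrt_at_top filterlim_real_sequentially] by (simp add: filterlim_at_top)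
    ultimately show "\<forall>\<^sub>F n in sequentially. dist (SUP (\<gamma>, \<rho>)\<in>{0..\<Gamma>} \<times> {0..R}. pr n \<gamma> \<rho>) 0 < e"
      using eventually_ge_at_top[of 1]
    proof eventually_elim
      case (elim n)
      have le: "pr n \<gamma> \<rho> \<le> bd (card N) s n" if "\<gamma> \<in> {0..\<Gamma>}" "\<rho> \<in> {0..R}" for \<gamma> \<rho>
      proof -
        interpret outlier_expansion "M n \<gamma> \<rho>" p \<beta> \<nu> G0 H P\<xi> n \<gamma> \<rho> "\<epsilon> n \<gamma> \<rho>" "v n \<gamma> \<rho>" "z n \<gamma> \<rho>" "\<xi> n \<gamma> \<rho>"
            \<mu> V \<psi> c x \<Theta> \<Gamma> R K L "g0 x"
          by (rule expansion[OF elim(3,2) that])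
        have "pr n \<gamma> \<rho> \<le> (real (card N) * (2 * sqrt (q * CM)) + Zbound + s * (L * C2 + L)) / \<delta>"
          unfolding pr_def
        proof (rule prob_sup_bound[OF s N(1) _ _ \<delta>])
          show "\<bar>g i\<bar> \<le> \<Theta>" if "g \<in> N" "i \<le> p" for g i by (rule N(2)[OF that])
          show "\<exists>g\<in>N. \<forall>i\<le>p. \<bar>\<tau> i - g i\<bar> \<le> s" if "\<And>i. i \<le> p \<Longrightarrow> \<bar>\<tau> i\<bar> \<le> \<Theta>" for \<tau>
            by (rule N(3)[OF that])
        qed
        then show ?thesis
          unfolding Zbound_eq q_def bd_def a1_def a2_def cm_def bb_def .
      qed
      have ge: "0 \<le> pr n \<gamma> \<rho>" for \<gamma> \<rho> unfolding pr_def by simp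
      have ne: "{0..\<Gamma>} \<times> {0..R} \<noteq> {}" using nonneg by auto
      have "(SUP (\<gamma>, \<rho>)\<in>{0..\<Gamma>} \<times> {0..R}. pr n \<gamma> \<rho>) \<le> bd (card N) s n"
        by (rule cSUP_least[OF ne]) (use le in auto)
      moreover have "0 \<le> (SUP (\<gamma>, \<rho>)\<in>{0..\<Gamma>} \<times> {0..R}. pr n \<gamma> \<rho>)"
      \<comment> \<open>A real supremum is nonnegative only if the set is bounded above and contains
        a nonnegative value; the uniform bound and the pair (0, 0) supply these.\<close>
      proof (rule cSUP_upper2[where x="(0, 0)"])
        show "bdd_above ((\<lambda>(\<gamma>, \<rho>). pr n \<gamma> \<rho>) ` ({0..\<Gamma>} \<times> {0..R}))"
          using le by (intro bdd_aboveI[of _ "bd (card N) s n"]) auto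
      qed (use nonneg ge in auto)
      ultimately show ?case using elim(1) by simp
    qed
  qed
qed

end
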